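(* Let $q$ be a prime power with $q\ne2$, $D,N$ integers with $N>2D\ge6$, $\Gamma$ the bilinear forms graph on the set $X$ of $D\times(N-D)$ matrices over $\mathrm{GF}(q)$, $x,y\in X$ adjacent, and $T=T(x)$, $U=U(x,y)$, $L,F,R$, $a_i,b_i,c_i$ as in the context. Then $U$ is an orthogonal direct sum of irreducible $T$-modules $U=W_1+W_2+W_3+W_4+W_5$, where: \begin{enumerate} \item[(i)] $W_1$ is the primary $T$-module; it is thin with endpoint $0$ and diameter $D$, and has a basis $\{w_i\}_{i=0}^D$ with $w_i\in E^*_iU$, $Rw_i=c_{i+1}w_{i+1}$ ($0\le i\le D-1$), $Rw_D=0$, $Lw_i=b_{i-1}w_{i-1}$ ($1\le i\le D$), $Lw_0=0$, $Fw_i=a_iw_i$ ($0\le i\le D$). \item[(ii)] $W_2$ is thin with endpoint $1$, diameter $D-2$, local eigenvalue $q^{N-D}-q-1$, and has a basis $\{w_i\}_{i=1}^{D-1}$ with $w_i\in E^*_iU$, $Rw_i=q^{i+1}\frac{q^i-1}{q-1}w_{i+1}$ ($1\le i\le D-2$), $Rw_{D-1}=0$, $Lw_i=\frac{(q^D-q^i)(q^{N-D}-q^{i-1})}{q(q-1)}w_{i-1}$ ($2\le i\le D-1$), $Lw_1=0$, $Fw_i=(a_i-q^{i-1}(q^D-1))w_i$ ($1\le i\le D-1$). \item[(iii)] $W_3$ is thin with endpoint $1$, diameter $D-1$, local eigenvalue $q^D-q-1$, and has a basis $\{w_i\}_{i=1}^{D}$ with $w_i\in E^*_iU$, $Rw_i=q^{i+1}\frac{q^i-1}{q-1}w_{i+1}$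 ($1\le i\le D-1$), $Rw_D=0$, $Lw_i=\frac{(q^D-q^{i-1})(q^{N-D}-q^{i})}{q(q-1)}w_{i-1}$ ($2\le i\le D$), $Lw_1=0$, $Fw_i=(a_i-q^{i-1}(q^{N-D}-1))w_i$ ($1\le i\le D$). \item[(iv)] $W_4$ is thin with endpoint $1$, diameter $D-1$, local eigenvalue $-1$, and has a basis $\{w_i\}_{i=1}^{D}$ with $w_i\in E^*_iU$, $Rw_i=q^{i}\frac{q^i-1}{q-1}w_{i+1}$ ($1\le i\le D-1$), $Rw_D=0$, $Lw_i=\frac{(q^D-q^{i-1})(q^{N-D}-q^{i-1})}{q(q-1)}w_{i-1}$ ($2\le i\le D$), $Lw_1=0$, $Fw_i=(a_i-q^{i-1}(q^{N-D}+q^D-q^i-q^{i-1}))w_i$ ($1\le i\le D$). \item[(v)] $W_5$ is nonthin with endpoint $1$, diameter $D-1$, local eigenvalue $-q$, and has a basis $\{w^-_i\}_{i=1}^{D-1}\cup\{w^+_i\}_{i=2}^{D}$ with $w^-_i\in E^*_iU$ ($1\le i\le D-1$), $w^+_i\in E^*_iU$ ($2\le i\le D$), and \begin{align*} Rw^-_i&=\frac{q^i(q^i-1)^2}{(q-1)(q^{i+1}-1)}w^-_{i+1}-\frac{q^{i-1}(q-1)}{q^{i+1}-1}w^+_{i+1}\quad(1\le i\le D-2),\qquad Rw^-_{D-1}=-q^{D-2}\frac{q-1}{q^D-1}w^+_D,\\ Rw^+_i&=q^{i-1}\frac{q^{i-1}-1}{q-1}w^+_{i+1}\quad(2\le i\le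 D-1),\qquad Rw^+_D=0,\\ Lw^-_i&=\frac{(q^D-q^i)(q^{N-D}-q^i)}{q-1}w^-_{i-1}\quad(2\le i\le D-1),\qquad Lw^-_1=0,\\ Lw^+_i&=\frac{(q^i-1)(q^D-q^{i-1})(q^{N-D}-q^{i-1})}{(q-1)(q^{i-1}-1)}w^+_{i-1}-\frac{q^{i-2}(q^D-1)(q^{N-D}-1)}{q^{i-1}-1}w^-_{i-1}\quad(3\le i\le D),\\ Lw^+_2&=-\frac{(q^D-1)(q^{N-D}-1)}{q-1}w^-_1,\\ Fw^-_i&=\bigl(a_i-q^{i-1}(q^{N-D}+q^D-2)\bigr)w^-_i\quad(1\le i\le D-1),\\ Fw^+_i&=\bigl(a_i-q^{i-1}(q^{N-D}+q^D-q^i-q^{i-1}-1+q^{-1})\bigr)w^+_i\quad(2\le i\le D). \end{align*} \end{enumerate}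
   Context: Adjacency in $\Gamma$: $\mathrm{rank}(z-w)=1$; distance $\partial(z,w)=\mathrm{rank}(z-w)$; $\Gamma$ is distance-regular with diameter $D$; $\Gamma_i(z)=\{w:\partial(z,w)=i\}$ (empty for $i<0$ or $i>D$), $\Gamma(z)=\Gamma_1(z)$. Intersection numbers: $c_i=q^{i-1}\frac{q^i-1}{q-1}$, $b_i=\frac{(q^{N-D}-q^i)(q^D-q^i)}{q-1}$, $a_i=\frac{q^i-1}{q-1}(q^{N-D}+q^D-q^i-q^{i-1}-1)$ $(0\le i\le D)$. The $(x,y)$-partition of $X$ consists of the following $6D-2$ sets (nonempty, partitioning $X$): for $1\le i\le D$, $O_{i,i-1}=\Gamma_i(x)\cap\Gamma_{i-1}(y)$, $O_{i-1,i}=\Gamma_{i-1}(x)\cap\Gamma_i(y)$; for $z\in\Gamma_i(x)\cap\Gamma_i(y)$ let $m^-(z)=|\Gamma(x)\cap\Gamma(y)\cap\Gamma_{i-1}(z)|$, $m^+(z)=|\Gamma(x)\cap\Gamma(y)\cap\Gamma_{i+1}(z)|$; $O^A_{i,i}$ ($2\le i\le D$), $O^B_{i,i}$ ($1\le i\le D$), $O^C_{i,i}$ ($1\le i\le D$), $O^D_{i,i}$ ($1\le i\le D-1$) are the sets of $z\in\Gamma_i(x)\cap\Gamma_i(y)$ with $(m^-(z),m^+(z))$ equal to $(2q^{i-1},0)$, $(2q^{i-1}-1,0)$, $(q^{i-1},q^D-q^i)$, $(q^{i-1},q^{N-D}-q^i)$ respectively. $V=\mathbb C^X$ with Hermitian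 form $\langle u,v\rangle=\overline u^tv$; $\hat z$ is the standard basis vector for $z\in X$; $U=U(x,y)$ is the span of the characteristic vectors $\sum_{z\in S}\hat z$ of the cells $S$ of the $(x,y)$-partition. $A$ is the adjacency matrix of $\Gamma$; $E^*_i=E^*_i(x)$ is the diagonal matrix with $(z,z)$-entry $1$ if $\partial(x,z)=i$ and $0$ otherwise; $T=T(x)$ is the algebra generated by $A$ and $E^*_0,\dots,E^*_D$. $L=\sum_{i=1}^DE^*_{i-1}AE^*_i$, $F=\sum_{i=0}^DE^*_iAE^*_i$, $R=\sum_{i=0}^{D-1}E^*_{i+1}AE^*_i$. A $T$-module is a subspace $W\subseteq V$ with $TW\subseteq W$; it is irreducible if $W\ne0$ and its only $T$-submodules are $0$ and $W$. For irreducible $W$: the endpoint is $\min\{i:E^*_iW\ne0\}$; the diameter is $|\{i:E^*_iW\ne0\}|-1$; $W$ is thin if $\dim E^*_iW\le1$ for all $i$; the primary $T$-module is the unique irreducible $T$-module of endpoint $0$; if $W$ has endpoint $1$ and $\dim E^*_1W=1$, its local eigenvalue is the scalar $\eta$ with $(F-\eta I)E^*_1W=0$. *)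

theory Defs
  imports "HOL-Analysis.Analysis"
begin

text \<open>
  The vertex set X of all D x (N - D) matrices over GF(q) is the whole type \<open>'a^'n^'m\<close>, where
  \<open>'a\<close> is a finite field, \<open>q = CARD('a)\<close>, \<open>D = CARD('m)\<close> and \<open>N - D = CARD('n)\<close>.
  The vector space of complex column vectors indexed by X is \<open>complex^('a^'n^'m)\<close>, and
  matrices with rows and columns indexed by X have type \<open>complex^('a^'n^'m)^('a^'n^'m)\<close>.
  Their product is \<open>**\<close>; \<open>*\<close> would be the entrywise product.
  Linear algebra over the complex numbers uses the \<open>vec\<close> locale interpretation.
\<close>

subsection \<open>The bilinear forms graph\<close>

definition bf_dist :: "'a::{finite,field}^'n^'m \<Rightarrow> 'a^'n^'m \<Rightarrow> nat" where
  "bf_dist z w = rank (z - w)"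

definition bf_adj :: "'a::{finite,field}^'n^'m \<Rightarrow> 'a^'n^'m \<Rightarrow> bool" where
  "bf_adj z w \<longleftrightarrow> rank (z - w) = 1"

definition Gam :: "nat \<Rightarrow> 'a::{finite,field}^'n^'m \<Rightarrow> ('a^'n^'m) set" where
  "Gam i z = {w. bf_dist z w = i}"

definition cnum :: "complex \<Rightarrow> nat \<Rightarrow> complex" where
  "cnum q i = q^(i-1) * ((q^i - 1) / (q - 1))"

definition bnum :: "complex \<Rightarrow> nat \<Rightarrow> nat \<Rightarrow> nat \<Rightarrow> complex" where
  "bnum q D N i = (q^(N-D) - q^i) * (q^D - q^i) / (q - 1)"

text \<open>At \<open>i = 0\<close> the truncated exponent \<open>i - 1\<close> is harmless: the factor \<open>q^i - 1\<close> vanishes.\<close>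

definition anum :: "complex \<Rightarrow> nat \<Rightarrow> nat \<Rightarrow> nat \<Rightarrow> complex" where
  "anum q D N i = (q^i - 1) / (q - 1) * (q^(N-D) + q^D - q^i - q^(i-1) - 1)"

subsection \<open>The (x,y)-partition\<close>

definition mminus :: "'a::{finite,field}^'n^'m \<Rightarrow> 'a^'n^'m \<Rightarrow> nat \<Rightarrow> 'a^'n^'m \<Rightarrow> nat" where
  "mminus x y i z = card (Gam 1 x \<inter> Gam 1 y \<inter> Gam (i-1) z)"

definition mplus :: "'a::{finite,field}^'n^'m \<Rightarrow> 'a^'n^'m \<Rightarrow> nat \<Rightarrow> 'a^'n^'m \<Rightarrow> nat" where
  "mplus x y i z = card (Gam 1 x \<inter> Gam 1 y \<inter> Gam (i+1) z)"

definition diag_cell ::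
    "'a::{finite,field}^'n^'m \<Rightarrow> 'a^'n^'m \<Rightarrow> nat \<Rightarrow> nat \<Rightarrow> nat \<Rightarrow> ('a^'n^'m) set" where
  "diag_cell x y i r s =
     {z \<in> Gam i x \<inter> Gam i y. mminus x y i z = r \<and> mplus x y i z = s}"

text \<open>The last four families are, in order, the cells of type A, B, C and D. No subtraction of
  natural numbers below truncates, since \<open>1 \<le> i \<le> D < N - D\<close> in the intended setting.\<close>

definition xy_partition ::
    "'a::{finite,field}^'n^'m \<Rightarrow> 'a^'n^'m \<Rightarrow> ('a^'n^'m) set set" where
  "xy_partition x y =
     (let q = CARD('a); D = CARD('m); M = CARD('n) in
        {Gam i x \<inter> Gam (i-1) y | i. 1 \<le> i \<and> i \<le> D}
      \<union> {Gam (i-1) x \<inter> Gam i y | i. 1 \<le> i \<and> i \<le> D}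
      \<union> {diag_cell x y i (2 * q^(i-1)) 0 | i. 2 \<le> i \<and> i \<le> D}
      \<union> {diag_cell x y i (2 * q^(i-1) - 1) 0 | i. 1 \<le> i \<and> i \<le> D}
      \<union> {diag_cell x y i (q^(i-1)) (q^D - q^i) | i. 1 \<le> i \<and> i \<le> D}
      \<union> {diag_cell x y i (q^(i-1)) (q^M - q^i) | i. 1 \<le> i \<and> i \<le> D - 1})"

definition char_vec :: "'k set \<Rightarrow> complex^'k::finite" where
  "char_vec S = (\<Sum>z\<in>S. axis z 1)"

definition U_space ::
    "'a::{finite,field}^'n^'m \<Rightarrow> 'a^'n^'m \<Rightarrow> (complex^('a^'n^'m)) set" where
  "U_space x y = vec.span (char_vec ` xy_partition x y)"

subsection \<open>The subconstituent algebra\<close>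

definition Adj :: "complex^('a::{finite,field}^'n^'m)^('a^'n^'m)" where
  "Adj = (\<chi> z w. if bf_adj z w then 1 else 0)"

definition Es :: "'a::{finite,field}^'n^'m \<Rightarrow> nat \<Rightarrow> complex^('a^'n^'m)^('a^'n^'m)" where
  "Es x i = (\<chi> z w. if z = w \<and> bf_dist x z = i then 1 else 0)"

text \<open>The unital algebra generated by a set of square matrices; the matrices \<open>mat c\<close> provide
  the identity and, through products, scalar multiplication.\<close>

inductive_set generated_algebra :: "(complex^'k^'k::finite) set \<Rightarrow> (complex^'k^'k) set"
  for S :: "(complex^'k^'k) set" where
  gen: "M \<in> S \<Longrightarrow> M \<in> generated_algebra S"
| scalar: "mat c \<in> generated_algebra S"
| add: "\<lbrakk>M \<in> generated_algebra S; M' \<in> generated_algebra S\<rbrakk> \<Longrightarrow> M + M' \<in> generated_algebra S"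
| mult: "\<lbrakk>M \<in> generated_algebra S; M' \<in> generated_algebra S\<rbrakk> \<Longrightarrow> M ** M' \<in> generated_algebra S"

definition T_alg :: "'a::{finite,field}^'n^'m \<Rightarrow> (complex^('a^'n^'m)^('a^'n^'m)) set" where
  "T_alg x = generated_algebra (insert Adj (Es x ` {0..CARD('m)}))"

definition Lop :: "'a::{finite,field}^'n^'m \<Rightarrow> complex^('a^'n^'m)^('a^'n^'m)" where
  "Lop x = (\<Sum>i = 1..CARD('m). Es x (i-1) ** Adj ** Es x i)"

definition Fop :: "'a::{finite,field}^'n^'m \<Rightarrow> complex^('a^'n^'m)^('a^'n^'m)" where
  "Fop x = (\<Sum>i = 0..CARD('m). Es x i ** Adj ** Es x i)"

definition Rop :: "'a::{finite,field}^'n^'m \<Rightarrow> complex^('a^'n^'m)^('a^'n^'m)" where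
  "Rop x = (\<Sum>i = 0..CARD('m) - 1. Es x (i+1) ** Adj ** Es x i)"

definition Es_image ::
    "'a::{finite,field}^'n^'m \<Rightarrow> nat \<Rightarrow> (complex^('a^'n^'m)) set \<Rightarrow> (complex^('a^'n^'m)) set" where
  "Es_image x i W = (\<lambda>w. Es x i *v w) ` W"

subsection \<open>Modules\<close>

definition T_module :: "'a::{finite,field}^'n^'m \<Rightarrow> (complex^('a^'n^'m)) set \<Rightarrow> bool" where
  "T_module x W \<longleftrightarrow> vec.subspace W \<and> (\<forall>M \<in> T_alg x. \<forall>w \<in> W. M *v w \<in> W)"

definition irreducible_T_module ::
    "'a::{finite,field}^'n^'m \<Rightarrow> (complex^('a^'n^'m)) set \<Rightarrow> bool" where
  "irreducible_T_module x W \<longleftrightarrow> T_module x W \<and> W \<noteq> {0} \<and>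
     (\<forall>W'. T_module x W' \<and> W' \<subseteq> W \<longrightarrow> W' = {0} \<or> W' = W)"

definition module_support ::
    "'a::{finite,field}^'n^'m \<Rightarrow> (complex^('a^'n^'m)) set \<Rightarrow> nat set" where
  "module_support x W = {i. i \<le> CARD('m) \<and> Es_image x i W \<noteq> {0}}"

definition endpoint :: "'a::{finite,field}^'n^'m \<Rightarrow> (complex^('a^'n^'m)) set \<Rightarrow> nat" where
  "endpoint x W = Min (module_support x W)"

definition module_diameter :: "'a::{finite,field}^'n^'m \<Rightarrow> (complex^('a^'n^'m)) set \<Rightarrow> nat" where
  "module_diameter x W = card (module_support x W) - 1"

definition thin :: "'a::{finite,field}^'n^'m \<Rightarrow> (complex^('a^'n^'m)) set \<Rightarrow> bool" where
  "thin x W \<longleftrightarrow> (\<forall>i \<le> CARD('m). vec.dim (Es_image x i W) \<le> 1)"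

definition primary_T_module ::
    "'a::{finite,field}^'n^'m \<Rightarrow> (complex^('a^'n^'m)) set \<Rightarrow> bool" where
  "primary_T_module x W \<longleftrightarrow> irreducible_T_module x W \<and> endpoint x W = 0 \<and>
     (\<forall>W'. irreducible_T_module x W' \<and> endpoint x W' = 0 \<longrightarrow> W' = W)"

definition has_local_eigenvalue ::
    "'a::{finite,field}^'n^'m \<Rightarrow> (complex^('a^'n^'m)) set \<Rightarrow> complex \<Rightarrow> bool" where
  "has_local_eigenvalue x W \<eta> \<longleftrightarrow> endpoint x W = 1 \<and> vec.dim (Es_image x 1 W) = 1 \<and>
     (\<forall>w \<in> Es_image x 1 W. (Fop x - mat \<eta>) *v w = 0)"

subsection \<open>Linear algebra\<close>

definition herm :: "complex^'k::finite \<Rightarrow> complex^'k \<Rightarrow> complex" where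
  "herm u v = (\<Sum>z\<in>UNIV. cnj (u $ z) * v $ z)"

definition orthogonal_direct_sum ::
    "(complex^'k::finite) set \<Rightarrow> 'i set \<Rightarrow> ('i \<Rightarrow> (complex^'k) set) \<Rightarrow> bool" where
  "orthogonal_direct_sum V I W \<longleftrightarrow>
     V = {(\<Sum>i\<in>I. u i) | u. \<forall>i\<in>I. u i \<in> W i} \<and>
     (\<forall>u. (\<forall>i\<in>I. u i \<in> W i) \<and> (\<Sum>i\<in>I. u i) = 0 \<longrightarrow> (\<forall>i\<in>I. u i = 0)) \<and>
     (\<forall>i\<in>I. \<forall>j\<in>I. i \<noteq> j \<longrightarrow> (\<forall>u\<in>W i. \<forall>v\<in>W j. herm u v = 0))"

definition is_basis_family ::
    "('i \<Rightarrow> complex^'k::finite) \<Rightarrow> 'i set \<Rightarrow> (complex^'k) set \<Rightarrow> bool" where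
  "is_basis_family w I W \<longleftrightarrow>
     inj_on w I \<and> vec.independent (w ` I) \<and> vec.span (w ` I) = W"

end

theory Submission
  imports Defs
begin

text \<open>
  Translating \<open>x\<close> to \<open>0\<close> turns \<open>y\<close> into a rank one matrix \<open>outer u v\<close>. On each rank level, \<open>U\<close> consists of
  functions of \<open>z\<close> that only depend on whether \<open>u\<close> lies in the column space of \<open>z\<close>, whether \<open>v\<close> lies in
  its row space and, if both hold, on whether the bilinear form given by a generalised inverse of \<open>z\<close>
  takes the value 0, 1 or another one at \<open>(u, v)\<close>. The neighbours of \<open>z\<close> are the matrices
  \<open>z + outer a b\<close>, so \<open>L\<close>, \<open>F\<close> and \<open>R\<close> act on such functions through counts of the pairs \<open>(a, b)\<close> that
  raise, keep or lower the rank. This yields six families of vectors with explicit \<open>L\<close>, \<open>F\<close> and \<open>R\<close>.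
  On each level their \<open>F\<close>-eigenvalues are distinct, and \<open>F\<close> is Hermitian, so the \<open>6 D - 2\<close> vectors are
  orthogonal and span \<open>U\<close>, whose dimension is at most \<open>6 D - 2\<close>. Every submodule of \<open>U\<close> is then spanned by
  some of these vectors, and irreducibility amounts to connectedness under \<open>L\<close> and \<open>R\<close>.
\<close>

subsection \<open>Matrices over a finite field\<close>

text \<open>Membership of \<open>u\<close> in \<open>col z\<close> is not linear in
  \<open>z\<close>, so its sums over neighbours resist direct evaluation. They are reached through
  the number of \<open>p\<close> in a set \<open>T\<close> with \<open>z *v p = u\<close>. For fixed
  \<open>p\<close> this condition is affine in \<open>z\<close>. On a fixed rank the counts for
  \<open>T = UNIV\<close> and \<open>T = {p. dotp v p = t}\<close> recover the indicator functions,
  because the nonempty fibres of \<open>z\<close> have equal size and spread evenly over all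
  \<open>t\<close> when \<open>v\<close> is outside the row space. Rank-preserving sums of the form
  values are the total minus the rising and the falling sums.

  With column and row space fixed, a share \<open>(q^(i-1) - 1) / (q^i - 1)\<close> of the matrices
  of rank \<open>i\<close> gives the form the value 0 at \<open>(u, v)\<close>, and the nonzero
  values are equally frequent. Families 4 and 6 are built on this: both sum to zero over the
  matrices of a rank that are incident with \<open>u\<close> and \<open>v\<close>.

  For \<open>q = 2\<close> the form has no value besides 0 and 1. The cells of type B are then empty
  and family 4 vanishes, which explains the hypothesis \<open>q \<noteq> 2\<close>.\<close>

declare transpose_matrix_vector [simp del]

section \<open>The bilinear dot product, outer products and column spaces\<close>

definition dotp :: "'a::field^'n \<Rightarrow> 'a^'n \<Rightarrow> 'a" where
  "dotp a b = (\<Sum>i\<in>UNIV. a $ i * b $ i)"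

definition outer :: "'a::field^'m \<Rightarrow> 'a^'n \<Rightarrow> 'a^'n^'m" where
  "outer a b = (\<chi> i j. a $ i * b $ j)"

definition col :: "'a::field^'n^'m \<Rightarrow> ('a^'m) set" where
  "col z = range (\<lambda>p. z *v p)"

abbreviation row_sp :: "'a::field^'n^'m \<Rightarrow> ('a^'n) set" where
  "row_sp z \<equiv> col (transpose z)"

lemma dotp_commute: "dotp a b = dotp b a"
  by (simp add: dotp_def mult.commute)

lemma dotp_add_left: "dotp (a + b) c = dotp a c + dotp b c"
  by (simp add: dotp_def distrib_right sum.distrib)

lemma dotp_add_right: "dotp c (a + b) = dotp c a + dotp c b"
  by (simp add: dotp_def distrib_left sum.distrib)

lemma dotp_scale_left: "dotp (k *s a) b = k * dotp a b"
  by (simp add: dotp_def sum_distrib_left mult.assoc)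

lemma dotp_scale_right: "dotp a (k *s b) = k * dotp a b"
  by (simp add: dotp_def sum_distrib_left mult_ac)

lemma dotp_zero [simp]: "dotp 0 a = 0" "dotp a 0 = 0"
  by (simp_all add: dotp_def)

lemma dotp_minus_left: "dotp (- a) b = - dotp a b"
  by (simp add: dotp_def sum_negf)

lemma dotp_minus_right: "dotp b (- a) = - dotp b a"
  by (simp add: dotp_def sum_negf)

lemma dotp_diff_left: "dotp (a - b) c = dotp a c - dotp b c"
  by (simp add: dotp_def left_diff_distrib sum_subtractf)

lemma dotp_diff_right: "dotp c (a - b) = dotp c a - dotp c b"
  by (simp add: dotp_def right_diff_distrib sum_subtractf)

lemmas dotp_simps = dotp_add_left dotp_add_right dotp_scale_left dotp_scale_right
  dotp_minus_left dotp_minus_right dotp_diff_left dotp_diff_right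

lemma dotp_axis: "dotp (axis i c) a = c * a $ i"
proof -
  have "dotp (axis i c) a = (\<Sum>j\<in>UNIV. if i = j then c * a $ j else 0)"
    unfolding dotp_def by (intro sum.cong) (auto simp: axis_def)
  then show ?thesis by simp
qed

lemma dotp_nondegenerate: "a \<noteq> 0 \<Longrightarrow> \<exists>k. dotp a k \<noteq> 0"
  by (metis dotp_axis dotp_commute mult_1 vec_eq_iff zero_index)

lemma matrix_vector_eq_dotp: "(z *v p) $ i = dotp (row i z) p"
  by (simp add: matrix_vector_mult_def dotp_def row_def)

lemma dotp_adjoint: "dotp s (z *v p) = dotp (transpose z *v s) p"
proof -
  have "dotp s (z *v p) = (\<Sum>i\<in>UNIV. \<Sum>j\<in>UNIV. s $ i * z $ i $ j * p $ j)"
    by (simp add: dotp_def matrix_vector_mult_def sum_distrib_left mult.assoc)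
  also have "\<dots> = (\<Sum>j\<in>UNIV. \<Sum>i\<in>UNIV. s $ i * z $ i $ j * p $ j)"
    by (rule sum.swap)
  also have "\<dots> = dotp (transpose z *v s) p"
    by (simp add: dotp_def matrix_vector_mult_def transpose_def sum_distrib_left
        sum_distrib_right mult_ac)
  finally show ?thesis .
qed

lemma outer_mult: "outer a b *v p = dotp b p *s a"
  by (simp add: outer_def matrix_vector_mult_def dotp_def vec_eq_iff sum_distrib_left mult_ac)

lemma transpose_outer: "transpose (outer a b) = outer b a"
  by (simp add: outer_def transpose_def vec_eq_iff mult.commute)

lemma transpose_add: "transpose (a + b) = transpose a + transpose b"
  by (simp add: transpose_def vec_eq_iff)

lemma add_outer_mult: "(z + outer a b) *v p = z *v p + dotp b p *s a"
  by (simp add: matrix_vector_mult_add_rdistrib outer_mult)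

lemma transpose_add_outer: "transpose (z + outer a b) = transpose z + outer b a"
  by (simp add: transpose_add transpose_outer)

lemma col_add: "a \<in> col z \<Longrightarrow> b \<in> col z \<Longrightarrow> a + b \<in> col z"
  by (auto simp: col_def image_iff intro: matrix_vector_right_distrib[symmetric])

lemma col_scale: "a \<in> col z \<Longrightarrow> k *s a \<in> col z"
  by (auto simp: col_def image_iff intro: vector_scalar_commute[symmetric])

lemma col_zero [simp]: "0 \<in> col z"
  unfolding col_def by (rule range_eqI[of _ _ 0]) simp

lemma col_uminus: "a \<in> col z \<Longrightarrow> - a \<in> col z"
  using col_scale[of a z "-1"] by simp

lemma col_diff: "a \<in> col z \<Longrightarrow> b \<in> col z \<Longrightarrow> a - b \<in> col z"
  using col_add[of a z "-b"] col_uminus[of b z] by simp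

lemma col_scale_iff: "k \<noteq> 0 \<Longrightarrow> k *s a \<in> col z \<longleftrightarrow> a \<in> col z"
  using col_scale[of "k *s a" z "inverse k"] col_scale[of a z k] by auto

lemma col_add_iff: "c \<in> col z \<Longrightarrow> c + a \<in> col z \<longleftrightarrow> a \<in> col z"
  using col_add[of c z a] col_diff[of "c + a" z c] by auto

lemma col_diff_iff: "c \<in> col z \<Longrightarrow> a - c \<in> col z \<longleftrightarrow> a \<in> col z"
  using col_add[of "a - c" z c] col_diff[of a z c] by auto

lemma mult_in_col [simp]: "z *v p \<in> col z"
  by (simp add: col_def)

lemma subspace_col: "vec.subspace (col z)"
  by (simp add: vec.subspace_def col_add col_scale)

text \<open>The bridge from \<open>row_sp\<close>, defined as an image, to \<open>rank\<close>,
  whose row description is used in \<open>card_row_sp\<close>.\<close>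

lemma row_sp_eq_span_rows: "row_sp z = vec.span (rows z)"
proof
  have "transpose z *v s = (\<Sum>i\<in>UNIV. s $ i *s row i z)" for s
    by (simp add: matrix_vector_mult_def transpose_def row_def vec_eq_iff mult.commute)
  moreover have "(\<Sum>i\<in>UNIV. s $ i *s row i z) \<in> vec.span (rows z)" for s
    by (intro vec.span_sum vec.span_scale vec.span_base) (auto simp: rows_def)
  ultimately show "row_sp z \<subseteq> vec.span (rows z)"
    by (auto simp: col_def)
  have "row i z = transpose z *v axis i 1" for i
    by (simp add: vec_eq_iff row_def transpose_def matrix_vector_mult_def axis_def if_distrib
        cong: if_cong)
  then show "vec.span (rows z) \<subseteq> row_sp z"
    by (intro vec.span_minimal subspace_col) (auto simp: rows_def)
qed

section \<open>Duality of row space and kernel; counting solutions of linear equations\<close>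

lemma row_sp_annihilates_kernel: "v \<in> row_sp z \<Longrightarrow> z *v k = 0 \<Longrightarrow> dotp v k = 0"
  by (auto simp: col_def dotp_adjoint[symmetric])

text \<open>The row space is the full annihilator of the kernel. Extending a basis gives a linear
  map that kills \<open>row_sp z\<close> and fixes \<open>v\<close>. A row of its matrix, taken at a
  coordinate where \<open>v\<close> is nonzero, is orthogonal to the row space, hence in the kernel,
  but not orthogonal to \<open>v\<close>.\<close>

lemma kernel_separates_row_sp:
  fixes z :: "'a::field^'n^'m"
  assumes "v \<notin> row_sp z"
  shows "\<exists>k. z *v k = 0 \<and> dotp v k \<noteq> 0"
proof -
  obtain B where B0: "B \<subseteq> row_sp z" "vec.independent B" "row_sp z \<subseteq> vec.span B"
    by (rule vec.basis_exists[of "row_sp z"])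
  have B: "vec.independent B" "vec.span B = row_sp z"
    using B0(2) vec.span_subspace[OF B0(1,3) subspace_col] by simp_all
  have indep: "vec.independent (insert v B)"
    by (rule vec.independent_insertI[OF _ B(1)]) (use B(2) assms in simp)
  have vB: "v \<notin> B" using B0(1) assms by blast
  obtain g where g: "Vector_Spaces.linear (*s) (*s) g"
      "\<forall>b\<in>insert v B. g b = (if b = v then v else 0)"
    using vec.linear_independent_extend[OF indep, of "\<lambda>b. if b = v then v else 0"] by blast
  have gR: "g r = 0" if "r \<in> row_sp z" for r
  proof -
    have "r \<in> vec.span B" using that B by simp
    then show ?thesis
    proof (rule vec.linear_eq_0_on_span[OF g(1), rotated])
      show "g b = 0" if "b \<in> B" for b using g(2) that vB by auto
    qed
  qed
  have mg: "matrix g *v w = g w" for w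
    by (rule matrix_works[OF g(1)])
  have "v \<noteq> 0" using assms by auto
  then obtain j where j: "v $ j \<noteq> 0" by (auto simp: vec_eq_iff)
  define k where "k = row j (matrix g)"
  have k: "dotp k w = g w $ j" for w
    using matrix_vector_eq_dotp[of "matrix g" w j] mg[of w] by (simp add: k_def)
  have "dotp v k \<noteq> 0" using j g(2) k[of v] dotp_commute[of v k] by simp
  moreover have "z *v k = 0"
  proof (rule ccontr)
    assume "z *v k \<noteq> 0"
    then obtain s where "dotp (z *v k) s \<noteq> 0" using dotp_nondegenerate by blast
    then have "dotp k (transpose z *v s) \<noteq> 0"
      using dotp_adjoint[of s z k] dotp_commute[of s "z *v k"]
        dotp_commute[of k "transpose z *v s"] by simp
    then show False using k gR by simp
  qed
  ultimately show ?thesis by blast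
qed

lemma card_span_independent:
  fixes B :: "('a::{finite,field}^'n) set"
  assumes "finite B" "vec.independent B"
  shows "card (vec.span B) = CARD('a) ^ card B"
  using assms
proof (induction B rule: finite_induct)
  case empty
  then show ?case by simp
next
  case (insert b B)
  have ib: "vec.independent B" "b \<notin> vec.span B"
    using insert.prems insert.hyps(2) by (simp_all add: vec.independent_insert)
  have "bij_betw (\<lambda>(c, w). c *s b + w) (UNIV \<times> vec.span B) (vec.span (insert b B))"
  proof (rule bij_betw_imageI)
    show "inj_on (\<lambda>(c, w). c *s b + w) (UNIV \<times> vec.span B)"
    proof (clarsimp simp: inj_on_def)
      fix c w c' w' assume w: "w \<in> vec.span B" "w' \<in> vec.span B" and eq: "c *s b + w = c' *s b + w'"
      have "(c - c') *s b = w' - w" using eq by (simp add: vec_eq_iff algebra_simps)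
      then have "(c - c') *s b \<in> vec.span B" using vec.span_diff[OF w(2,1)] by simp
      then have "inverse (c - c') *s ((c - c') *s b) \<in> vec.span B" by (rule vec.span_scale)
      then have "c = c'" using ib(2)
        by (cases "c - c' = 0") (simp_all add: vector_smult_assoc del: vector_ssub_ldistrib vector_sub_rdistrib)
      then show "c = c' \<and> w = w'" using eq by simp
    qed
    show "(\<lambda>(c, w). c *s b + w) ` (UNIV \<times> vec.span B) = vec.span (insert b B)"
    proof (intro equalityI subsetI)
      fix x assume "x \<in> (\<lambda>(c, w). c *s b + w) ` (UNIV \<times> vec.span B)"
      then obtain c w where x: "x = c *s b + w" and w: "w \<in> vec.span B" by auto
      have "b \<in> vec.span (insert b B)" by (intro vec.span_base insertI1)
      moreover have "w \<in> vec.span (insert b B)"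
        using w vec.span_mono[of B "insert b B"] by blast
      ultimately show "x \<in> vec.span (insert b B)"
        unfolding x by (intro vec.span_add vec.span_scale)
    next
      fix x assume "x \<in> vec.span (insert b B)"
      then obtain k where k: "x - k *s b \<in> vec.span B"
        using vec.span_breakdown_eq[of x b B] by auto
      have "x = (\<lambda>(c, w). c *s b + w) (k, x - k *s b)" by simp
      then show "x \<in> (\<lambda>(c, w). c *s b + w) ` (UNIV \<times> vec.span B)"
        using k by blast
    qed
  qed
  from bij_betw_same_card[OF this]
  have "card (vec.span (insert b B)) = CARD('a) * card (vec.span B)"
    by (simp add: card_cartesian_product)
  then show ?case using insert ib by simp
qed

lemma card_subspace:
  fixes S :: "('a::{finite,field}^'n) set"
  assumes "vec.subspace S"
  shows "card S = CARD('a) ^ vec.dim S"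
proof -
  obtain B where B: "B \<subseteq> S" "vec.independent B" "S \<subseteq> vec.span B" "card B = vec.dim S"
    by (rule vec.basis_exists[of S])
  show ?thesis
    using card_span_independent[OF finite B(2)] vec.span_subspace[OF B(1,3) assms] B(4) by simp
qed

lemma card_row_sp:
  fixes z :: "'a::{finite,field}^'n^'m"
  shows "card (row_sp z) = CARD('a) ^ rank z"
proof -
  have "card (vec.span (rows z)) = CARD('a) ^ vec.dim (vec.span (rows z))"
    by (rule card_subspace[OF vec.subspace_span])
  then show ?thesis
    unfolding row_rank_def_gen row_sp_eq_span_rows vec.dim_span .
qed

text \<open>The shifts \<open>sh c\<close> carry the level sets of \<open>f\<close> bijectively onto
  each other, so all have the same size. With translations along a suitable vector this says that a
  nontrivial linear condition divides a count by \<open>CARD('a)\<close>.\<close>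

lemma card_level_set:
  fixes f :: "'k::finite \<Rightarrow> 'a::{finite,field}" and S :: "'k set"
  assumes tr: "\<And>c p. p \<in> S \<Longrightarrow> sh c p \<in> S" "\<And>c p. p \<in> S \<Longrightarrow> f (sh c p) = f p + c"
     "\<And>c p. sh (- c) (sh c p) = p"
  shows "CARD('a) * card {p \<in> S. f p = t} = card S"
proof -
  have "card {p \<in> S. f p = t'} = card {p \<in> S. f p = t}" for t' :: 'a
  proof (rule bij_betw_same_card[of "sh (t - t')"], rule bij_betw_byWitness[where f' = "sh (t' - t)"])
    show "\<forall>a\<in>{p \<in> S. f p = t'}. sh (t' - t) (sh (t - t') a) = a"
      using tr(3)[of "t - t'"] by simp
    show "\<forall>a\<in>{p \<in> S. f p = t}. sh (t - t') (sh (t' - t) a) = a"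
      using tr(3)[of "t' - t"] by simp
  qed (use tr in auto)
  then have "(\<Sum>t'\<in>(UNIV::'a set). card {p \<in> S. f p = t'})
      = (\<Sum>t'\<in>(UNIV::'a set). card {p \<in> S. f p = t})"
    by (intro sum.cong refl)
  then have "(\<Sum>t'\<in>(UNIV::'a set). card {p \<in> S. f p = t'}) = CARD('a) * card {p \<in> S. f p = t}"
    by simp
  moreover have "(\<Sum>t'\<in>UNIV. card {p \<in> S. f p = t'}) = card S"
  proof -
    have "S = (\<Union>t'. {p \<in> S. f p = t'})" by auto
    then have "card S = card (\<Union>t'. {p \<in> S. f p = t'})" by (rule arg_cong)
    also have "\<dots> = (\<Sum>t'\<in>UNIV. card {p \<in> S. f p = t'})"
      by (rule card_UN_disjoint) auto
    finally show ?thesis by simp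
  qed
  ultimately show ?thesis by simp
qed

lemma card_dotp_eq:
  fixes b :: "'a::{finite,field}^'n"
  assumes "b \<noteq> 0"
  shows "CARD('a) * card {p. dotp b p = t} = CARD('a) ^ CARD('n)"
proof -
  obtain k where k: "dotp b k \<noteq> 0" using dotp_nondegenerate[OF assms] by blast
  have "CARD('a) * card {p \<in> UNIV. dotp b p = t} = card (UNIV :: ('a^'n) set)"
    by (rule card_level_set[where sh = "\<lambda>c p. p + (c / dotp b k) *s k"])
      (use k in \<open>auto simp: dotp_simps vec_eq_iff\<close>)
  then show ?thesis by simp
qed

text \<open>The fibres over the column space are translates of the kernel.\<close>

lemma card_kernel:
  fixes z :: "'a::{finite,field}^'n^'m"
  shows "card (col z) * card {p. z *v p = 0} = CARD('a) ^ CARD('n)"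
proof -
  have "card {p. z *v p = c} = card {p. z *v p = 0}" if c: "c \<in> col z" for c
  proof -
    obtain p0 where p0: "z *v p0 = c" using c by (auto simp: col_def)
    show ?thesis
      by (rule bij_betw_same_card[of "\<lambda>p. p - p0"],
          rule bij_betw_byWitness[where f' = "\<lambda>p. p + p0"])
        (auto simp: p0 matrix_vector_right_distrib matrix_vector_mult_diff_distrib)
  qed
  then have "(\<Sum>c\<in>col z. card {p. z *v p = c}) = (\<Sum>c\<in>col z. card {p. z *v p = 0})"
    by (intro sum.cong refl)
  moreover have "(\<Sum>c\<in>col z. card {p. z *v p = c}) = card (UNIV :: ('a^'n) set)"
  proof -
    have "(UNIV :: ('a^'n) set) = (\<Union>c\<in>col z. {p. z *v p = c})" by (auto simp: col_def)
    then have "card (UNIV :: ('a^'n) set) = card (\<Union>c\<in>col z. {p. z *v p = c})"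
      by (rule arg_cong)
    also have "\<dots> = (\<Sum>c\<in>col z. card {p. z *v p = c})"
      by (rule card_UN_disjoint) auto
    finally show ?thesis by simp
  qed
  ultimately show ?thesis by simp
qed

abbreviation (input) cN :: "'k set \<Rightarrow> complex" where
  "cN S \<equiv> of_nat (card S)"

lemma dotp_adjoint_swap: "dotp s (z *v p) = dotp p (transpose z *v s)"
  unfolding dotp_adjoint[of s z p] by (rule dotp_commute)

text \<open>Row rank equals column rank. The pairs \<open>(s, p)\<close> with
  \<open>dotp s (z *v p) = 0\<close> are counted once by \<open>p\<close> and once by
  \<open>s\<close>. This relates the sizes of the two kernels, and \<open>card_kernel\<close> turns
  the relation into one between the two images.\<close>

lemma card_col:
  fixes z :: "'a::{finite,field}^'n^'m"
  shows "card (col z) = CARD('a) ^ rank z"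
proof -
  define q K K' where "q = real CARD('a)" and "K = real (card {p. z *v p = 0})"
    and "K' = real (card {s. transpose z *v s = 0})"
  have q1: "q > 1"
    using card_mono[of UNIV "{0::'a, 1}"] by (simp add: q_def)
  \<comment> \<open>For a given \<open>p\<close> the admissible \<open>s\<close> form the whole
    space if \<open>w *v p = 0\<close> and a hyperplane otherwise.\<close>
  have count: "real (\<Sum>p\<in>UNIV. card {s. dotp s (w *v p) = 0})
      = real (card {p. w *v p = 0}) * (q ^ CARD('j) - q ^ CARD('j) / q) + q ^ CARD('i) * (q ^ CARD('j) / q)"
    for w :: "'a^'i^'j"
  proof -
    have "real (card {s. dotp s (w *v p) = 0})
        = of_bool (w *v p = 0) * (q ^ CARD('j) - q ^ CARD('j) / q) + q ^ CARD('j) / q" for p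
    proof (cases "w *v p = 0")
      case False
      then have "real (CARD('a) * card {s. dotp (w *v p) s = 0}) = real (CARD('a) ^ CARD('j))"
        using card_dotp_eq[of "w *v p" 0] by presburger
      then show ?thesis using False q1 by (simp add: q_def dotp_commute field_simps)
    qed (simp add: q_def)
    then have "real (\<Sum>p\<in>UNIV. card {s. dotp s (w *v p) = 0})
        = (\<Sum>p\<in>UNIV. of_bool (w *v p = 0) * (q ^ CARD('j) - q ^ CARD('j) / q) + q ^ CARD('j) / q)"
      by simp
    also have "\<dots> = (\<Sum>p\<in>UNIV. of_bool (w *v p = 0)) * (q ^ CARD('j) - q ^ CARD('j) / q)
        + q ^ CARD('i) * (q ^ CARD('j) / q)"
      unfolding sum.distrib sum_distrib_right[symmetric] by (simp add: q_def)
    also have "(\<Sum>p\<in>UNIV. of_bool (w *v p = 0)) = real (card {p. w *v p = 0})"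
      by (subst sum_of_bool_eq) simp_all
    finally show ?thesis .
  qed
  have "(\<Sum>p\<in>UNIV. card {s. dotp s (z *v p) = 0}) = (\<Sum>p\<in>UNIV. \<Sum>s\<in>UNIV. of_bool (dotp s (z *v p) = 0))"
    by (simp add: sum_of_bool_eq)
  also have "\<dots> = (\<Sum>s\<in>UNIV. \<Sum>p\<in>UNIV. of_bool (dotp p (transpose z *v s) = 0))"
    by (subst sum.swap) (simp only: dotp_adjoint_swap[of _ z])
  also have "\<dots> = (\<Sum>s\<in>UNIV. card {p. dotp p (transpose z *v s) = 0})"
    by (simp add: sum_of_bool_eq)
  finally have "K * (q ^ CARD('m) - q ^ CARD('m) / q) + q ^ CARD('n) * (q ^ CARD('m) / q)
      = K' * (q ^ CARD('n) - q ^ CARD('n) / q) + q ^ CARD('m) * (q ^ CARD('n) / q)"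
    using count[of z] count[of "transpose z"] by (simp add: K_def K'_def)
  then have "K * q ^ CARD('m) * (1 - 1 / q) = K' * q ^ CARD('n) * (1 - 1 / q)"
    by (simp add: algebra_simps)
  then have eq: "K * q ^ CARD('m) = K' * q ^ CARD('n)" using q1 by simp
  have cK: "real (card (col z)) * K = q ^ CARD('n)"
    using arg_cong[OF card_kernel[of z], of real] by (simp add: K_def q_def)
  have rK: "real (card (row_sp z)) * K' = q ^ CARD('m)"
    using arg_cong[OF card_kernel[of "transpose z"], of real] by (simp add: K'_def q_def)
  have "real (card (col z)) * (K * K' * q ^ CARD('m)) = (real (card (col z)) * K) * (K' * q ^ CARD('m))"
    by (simp add: mult_ac)
  also have "\<dots> = (real (card (row_sp z)) * K') * (K' * q ^ CARD('n))"
    unfolding cK rK by (simp add: mult_ac)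
  also have "\<dots> = real (card (row_sp z)) * (K * K' * q ^ CARD('m))"
    unfolding eq[symmetric] by (simp add: mult_ac)
  finally have "real (card (col z)) * (K * K' * q ^ CARD('m)) = real (card (row_sp z)) * (K * K' * q ^ CARD('m))" .
  moreover have "K * K' * q ^ CARD('m) \<noteq> 0"
    using cK rK q1 by auto
  ultimately have "card (col z) = card (row_sp z)" by simp
  then show ?thesis by (simp add: card_row_sp)
qed

lemma CARD_field_gt_1: "CARD('a::{finite,field}) > 1"
  using card_mono[of UNIV "{0::'a, 1}"] by simp

lemma rank_eq_iff_card_col:
  fixes z :: "'a::{finite,field}^'n^'m"
  shows "rank z = k \<longleftrightarrow> card (col z) = CARD('a) ^ k"
  using CARD_field_gt_1[where 'a = 'a] by (simp add: card_col)

lemma rank_transpose_finite: "rank (transpose z) = rank z"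
  for z :: "'a::{finite,field}^'n^'m"
  using card_row_sp[of z] card_col[of "transpose z"] CARD_field_gt_1[where 'a = 'a] by simp

lemma rank_zero_iff: "rank z = 0 \<longleftrightarrow> z = 0" for z :: "'a::{finite,field}^'n^'m"
proof
  assume "rank z = 0"
  then have "card (col z) = 1" by (simp add: card_col)
  then have "col z = {0}" by (metis card_1_singletonE col_zero singletonD)
  then have "z *v p = 0" for p
    using mult_in_col[of z p] by (metis singletonD)
  then show "z = 0" by (simp add: matrix_eq)
qed (simp add: rank_eq_iff_card_col col_def image_constant_conv)

lemma rank_le:
  fixes z :: "'a::{finite,field}^'n^'m"
  shows "rank z \<le> CARD('m)" "rank z \<le> CARD('n)"
proof -
  have le: "rank w \<le> CARD('j)" for w :: "'a^'i^'j"
    using card_mono[of UNIV "col w"] CARD_field_gt_1[where 'a = 'a] by (simp add: card_col)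
  show "rank z \<le> CARD('m)" by (rule le)
  show "rank z \<le> CARD('n)" using le[of "transpose z"] by (simp add: rank_transpose_finite)
qed

lemma col_outer: "b \<noteq> 0 \<Longrightarrow> col (outer a b) = range (\<lambda>k. k *s a)"
proof -
  assume "b \<noteq> 0"
  then obtain k where k: "dotp b k \<noteq> 0" using dotp_nondegenerate by blast
  have "c *s a = outer a b *v ((c / dotp b k) *s k)" for c
    using k by (simp add: outer_mult dotp_simps)
  then have "range (\<lambda>k. k *s a) \<subseteq> col (outer a b)"
    using mult_in_col by (metis image_subsetI)
  then show ?thesis by (auto simp: col_def outer_mult)
qed

lemma inj_scale: "a \<noteq> 0 \<Longrightarrow> inj (\<lambda>k. k *s (a :: 'a::field^'n))"
  by (auto simp: inj_def vec_eq_iff)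

lemma rank_outer:
  fixes a :: "'a::{finite,field}^'m" and b :: "'a^'n"
  assumes "a \<noteq> 0" "b \<noteq> 0"
  shows "rank (outer a b) = 1"
  using assms by (simp add: rank_eq_iff_card_col col_outer card_image inj_scale)

text \<open>A vector annihilated by the first functional but not by the second gives translations
  inside the first hyperplane, so the second condition costs another factor
  \<open>CARD('a)\<close>.\<close>

lemma card_dotp_eq2:
  fixes b :: "'a::{finite,field}^'n"
  assumes "b \<noteq> 0" "b' \<notin> range (\<lambda>k. k *s b)"
  shows "CARD('a) * (CARD('a) * card {p. dotp b p = t \<and> dotp b' p = t'}) = CARD('a) ^ CARD('n)"
proof -
  \<comment> \<open>The left factor only has to be nonzero: \<open>outer e b\<close> realises the
    line of \<open>b\<close> as a row space, so that \<open>kernel_separates_row_sp\<close>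
    applies.\<close>
  define e :: "'a^'n" where "e = b"
  have "b' \<notin> row_sp (outer e b)"
    using assms by (simp add: transpose_outer col_outer e_def)
  then obtain k where k: "outer e b *v k = 0" "dotp b' k \<noteq> 0"
    using kernel_separates_row_sp by blast
  then have bk: "dotp b k = 0" using assms(1) by (simp add: outer_mult e_def)
  have "CARD('a) * card {p \<in> {p. dotp b p = t}. dotp b' p = t'} = card {p. dotp b p = t}"
    by (rule card_level_set[where sh = "\<lambda>c p. p + (c / dotp b' k) *s k"])
      (use k bk in \<open>auto simp: dotp_simps vec_eq_iff\<close>)
  then show ?thesis using card_dotp_eq[OF assms(1), of t] by simp
qed

section \<open>Rank one matrices and rank one perturbations\<close>

lemma rank_one_decomp:
  fixes w :: "'a::{finite,field}^'n^'m"
  assumes "rank w = 1"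
  obtains a b where "a \<noteq> 0" "b \<noteq> 0" "w = outer a b"
proof -
  have card: "card (col w) = CARD('a)" using assms by (simp add: card_col)
  have "w \<noteq> 0" using assms rank_zero_iff[of w] by force
  then obtain p where p: "w *v p \<noteq> 0" by (auto simp: matrix_eq)
  define a where "a = w *v p"
  have "range (\<lambda>k. k *s a) \<subseteq> col w" by (auto simp: a_def col_scale)
  moreover have "card (range (\<lambda>k. k *s a)) = CARD('a)"
    using p by (simp add: card_image inj_scale a_def)
  ultimately have C: "col w = range (\<lambda>k. k *s a)"
    using card by (metis card_subset_eq finite)
  obtain i where i: "a $ i \<noteq> 0" using p by (auto simp: a_def vec_eq_iff)
  \<comment> \<open>Every value of \<open>w\<close> is a multiple of \<open>a\<close>, and the
    multiple can be read off at a coordinate \<open>i\<close> where \<open>a\<close> is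
    nonzero.\<close>
  define b where "b = (1 / a $ i) *s row i w"
  have "w *v x = outer a b *v x" for x
  proof -
    obtain k where k: "w *v x = k *s a" using C mult_in_col[of w x] by auto
    then have "dotp (row i w) x = k * a $ i" using matrix_vector_eq_dotp[of w x i] by simp
    then show ?thesis using k i by (simp add: outer_mult b_def dotp_simps)
  qed
  then have "w = outer a b" by (simp add: matrix_eq)
  moreover have "a \<noteq> 0" using p by (simp add: a_def)
  moreover have "b \<noteq> 0" using p \<open>w = outer a b\<close> by (auto simp: outer_mult)
  ultimately show ?thesis using that by blast
qed

text \<open>For \<open>a\<close> in the column space and \<open>b\<close> in the row space,
  \<open>dotp b p\<close> is the value at \<open>(a, b)\<close> of the form given by a generalised
  inverse of \<open>z\<close>. The value \<open>- 1\<close> is the singular case of the update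
  \<open>z + outer a b\<close>: it lowers the rank.\<close>

definition dnp :: "'a::field^'n^'m \<Rightarrow> 'a^'m \<Rightarrow> 'a^'n \<Rightarrow> bool" where
  "dnp z a b \<longleftrightarrow> b \<in> row_sp z \<and> (\<exists>p. z *v p = a \<and> dotp b p = - 1)"

text \<open>For \<open>b\<close> in the row space of \<open>z\<close>, the value \<open>b \<bullet> p\<close> only depends on \<open>z p\<close>.\<close>

lemma row_sp_dotp_cong: "b \<in> row_sp z \<Longrightarrow> z *v p = z *v p' \<Longrightarrow> dotp b p = dotp b p'"
  using row_sp_annihilates_kernel[of b z "p - p'"]
  by (simp add: matrix_vector_mult_diff_distrib dotp_simps)

lemma dnp_iff: "b \<in> row_sp z \<Longrightarrow> dnp z (z *v p) b \<longleftrightarrow> dotp b p = - 1"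
  unfolding dnp_def by (metis row_sp_dotp_cong)

text \<open>If \<open>z *v p = a\<close> and \<open>transpose z *v s = b\<close>, then adjointness
  gives \<open>dotp b p = dotp a s\<close>, so the form treats columns and rows alike.\<close>

lemma dnp_transpose: "dnp (transpose z) b a \<longleftrightarrow> dnp z a b"
proof -
  have "dnp (transpose z) b a" if ab: "dnp z a b" for z :: "'a^'n^'m" and a b
  proof -
    obtain p s where "z *v p = a" "transpose z *v s = b" "dotp b p = - 1"
      using ab by (auto simp: dnp_def col_def)
    then show ?thesis
      using dotp_adjoint_swap[of s z p] dotp_commute[of b p] dotp_commute[of a s]
      by (auto simp: dnp_def intro!: exI[of _ s])
  qed
  from this[of z a b] this[of "transpose z" b a] show ?thesis by auto
qed

lemma dnp_in_col: "dnp z a b \<Longrightarrow> a \<in> col z" "dnp z a b \<Longrightarrow> b \<in> row_sp z"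
  by (auto simp: dnp_def)

lemma dnp_nonzero: "dnp z a b \<Longrightarrow> a \<noteq> 0" "dnp z a b \<Longrightarrow> b \<noteq> 0"
  using row_sp_annihilates_kernel by (fastforce simp: dnp_def)+

text \<open>A Sherman-Morrison argument: the update still reaches all of \<open>col z\<close> as
  soon as some \<open>p0\<close> with \<open>z *v p0 = a\<close> makes \<open>1 + dotp b p0\<close>
  nonzero. If \<open>b\<close> is outside the row space, moving along the kernel produces such a
  \<open>p0\<close>.\<close>

lemma col_same:
  fixes z :: "'a::field^'n^'m"
  assumes "a \<in> col z" "\<not> dnp z a b"
  shows "col (z + outer a b) = col z"
proof -
  obtain p0 where p0: "z *v p0 = a" "dotp b p0 \<noteq> - 1"
  proof (cases "b \<in> row_sp z")
    case True
    then show ?thesis using assms that by (auto simp: dnp_def col_def)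
  next
    case False
    then obtain k where k: "z *v k = 0" "dotp b k \<noteq> 0" using kernel_separates_row_sp by blast
    obtain p where p: "z *v p = a" using assms by (auto simp: col_def)
    show ?thesis
    proof (cases "dotp b p = - 1")
      case True
      then show ?thesis
        using that[of "p + k"] p k by (simp add: matrix_vector_right_distrib dotp_simps)
    qed (use p that in blast)
  qed
  show ?thesis
  proof (intro equalityI subsetI)
    fix c assume "c \<in> col (z + outer a b)"
    then show "c \<in> col z" using assms(1) by (auto simp: col_def[of "z + _"] add_outer_mult col_add col_scale)
  next
    fix c assume "c \<in> col z"
    then obtain p where p: "z *v p = c" by (auto simp: col_def)
    \<comment> \<open>The Sherman-Morrison correction, chosen so that the multiple of
      \<open>a\<close> added by \<open>outer a b\<close> cancels.\<close>
    define p' where "p' = p - (dotp b p / (1 + dotp b p0)) *s p0"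
    have n: "1 + dotp b p0 \<noteq> 0" using p0(2) by (metis add.commute add_eq_0_iff)
    have "dotp b p' = dotp b p / (1 + dotp b p0)"
      using n by (simp add: p'_def dotp_simps field_simps)
    then have "(z + outer a b) *v p' = c"
      by (simp add: add_outer_mult) (simp add: p'_def matrix_vector_mult_diff_distrib
        vector_scalar_commute p p0)
    then show "c \<in> col (z + outer a b)" by (auto simp: col_def)
  qed
qed

text \<open>A kernel vector not orthogonal to \<open>b\<close> adjusts the coefficient of
  \<open>a\<close> without changing \<open>z *v p\<close>, so the new column space is
  \<open>col z\<close> plus the line of \<open>a\<close>.\<close>

lemma col_up:
  fixes z :: "'a::field^'n^'m"
  assumes "b \<notin> row_sp z"
  shows "u \<in> col (z + outer a b) \<longleftrightarrow> (\<exists>k. u - k *s a \<in> col z)"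
proof
  assume "u \<in> col (z + outer a b)"
  then obtain p where "u = z *v p + dotp b p *s a" by (auto simp: col_def add_outer_mult)
  then have "u - dotp b p *s a \<in> col z" by simp
  then show "\<exists>k. u - k *s a \<in> col z" ..
next
  assume "\<exists>k. u - k *s a \<in> col z"
  then obtain c where "u - c *s a \<in> col z" by blast
  then obtain p where p: "z *v p = u - c *s a" unfolding col_def by (metis rangeE)
  obtain k where k: "z *v k = 0" "dotp b k \<noteq> 0" using kernel_separates_row_sp[OF assms] by blast
  have "(z + outer a b) *v (p + ((c - dotp b p) / dotp b k) *s k) = u"
    using k by (simp add: add_outer_mult matrix_vector_right_distrib vector_scalar_commute dotp_simps p)
  then show "u \<in> col (z + outer a b)" by (auto simp: col_def)
qed

text \<open>With \<open>z *v p0 = a\<close> and \<open>dotp b p0 = - 1\<close>, the perturbed image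
  of \<open>p'\<close> is the image under \<open>z\<close> of \<open>p' + dotp b p' *s p0\<close>, a
  vector orthogonal to \<open>b\<close>. Conversely, \<open>p\<close> orthogonal to \<open>b\<close>
  does not feel the perturbation. The column space shrinks to a hyperplane of itself.\<close>

lemma col_dn:
  fixes z :: "'a::field^'n^'m"
  assumes "dnp z a b"
  shows "z *v p \<in> col (z + outer a b) \<longleftrightarrow> dotp b p = 0" "col (z + outer a b) \<subseteq> col z"
proof -
  obtain p0 where p0: "z *v p0 = a" "dotp b p0 = - 1" and b: "b \<in> row_sp z"
    using assms by (auto simp: dnp_def)
  show "z *v p \<in> col (z + outer a b) \<longleftrightarrow> dotp b p = 0"
  proof
    assume "z *v p \<in> col (z + outer a b)"
    then obtain p' where "z *v p = z *v p' + dotp b p' *s a" by (auto simp: col_def add_outer_mult)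
    then have "z *v p = z *v (p' + dotp b p' *s p0)"
      by (simp add: matrix_vector_right_distrib vector_scalar_commute p0)
    then have "dotp b p = dotp b (p' + dotp b p' *s p0)" using b by (rule row_sp_dotp_cong[rotated])
    then show "dotp b p = 0" using p0 by (simp add: dotp_simps)
  next
    assume "dotp b p = 0"
    then have "(z + outer a b) *v p = z *v p" by (simp add: add_outer_mult)
    then show "z *v p \<in> col (z + outer a b)" by (metis mult_in_col)
  qed
  show "col (z + outer a b) \<subseteq> col z"
    using dnp_in_col(1)[OF assms] by (auto simp: col_def[of "z + _"] add_outer_mult col_add col_scale)
qed

section \<open>Complex-valued counts at a fixed matrix\<close>

lemma cN_sum_bool: "cN {x \<in> A. P x} = (\<Sum>x\<in>A. of_bool (P x))" if "finite A"
  using that by (simp add: sum_of_bool_eq Int_def)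

lemma cN_filter_not: "finite A \<Longrightarrow> cN {x \<in> A. \<not> P x} = cN A - cN {x \<in> A. P x}"
proof -
  assume "finite A"
  moreover have "{x \<in> A. \<not> P x} = A - {x \<in> A. P x}" by blast
  ultimately show ?thesis
    by (simp only:) (subst card_Diff_subset, auto simp: of_nat_diff card_mono)
qed

lemma cN_compl: "cN (- A) = cN (UNIV :: 'k::finite set) - cN (A :: 'k set)"
  using cN_filter_not[of "UNIV :: 'k set" "\<lambda>x. x \<in> A"] by (simp add: Compl_eq)

lemma cN_fibres: "cN {x. g x \<in> A} = (\<Sum>a\<in>A. cN {x. g x = a})" for g :: "'i::finite \<Rightarrow> 'k::finite"
proof -
  have "{x. g x \<in> A} = (\<Union>a\<in>A. {x. g x = a})" by auto
  then have "card {x. g x \<in> A} = card (\<Union>a\<in>A. {x. g x = a})" by (rule arg_cong)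
  also have "\<dots> = (\<Sum>a\<in>A. card {x. g x = a})" by (rule card_UN_disjoint) auto
  finally show ?thesis by (simp only: of_nat_sum)
qed

lemma sum_bool_scale_eq:
  assumes "c \<noteq> 0" "\<And>a k. k \<noteq> 0 \<Longrightarrow> k *s a \<in> A \<longleftrightarrow> a \<in> A"
  shows "(\<Sum>a\<in>A. of_bool (c *s a = w) :: complex) = of_bool ((w :: 'a::{finite,field}^'k) \<in> A)"
proof -
  have "c *s a = w \<longleftrightarrow> a = inverse c *s w" for a
    using assms(1) by (auto simp: vector_smult_assoc)
  then have "(\<Sum>a\<in>A. of_bool (c *s a = w) :: complex) = (\<Sum>a\<in>A. of_bool (a = inverse c *s w))"
    by (simp only:)
  also have "\<dots> = of_bool (inverse c *s w \<in> A)"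
    unfolding of_bool_def by (simp add: sum.delta)
  also have "\<dots> = of_bool (w \<in> A)" using assms(2)[of "inverse c" w] assms(1) by simp
  finally show ?thesis .
qed

text \<open>\<open>P\<close>, \<open>Q\<close> and \<open>s\<close> are the sizes of the two ambient
  spaces and of the column space. In these terms all counts are rational expressions, passing to a
  neighbour of larger or smaller rank replaces \<open>s\<close> by \<open>q * s\<close> or
  \<open>s / q\<close>, and transposition exchanges \<open>P\<close> and \<open>Q\<close>.\<close>

locale rank_data =
  fixes z :: "'a::{finite,field}^'n^'m" and q P Q s :: complex
  assumes q: "q = of_nat CARD('a)" and P: "P = q ^ CARD('m)" and Q: "Q = q ^ CARD('n)"
    and s: "s = q ^ rank z"
begin

lemma transposed: "rank_data (transpose z) q Q P s"
  by standard (simp_all add: q P Q s rank_transpose_finite)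

lemma nz: "q \<noteq> 0" "q \<noteq> 1" "q - 1 \<noteq> 0" "s \<noteq> 0" "P \<noteq> 0" "Q \<noteq> 0"
proof -
  show "q \<noteq> 0" by (simp add: q)
  show "q \<noteq> 1" using CARD_field_gt_1[where 'a = 'a] by (simp add: q)
  then show "q - 1 \<noteq> 0" by simp
  show "s \<noteq> 0" "P \<noteq> 0" "Q \<noteq> 0" by (simp_all add: s P Q q)
qed

lemma cN_UNIV: "cN (UNIV :: ('a^'m) set) = P" "cN (UNIV :: ('a^'n) set) = Q"
  by (simp_all add: P Q q)

lemma cN_col: "cN (col z) = s" "cN (row_sp z) = s" "cN (- col z) = P - s" "cN (- row_sp z) = Q - s"
    "cN (col z - {0}) = s - 1" "cN (row_sp z - {0}) = s - 1"
proof -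
  show 1: "cN (col z) = s" "cN (row_sp z) = s"
    by (simp_all add: card_col rank_transpose_finite s q)
  show "cN (- col z) = P - s" "cN (- row_sp z) = Q - s"
    using 1 by (simp_all only: cN_compl cN_UNIV)
  have "card (col z) > 0" "card (row_sp z) > 0" by (simp_all add: card_gt_0_iff) (metis col_zero empty_iff)+
  then show "cN (col z - {0}) = s - 1" "cN (row_sp z - {0}) = s - 1"
    using 1 by (simp_all add: card_Diff_singleton of_nat_diff)
qed

lemma cN_fibre: "cN {p. z *v p = a} = of_bool (a \<in> col z) * (Q / s)"
proof (cases "a \<in> col z")
  case True
  then obtain p0 where p0: "z *v p0 = a" by (auto simp: col_def)
  have "card {p. z *v p = a} = card {p. z *v p = 0}"
    by (rule bij_betw_same_card[of "\<lambda>p. p - p0"],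
        rule bij_betw_byWitness[where f' = "\<lambda>p. p + p0"])
      (auto simp: p0 matrix_vector_right_distrib matrix_vector_mult_diff_distrib)
  moreover have "s * cN {p. z *v p = 0} = Q"
    using arg_cong[OF card_kernel[of z], of "of_nat :: nat \<Rightarrow> complex"]
    unfolding of_nat_mult cN_col by (simp add: Q q)
  ultimately show ?thesis using True nz by (simp add: field_simps)
next
  case False
  then have "{p. z *v p = a} = {}" by auto
  then show ?thesis using False by simp
qed

text \<open>A kernel vector not orthogonal to \<open>v\<close> translates along every fibre, so the
  values of \<open>dotp v\<close> are equidistributed there.\<close>

lemma cN_fibre_out:
  assumes "v \<notin> row_sp z"
  shows "cN {p. z *v p = a \<and> dotp v p = t} = of_bool (a \<in> col z) * (Q / s / q)"
proof -
  obtain k where k: "z *v k = 0" "dotp v k \<noteq> 0" using kernel_separates_row_sp[OF assms] by blast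
  have "CARD('a) * card {p \<in> {p. z *v p = a}. dotp v p = t} = card {p. z *v p = a}"
    by (rule card_level_set[where sh = "\<lambda>c p. p + (c / dotp v k) *s k"])
      (use k in \<open>auto simp: dotp_simps matrix_vector_right_distrib vector_scalar_commute vec_eq_iff\<close>)
  then have "q * cN {p. z *v p = a \<and> dotp v p = t} = cN {p. z *v p = a}"
    unfolding q of_nat_mult[symmetric] by simp
  then show ?thesis using nz unfolding cN_fibre by (simp add: field_simps)
qed

text \<open>In contrast to the previous case, \<open>dotp v\<close> is constant on each
  fibre.\<close>

lemma cN_fibre_in:
  assumes "v \<in> row_sp z"
  shows "cN {p. z *v p = a \<and> dotp v p = t} = of_bool (\<exists>p. z *v p = a \<and> dotp v p = t) * (Q / s)"
proof (cases "\<exists>p. z *v p = a \<and> dotp v p = t")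
  case True
  then obtain p0 where p0: "z *v p0 = a" "dotp v p0 = t" by blast
  have "dotp v p = t" if "z *v p = a" for p
    using row_sp_dotp_cong[OF assms, of p p0] p0 that by simp
  then have "{p. z *v p = a \<and> dotp v p = t} = {p. z *v p = a}" by blast
  moreover have "a \<in> col z" using p0 by auto
  ultimately show ?thesis using True by (simp add: cN_fibre)
next
  case False
  then have "{p. z *v p = a \<and> dotp v p = t} = {}" by blast
  then have "cN {p. z *v p = a \<and> dotp v p = t} = 0" by (simp only: card.empty of_nat_0)
  then show ?thesis using False by (simp only: of_bool_eq mult_zero_left)
qed

lemma cN_dotp: "b \<noteq> 0 \<Longrightarrow> cN {p. dotp (b :: 'a^'n) p = t} = Q / q"
    "b' \<noteq> 0 \<Longrightarrow> cN {p. dotp (b' :: 'a^'m) p = t} = P / q"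
proof -
  have eq: "cN {p. dotp b p = t} = q ^ CARD('k) / q" if "b \<noteq> 0" for b :: "'a^'k"
    using arg_cong[OF card_dotp_eq[OF that, of t], of "of_nat :: nat \<Rightarrow> complex"] nz
    by (simp add: q field_simps)
  show "b \<noteq> 0 \<Longrightarrow> cN {p. dotp (b :: 'a^'n) p = t} = Q / q"
    "b' \<noteq> 0 \<Longrightarrow> cN {p. dotp (b' :: 'a^'m) p = t} = P / q"
    by (simp_all add: eq P Q)
qed

text \<open>Each element of the row space has \<open>P / s\<close> preimages under
  \<open>transpose z\<close>, which reduces counting in the row space to counting in the ambient
  space.\<close>

lemma cN_row_sp: "cN {b \<in> row_sp z. \<phi> b} = s / P * cN {\<sigma>. \<phi> (transpose z *v \<sigma>)}"
proof -
  interpret T: rank_data "transpose z" q Q P s by (rule transposed)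
  have "cN {\<sigma>. \<phi> (transpose z *v \<sigma>)} = cN {\<sigma>. transpose z *v \<sigma> \<in> {b \<in> row_sp z. \<phi> b}}"
    by simp
  also have "\<dots> = (\<Sum>b\<in>{b \<in> row_sp z. \<phi> b}. P / s)"
    unfolding cN_fibres T.cN_fibre by (intro sum.cong) auto
  finally show ?thesis using nz by simp
qed

lemma cN_row_sp_dotp: "z *v p \<noteq> 0 \<Longrightarrow> cN {b \<in> row_sp z. dotp b p = t} = s / q"
  using nz unfolding cN_row_sp dotp_adjoint[symmetric]
  by (subst dotp_commute) (simp add: cN_dotp)

lemma cN_row_sp_dotp2:
  assumes "z *v p \<noteq> 0" "z *v p' \<notin> range (\<lambda>k. k *s (z *v p))"
  shows "cN {b \<in> row_sp z. dotp b p = t \<and> dotp b p' = t'} = s / q / q"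
proof -
  have "q * (q * cN {\<sigma>. dotp (z *v p) \<sigma> = t \<and> dotp (z *v p') \<sigma> = t'}) = P"
    using arg_cong[OF card_dotp_eq2[OF assms, of t t'], of "of_nat :: nat \<Rightarrow> complex"]
    by (simp add: P q)
  then have "cN {\<sigma>. dotp \<sigma> (z *v p) = t \<and> dotp \<sigma> (z *v p') = t'} = P / q / q"
    using nz by (simp add: dotp_commute field_simps)
  then show ?thesis
    using nz unfolding cN_row_sp dotp_adjoint[symmetric] by simp
qed

text \<open>By \<open>col_up\<close> the new column space is \<open>col z\<close> plus the line of
  \<open>a\<close>, and the sum is direct since \<open>a\<close> is outside.\<close>

lemma rank_up: "a \<notin> col z \<Longrightarrow> b \<notin> row_sp z \<Longrightarrow> rank (z + outer a b) = Suc (rank z)"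
proof -
  assume a: "a \<notin> col z" and b: "b \<notin> row_sp z"
  have a0: "a \<noteq> 0" using a by auto
  have "bij_betw (\<lambda>(k, c). c + k *s a) (UNIV \<times> col z) (col (z + outer a b))"
  proof (rule bij_betw_imageI)
    show "inj_on (\<lambda>(k, c). c + k *s a) (UNIV \<times> col z)"
    proof (clarsimp simp: inj_on_def)
      fix k c k' c' assume c: "c \<in> col z" "c' \<in> col z" and eq: "c + k *s a = c' + k' *s a"
      have "(k - k') *s a = c' - c" using eq by (simp add: vec_eq_iff algebra_simps)
      then have "(k - k') *s a \<in> col z" using c by (simp add: col_diff)
      then have "k = k'" using a col_scale_iff[of "k - k'" a z] by auto
      then show "k = k' \<and> c = c'" using eq by simp
    qed
    show "(\<lambda>(k, c). c + k *s a) ` (UNIV \<times> col z) = col (z + outer a b)"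
    proof (intro equalityI subsetI)
      fix w assume "w \<in> (\<lambda>(k, c). c + k *s a) ` (UNIV \<times> col z)"
      then obtain k c where "w = c + k *s a" "c \<in> col z" by auto
      then show "w \<in> col (z + outer a b)" by (auto simp: col_up[OF b] intro!: exI[of _ k])
    next
      fix w assume "w \<in> col (z + outer a b)"
      then obtain k where "w - k *s a \<in> col z" by (auto simp: col_up[OF b])
      then show "w \<in> (\<lambda>(k, c). c + k *s a) ` (UNIV \<times> col z)"
        by (intro image_eqI[of _ _ "(k, w - k *s a)"]) auto
    qed
  qed
  from bij_betw_same_card[OF this] show ?thesis
    by (simp add: rank_eq_iff_card_col card_cartesian_product card_col)
qed

lemma rank_same: "\<not> dnp z a b \<Longrightarrow> a \<in> col z \<or> b \<in> row_sp z \<Longrightarrow> rank (z + outer a b) = rank z"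
proof -
  assume n: "\<not> dnp z a b" and ab: "a \<in> col z \<or> b \<in> row_sp z"
  from ab show ?thesis
  proof
    assume "a \<in> col z"
    then show ?thesis using col_same[OF _ n] by (simp add: rank_eq_iff_card_col card_col)
  next
    assume "b \<in> row_sp z"
    then have "col (transpose z + outer b a) = row_sp z"
      using n by (intro col_same) (auto simp: dnp_transpose)
    then have "CARD('a) ^ rank (z + outer a b) = CARD('a) ^ rank z"
      unfolding card_row_sp[symmetric] transpose_add_outer by (rule arg_cong)
    then show ?thesis using CARD_field_gt_1[where 'a = 'a] by simp
  qed
qed

lemma rank_dn: "dnp z a b \<Longrightarrow> Suc (rank (z + outer a b)) = rank z"
proof -
  assume d: "dnp z a b"
  then obtain p0 where p0: "z *v p0 = a" "dotp b p0 = - 1" "b \<in> row_sp z" by (auto simp: dnp_def)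
  \<comment> \<open>The functional that \<open>b\<close> induces on the column space. The chosen
    preimage does not matter, because \<open>b\<close> lies in the row space.\<close>
  define l where "l c = dotp b (SOME p. z *v p = c)" for c
  have l: "l (z *v p) = dotp b p" for p
    unfolding l_def using p0(3) by (rule row_sp_dotp_cong) (rule someI, rule refl)
  have "CARD('a) * card {c \<in> col z. l c = 0} = card (col z)"
  \<comment> \<open>As \<open>l a = - 1\<close>, subtracting \<open>k *s a\<close> raises
    \<open>l\<close> by \<open>k\<close>. So the kernel of \<open>l\<close>, which is the new column
    space, is smaller by one factor \<open>CARD('a)\<close>.\<close>
  proof (rule card_level_set[where sh = "\<lambda>k c. c + (- k) *s a"])
    show "c + - k *s a \<in> col z" if "c \<in> col z" for k c
      using that p0(1) by (metis col_add col_scale mult_in_col)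
    show "l (c + - k *s a) = l c + k" if c: "c \<in> col z" for k c
    proof -
      obtain p where p: "c = z *v p" using c by (auto simp: col_def)
      have "c + - k *s a = z *v (p + (- k) *s p0)"
        by (simp only: p p0(1)[symmetric] matrix_vector_right_distrib vector_scalar_commute)
      then show ?thesis using p0(2) by (simp only: l p) (simp add: dotp_simps)
    qed
  qed (simp add: vec_eq_iff)
  moreover have "{c \<in> col z. l c = 0} = col (z + outer a b)"
    using col_dn[OF d] l by (auto simp: col_def[of z])
  ultimately have "CARD('a) ^ Suc (rank (z + outer a b)) = CARD('a) ^ rank z"
    by (simp add: card_col)
  then show ?thesis by (simp only: power_inject_exp[OF CARD_field_gt_1])
qed

end

section \<open>Sums over rank one perturbations\<close>

definition upS :: "'a::{finite,field}^'n^'m \<Rightarrow> ('a^'n^'m \<Rightarrow> complex) \<Rightarrow> complex" where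
  "upS z \<Phi> = (\<Sum>a\<in>- col z. \<Sum>b\<in>- row_sp z. \<Phi> (z + outer a b))"

definition dnS :: "'a::{finite,field}^'n^'m \<Rightarrow> ('a^'n^'m \<Rightarrow> complex) \<Rightarrow> complex" where
  "dnS z \<Phi> = (\<Sum>a\<in>col z. \<Sum>b\<in>row_sp z. of_bool (dnp z a b) * \<Phi> (z + outer a b))"

text \<open>As in \<open>upS\<close> and \<open>dnS\<close>, the sum is over pairs
  \<open>(a, b)\<close> and not over neighbours. Each neighbour arises from
  \<open>CARD('a) - 1\<close> pairs, a factor that is divided out only in the passage to
  \<open>Adj\<close> by \<open>sum_bf_adj\<close>.\<close>

definition totS :: "'a::{finite,field}^'n^'m \<Rightarrow> ('a^'n^'m \<Rightarrow> complex) \<Rightarrow> complex" where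
  "totS z \<Phi> = (\<Sum>a\<in>- {0}. \<Sum>b\<in>- {0}. \<Phi> (z + outer a b))"

definition smS :: "'a::{finite,field}^'n^'m \<Rightarrow> ('a^'n^'m \<Rightarrow> complex) \<Rightarrow> complex" where
  "smS z \<Phi> = (\<Sum>a\<in>col z - {0}. \<Sum>b\<in>- row_sp z. \<Phi> (z + outer a b))
     + (\<Sum>a\<in>- col z. \<Sum>b\<in>row_sp z - {0}. \<Phi> (z + outer a b))
     + (\<Sum>a\<in>col z - {0}. \<Sum>b\<in>row_sp z - {0}. of_bool (\<not> dnp z a b) * \<Phi> (z + outer a b))"

lemma not_dnp_zero [simp]: "\<not> dnp z 0 b" "\<not> dnp z a 0"
  using dnp_nonzero by blast+

lemma dnS_alt: "dnS z \<Phi> = (\<Sum>a\<in>col z - {0}. \<Sum>b\<in>row_sp z - {0}. of_bool (dnp z a b) * \<Phi> (z + outer a b))"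
proof -
  have "(\<Sum>b\<in>row_sp z. of_bool (dnp z a b) * \<Phi> (z + outer a b))
      = (\<Sum>b\<in>row_sp z - {0}. of_bool (dnp z a b) * \<Phi> (z + outer a b))" for a
    by (rule sum.mono_neutral_right) auto
  then show ?thesis unfolding dnS_def
    by (simp only:) (rule sum.mono_neutral_right, simp, blast, intro ballI sum.neutral, auto)
qed

lemma totS_split: "totS z \<Phi> = upS z \<Phi> + dnS z \<Phi> + smS z \<Phi>"
proof -
  have split: "(\<Sum>a\<in>- {0}. f a) = (\<Sum>a\<in>col w - {0}. f a) + (\<Sum>a\<in>- col w. f a)"
    for w :: "'x::{finite,field}^'y^'t" and f :: "_ \<Rightarrow> complex"
  proof -
    have "- {0} = (col w - {0}) \<union> - col w" by auto
    then show ?thesis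
      by (simp only:) (rule sum.union_disjoint, auto)
  qed
  have "(\<Sum>a\<in>col z - {0}. \<Sum>b\<in>row_sp z - {0}. \<Phi> (z + outer a b))
      = dnS z \<Phi> + (\<Sum>a\<in>col z - {0}. \<Sum>b\<in>row_sp z - {0}. of_bool (\<not> dnp z a b) * \<Phi> (z + outer a b))"
    unfolding dnS_alt sum.distrib[symmetric] by (intro sum.cong refl) auto
  then show ?thesis
    unfolding totS_def split[of _ z] split[of _ "transpose z"] upS_def smS_def sum.distrib
    by (simp only: add_ac)
qed

lemma sum_transpose:
  "upS (transpose z) \<Phi> = upS z (\<lambda>w. \<Phi> (transpose w))"
  "dnS (transpose z) \<Phi> = dnS z (\<lambda>w. \<Phi> (transpose w))"
  "smS (transpose z) \<Phi> = smS z (\<lambda>w. \<Phi> (transpose w))"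
proof -
  show "upS (transpose z) \<Phi> = upS z (\<lambda>w. \<Phi> (transpose w))"
    unfolding upS_def by (subst sum.swap) (simp add: transpose_add_outer)
  show "dnS (transpose z) \<Phi> = dnS z (\<lambda>w. \<Phi> (transpose w))"
    unfolding dnS_def by (subst sum.swap) (simp add: transpose_add_outer dnp_transpose)
  have 1: "(\<Sum>a\<in>row_sp z - {0}. \<Sum>b\<in>- col z. \<Phi> (transpose z + outer a b))
     = (\<Sum>b\<in>- col z. \<Sum>a\<in>row_sp z - {0}. \<Phi> (transpose z + outer a b))" by (rule sum.swap)
  have 2: "(\<Sum>a\<in>- row_sp z. \<Sum>b\<in>col z - {0}. \<Phi> (transpose z + outer a b))
     = (\<Sum>b\<in>col z - {0}. \<Sum>a\<in>- row_sp z. \<Phi> (transpose z + outer a b))" by (rule sum.swap)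
  have 3: "(\<Sum>a\<in>row_sp z - {0}. \<Sum>b\<in>col z - {0}. of_bool (\<not> dnp z b a) * \<Phi> (transpose z + outer a b))
     = (\<Sum>b\<in>col z - {0}. \<Sum>a\<in>row_sp z - {0}. of_bool (\<not> dnp z b a) * \<Phi> (transpose z + outer a b))"
    by (rule sum.swap)
  show "smS (transpose z) \<Phi> = smS z (\<lambda>w. \<Phi> (transpose w))"
    unfolding smS_def transpose_transpose dnp_transpose transpose_add_outer 1 2 3
    by (simp only: add_ac)
qed

text \<open>Later \<open>T\<close> is \<open>UNIV\<close>, which gives access to \<open>fF\<close>,
  or \<open>{p. dotp v p = t}\<close>, which gives access to \<open>phiF\<close>.\<close>

definition psiT :: "'a::{finite,field}^'m \<Rightarrow> ('a^'n) set \<Rightarrow> 'a^'n^'m \<Rightarrow> complex" where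
  "psiT u T z = cN {p \<in> T. z *v p = u}"

lemma psi_sum:
  fixes z :: "'a::{finite,field}^'n^'m"
  assumes A: "0 \<notin> A" "\<And>a k. k \<noteq> 0 \<Longrightarrow> k *s a \<in> A \<longleftrightarrow> a \<in> A"
  shows "(\<Sum>a\<in>A. \<Sum>b\<in>B. psiT u T (z + outer a b))
    = (\<Sum>p\<in>T. if z *v p = u then cN A * cN {b \<in> B. dotp b p = 0}
          else of_bool (u - z *v p \<in> A) * cN {b \<in> B. dotp b p \<noteq> 0})"
proof -
  have inner: "(\<Sum>a\<in>A. of_bool ((z + outer a b) *v p = u) :: complex)
      = (if z *v p = u then cN A * of_bool (dotp b p = 0)
         else of_bool (u - z *v p \<in> A) * of_bool (dotp b p \<noteq> 0))" for b p
  proof (cases "dotp b p = 0")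
    case True
    then show ?thesis by (simp add: add_outer_mult)
  next
    case False
    have "(z + outer a b) *v p = u \<longleftrightarrow> dotp b p *s a = u - z *v p" for a
      unfolding add_outer_mult eq_diff_eq by (simp only: add.commute)
    then have "(\<Sum>a\<in>A. of_bool ((z + outer a b) *v p = u) :: complex) = of_bool (u - z *v p \<in> A)"
      by (simp only:) (subst sum_bool_scale_eq[OF False], use A(2) in auto)
    then show ?thesis using False A(1) by simp
  qed
  have "(\<Sum>a\<in>A. \<Sum>b\<in>B. psiT u T (z + outer a b))
      = (\<Sum>a\<in>A. \<Sum>b\<in>B. \<Sum>p\<in>T. of_bool ((z + outer a b) *v p = u) :: complex)"
    unfolding psiT_def by (simp only: cN_sum_bool[OF finite])
  also have "\<dots> = (\<Sum>b\<in>B. \<Sum>p\<in>T. \<Sum>a\<in>A. of_bool ((z + outer a b) *v p = u) :: complex)"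
    by (subst sum.swap, intro sum.cong refl, rule sum.swap)
  also have "\<dots> = (\<Sum>p\<in>T. \<Sum>b\<in>B. \<Sum>a\<in>A. of_bool ((z + outer a b) *v p = u) :: complex)"
    by (rule sum.swap)
  also have "\<dots> = (\<Sum>p\<in>T. if z *v p = u then cN A * cN {b \<in> B. dotp b p = 0}
          else of_bool (u - z *v p \<in> A) * cN {b \<in> B. dotp b p \<noteq> 0})"
    unfolding inner
  proof (rule sum.cong[OF refl], goal_cases)
    case (1 p)
    show ?case
      by (cases "z *v p = u")
        (simp_all only: cN_sum_bool[OF finite] sum_distrib_left if_True if_False simp_thms)
  qed
  finally show ?thesis .
qed

context rank_data
begin

lemma q_pow: "of_nat CARD('a) ^ CARD('n) = Q" "of_nat CARD('a) ^ CARD('m) = P"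
  by (simp_all add: q Q P)

lemma row_sp_zero_dotp: "z *v p = 0 \<Longrightarrow> {b \<in> row_sp z. dotp b p = 0} = row_sp z"
  using row_sp_annihilates_kernel by blast

lemma cN_not_row_sp_dotp:
  "z *v p \<noteq> 0 \<Longrightarrow> cN {b \<in> - row_sp z. dotp b p = 0} = Q / q - s / q"
  "cN {b \<in> - row_sp z. dotp b p \<noteq> 0} = (1 - 1 / q) * (Q * of_bool (p \<noteq> 0) - s * of_bool (z *v p \<noteq> 0))"
  "cN {b \<in> row_sp z - {0}. dotp b p \<noteq> 0} = s * (1 - 1 / q) * of_bool (z *v p \<noteq> 0)"
  "z *v p \<noteq> 0 \<Longrightarrow> cN {b \<in> row_sp z - {0}. dotp b p = 0} = s / q - 1"
  "cN {b \<in> - {0}. dotp b p \<noteq> 0} = Q * (1 - 1 / q) * of_bool (p \<noteq> 0)"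
  "p \<noteq> 0 \<Longrightarrow> cN {b \<in> - {0}. dotp b p = 0} = Q / q - 1"
proof -
  have all: "cN {b. dotp b p = 0} = (if p = 0 then Q else Q / q)"
    using cN_dotp(1)[of p 0] by (simp add: dotp_commute[of _ p] q_pow)
  have row: "cN {b \<in> row_sp z. dotp b p = 0} = (if z *v p = 0 then s else s / q)"
    using cN_row_sp_dotp[of p 0] row_sp_zero_dotp[of p] by (simp add: cN_col)
  have p0: "z *v p \<noteq> 0 \<Longrightarrow> p \<noteq> 0" by auto
  have diff: "cN {b \<in> - row_sp z. dotp b p = 0} = cN {b. dotp b p = 0} - cN {b \<in> row_sp z. dotp b p = 0}"
    using cN_filter_not[of "{b. dotp b p = 0}" "\<lambda>b. b \<in> row_sp z"] by (simp add: conj_commute)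
  show 1: "z *v p \<noteq> 0 \<Longrightarrow> cN {b \<in> - row_sp z. dotp b p = 0} = Q / q - s / q"
    unfolding diff all row using p0 by simp
  show "cN {b \<in> - row_sp z. dotp b p \<noteq> 0} = (1 - 1 / q) * (Q * of_bool (p \<noteq> 0) - s * of_bool (z *v p \<noteq> 0))"
    unfolding cN_filter_not[OF finite] diff all row cN_col using p0 by (auto simp: algebra_simps)
  have z: "{b \<in> B - {0}. dotp b p = 0} = {b \<in> B. dotp b p = 0} - {0}" for B by auto
  have nz': "{b \<in> B - {0}. dotp b p \<noteq> 0} = {b \<in> B. dotp b p \<noteq> 0}" for B by auto
  show "cN {b \<in> row_sp z - {0}. dotp b p \<noteq> 0} = s * (1 - 1 / q) * of_bool (z *v p \<noteq> 0)"
    unfolding nz' cN_filter_not[OF finite] row cN_col by (auto simp: algebra_simps)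
  have card1: "cN (B - {0}) = cN B - 1" if "0 \<in> B" for B :: "('a^'n) set"
    using cN_filter_not[of B "\<lambda>b. b = 0"] that by (simp add: set_diff_eq Collect_conv_if)
  show "z *v p \<noteq> 0 \<Longrightarrow> cN {b \<in> row_sp z - {0}. dotp b p = 0} = s / q - 1"
    unfolding z by (subst card1) (simp_all add: row)
  have U: "{b \<in> - {0}. dotp b p \<noteq> 0} = {b \<in> UNIV. dotp b p \<noteq> 0}" by auto
  show "cN {b \<in> - {0}. dotp b p \<noteq> 0} = Q * (1 - 1 / q) * of_bool (p \<noteq> 0)"
    unfolding U cN_filter_not[OF finite] by (auto simp: all q_pow algebra_simps)
  have U': "{b \<in> - {0}. dotp b p = 0} = {b. dotp b p = 0} - {0}" by auto
  show "p \<noteq> 0 \<Longrightarrow> cN {b \<in> - {0}. dotp b p = 0} = Q / q - 1"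
    unfolding U' by (subst card1) (simp_all add: all)
qed

lemma scale_mem:
  "k \<noteq> 0 \<Longrightarrow> k *s a \<in> - col z \<longleftrightarrow> a \<in> - col z"
  "k \<noteq> 0 \<Longrightarrow> k *s (a :: 'a^'m) \<in> - {0} \<longleftrightarrow> a \<in> - {0}"
  by (auto simp: col_scale_iff)

lemma diff_mem:
  "u - z *v p \<in> - col z \<longleftrightarrow> u \<notin> col z" "u - z *v p \<in> - {0} \<longleftrightarrow> z *v p \<noteq> u"
  by (auto simp: col_diff_iff)

lemma sum_psi_cases:
  fixes T :: "('a^'n) set" and c d e :: complex
  shows "(\<Sum>p\<in>T. if z *v p = u then c else of_bool (\<phi> p) * d + of_bool (\<theta> p) * e)
    = psiT u T z * c + d * cN {p \<in> T. z *v p \<noteq> u \<and> \<phi> p} + e * cN {p \<in> T. z *v p \<noteq> u \<and> \<theta> p}"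
proof -
  have "(\<Sum>p\<in>T. if z *v p = u then c else of_bool (\<phi> p) * d + of_bool (\<theta> p) * e)
    = (\<Sum>p\<in>T. of_bool (z *v p = u) * c + d * of_bool (z *v p \<noteq> u \<and> \<phi> p) + e * of_bool (z *v p \<noteq> u \<and> \<theta> p))"
    by (intro sum.cong refl) auto
  then show ?thesis
    unfolding psiT_def cN_sum_bool[OF finite] sum.distrib sum_distrib_right sum_distrib_left by simp
qed

text \<open>If \<open>u\<close> is in \<open>col z\<close>, then adding a nonzero multiple of some
  \<open>a\<close> outside \<open>col z\<close> cannot move \<open>z *v p\<close> onto
  \<open>u\<close>. Only \<open>p\<close> with \<open>z *v p = u\<close> contribute in that
  case.\<close>

lemma up_psi:
  assumes u: "u \<noteq> 0"
  shows "upS z (psiT u T) = psiT u T z * ((P - s) * (Q - s) / q)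
    + of_bool (u \<notin> col z) * (1 - 1 / q) * (Q * cN {p \<in> T. p \<noteq> 0} - s * cN {p \<in> T. z *v p \<noteq> 0})"
proof -
  have "upS z (psiT u T) = (\<Sum>p\<in>T. if z *v p = u then (P - s) * (Q / q - s / q)
      else of_bool (u \<notin> col z \<and> p \<noteq> 0) * ((1 - 1 / q) * Q) + of_bool (u \<notin> col z \<and> z *v p \<noteq> 0) * (- (1 - 1 / q) * s))"
    (is "_ = ?R")
  proof -
    have "(\<Sum>a\<in>- col z. \<Sum>b\<in>- row_sp z. psiT u T (z + outer a b))
      = (\<Sum>p\<in>T. if z *v p = u then cN (- col z) * cN {b \<in> - row_sp z. dotp b p = 0}
          else of_bool (u - z *v p \<in> - col z) * cN {b \<in> - row_sp z. dotp b p \<noteq> 0})"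
      by (rule psi_sum) (simp, rule scale_mem(1))
    also have "\<dots> = ?R"
    proof (rule sum.cong[OF refl], goal_cases)
      case (1 p)
      have "p \<noteq> 0 \<and> z *v p \<noteq> 0" if "z *v p = u" using that u by auto
      then show ?case
        by (cases "z *v p = u")
          (simp_all add: cN_not_row_sp_dotp(1) cN_not_row_sp_dotp(2) cN_col diff_mem algebra_simps del: mem_Collect_eq Compl_iff Diff_iff)
    qed
    finally show ?thesis unfolding upS_def .
  qed
  also have "\<dots> = psiT u T z * ((P - s) * (Q / q - s / q))
     + (1 - 1 / q) * Q * cN {p \<in> T. z *v p \<noteq> u \<and> u \<notin> col z \<and> p \<noteq> 0}
     + (- (1 - 1 / q) * s) * cN {p \<in> T. z *v p \<noteq> u \<and> u \<notin> col z \<and> z *v p \<noteq> 0}"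
    by (rule sum_psi_cases)
  also have "{p \<in> T. z *v p \<noteq> u \<and> u \<notin> col z \<and> p \<noteq> 0} = (if u \<in> col z then {} else {p \<in> T. p \<noteq> 0})"
    by auto
  also have "{p \<in> T. z *v p \<noteq> u \<and> u \<notin> col z \<and> z *v p \<noteq> 0} = (if u \<in> col z then {} else {p \<in> T. z *v p \<noteq> 0})"
    by auto
  finally show ?thesis
    by (cases "u \<in> col z") (simp_all add: algebra_simps diff_divide_distrib add_divide_distrib)
qed

lemma tot_psi:
  assumes u: "u \<noteq> 0"
  shows "totS z (psiT u T) = psiT u T z * ((P - 1) * (Q / q - 1))
    + Q * (1 - 1 / q) * (cN {p \<in> T. p \<noteq> 0} - psiT u T z)"
proof -
  have c: "cN (- {0 :: 'a^'m}) = P - 1" by (simp add: cN_compl q_pow)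
  have "totS z (psiT u T) = (\<Sum>p\<in>T. if z *v p = u then (P - 1) * (Q / q - 1)
      else of_bool (p \<noteq> 0) * (Q * (1 - 1 / q)) + of_bool False * 0)"
    (is "_ = ?R")
  proof -
    have "(\<Sum>a\<in>- {0}. \<Sum>b\<in>- {0}. psiT u T (z + outer a b))
      = (\<Sum>p\<in>T. if z *v p = u then cN (- {0 :: 'a^'m}) * cN {b \<in> - {0}. dotp b p = 0}
          else of_bool (u - z *v p \<in> - {0}) * cN {b \<in> - {0}. dotp b p \<noteq> 0})"
      by (rule psi_sum) (simp, rule scale_mem(2))
    also have "\<dots> = ?R"
    proof (rule sum.cong[OF refl], goal_cases)
      case (1 p)
      have "p \<noteq> 0 \<and> z *v p \<noteq> 0" if "z *v p = u" using that u by auto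
      then show ?case
        by (cases "z *v p = u")
          (simp_all add: cN_not_row_sp_dotp(6) cN_not_row_sp_dotp(5) c diff_mem algebra_simps del: mem_Collect_eq Compl_iff Diff_iff)
    qed
    finally show ?thesis unfolding totS_def .
  qed
  also have "\<dots> = psiT u T z * ((P - 1) * (Q / q - 1))
     + Q * (1 - 1 / q) * cN {p \<in> T. z *v p \<noteq> u \<and> p \<noteq> 0} + 0 * cN {p \<in> T. z *v p \<noteq> u \<and> False}"
    by (rule sum_psi_cases)
  also have "{p \<in> T. z *v p \<noteq> u \<and> p \<noteq> 0} = {p \<in> {p \<in> T. p \<noteq> 0}. z *v p \<noteq> u}" by auto
  also have "cN \<dots> = cN {p \<in> T. p \<noteq> 0} - psiT u T z"
  proof -
    have "{p \<in> {p \<in> T. p \<noteq> 0}. z *v p = u} = {p \<in> T. z *v p = u}" using u by auto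
    then show ?thesis unfolding cN_filter_not[OF finite] psiT_def by (simp only:)
  qed
  finally show ?thesis by simp
qed

text \<open>Among the rank-preserving pairs only those with \<open>a\<close> outside
  \<open>col z\<close> can change the column space; all others keep it by \<open>col_same\<close>.
  So this part alone needs a separate count.\<close>

lemma half_same_psi:
  assumes u: "u \<noteq> 0"
  shows "(\<Sum>a\<in>- col z. \<Sum>b\<in>row_sp z - {0}. psiT u T (z + outer a b))
    = psiT u T z * ((P - s) * (s / q - 1)) + of_bool (u \<notin> col z) * (s * (1 - 1 / q)) * cN {p \<in> T. z *v p \<noteq> 0}"
proof -
  have "(\<Sum>a\<in>- col z. \<Sum>b\<in>row_sp z - {0}. psiT u T (z + outer a b))
    = (\<Sum>p\<in>T. if z *v p = u then (P - s) * (s / q - 1)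
      else of_bool (u \<notin> col z \<and> z *v p \<noteq> 0) * (s * (1 - 1 / q)) + of_bool False * 0)"
    (is "_ = ?R")
  proof -
    have "(\<Sum>a\<in>- col z. \<Sum>b\<in>row_sp z - {0}. psiT u T (z + outer a b))
      = (\<Sum>p\<in>T. if z *v p = u then cN (- col z) * cN {b \<in> row_sp z - {0}. dotp b p = 0}
          else of_bool (u - z *v p \<in> - col z) * cN {b \<in> row_sp z - {0}. dotp b p \<noteq> 0})"
      by (rule psi_sum) (simp, rule scale_mem(1))
    also have "\<dots> = ?R"
    proof (rule sum.cong[OF refl], goal_cases)
      case (1 p)
      have "p \<noteq> 0 \<and> z *v p \<noteq> 0" if "z *v p = u" using that u by auto
      then show ?case
        by (cases "z *v p = u")
          (simp_all add: cN_not_row_sp_dotp(4) cN_not_row_sp_dotp(3) cN_col diff_mem algebra_simps del: mem_Collect_eq Compl_iff Diff_iff)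
    qed
    finally show ?thesis .
  qed
  also have "\<dots> = psiT u T z * ((P - s) * (s / q - 1))
     + (s * (1 - 1 / q)) * cN {p \<in> T. z *v p \<noteq> u \<and> u \<notin> col z \<and> z *v p \<noteq> 0}
     + 0 * cN {p \<in> T. z *v p \<noteq> u \<and> False}"
    by (rule sum_psi_cases)
  also have "{p \<in> T. z *v p \<noteq> u \<and> u \<notin> col z \<and> z *v p \<noteq> 0} = (if u \<in> col z then {} else {p \<in> T. z *v p \<noteq> 0})"
    by auto
  finally show ?thesis by simp
qed

end

section \<open>Indicator functions of incidence and their perturbation sums\<close>

definition fF :: "'a::{finite,field}^'m \<Rightarrow> 'a^'n^'m \<Rightarrow> complex" where
  "fF u z = of_bool (u \<in> col z)"

definition gF :: "'a::{finite,field}^'n \<Rightarrow> 'a^'n^'m \<Rightarrow> complex" where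
  "gF v z = of_bool (v \<in> row_sp z)"

definition hF :: "'a::{finite,field}^'m \<Rightarrow> 'a^'n \<Rightarrow> 'a^'n^'m \<Rightarrow> complex" where
  "hF u v z = of_bool (u \<in> col z \<and> v \<in> row_sp z)"

definition phiF :: "'a::{finite,field}^'m \<Rightarrow> 'a^'n \<Rightarrow> 'a \<Rightarrow> 'a^'n^'m \<Rightarrow> complex" where
  "phiF u v t z = of_bool (v \<in> row_sp z \<and> (\<exists>p. z *v p = u \<and> dotp v p = t))"

lemma hF_eq: "hF u v z = fF u z * gF v z"
  by (simp add: hF_def fF_def gF_def)

lemma gF_transpose: "gF v z = fF v (transpose z)"
  by (simp add: fF_def gF_def)

lemma smS_eq: "smS z \<Phi> = totS z \<Phi> - upS z \<Phi> - dnS z \<Phi>"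
  unfolding totS_split by simp

context rank_data
begin

lemma neighbour_rank_data:
  "a \<notin> col z \<Longrightarrow> b \<notin> row_sp z \<Longrightarrow> rank_data (z + outer a b) q P Q (q * s)"
  "dnp z a b \<Longrightarrow> rank_data (z + outer a b) q P Q (s / q)"
  "\<not> dnp z a b \<Longrightarrow> a \<in> col z \<or> b \<in> row_sp z \<Longrightarrow> rank_data (z + outer a b) q P Q s"
proof -
  show "rank_data (z + outer a b) q P Q (q * s)" if "a \<notin> col z" "b \<notin> row_sp z"
    using that by unfold_locales (simp_all add: q P Q s rank_up)
  show "rank_data (z + outer a b) q P Q (s / q)" if "dnp z a b"
    using rank_dn[OF that, symmetric] nz by unfold_locales (simp_all add: q P Q s)
  show "rank_data (z + outer a b) q P Q s" if "\<not> dnp z a b" "a \<in> col z \<or> b \<in> row_sp z"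
    using rank_same[OF that] by unfold_locales (simp_all add: q P Q s)
qed

lemma smS_scale_cong:
  assumes "\<And>a b. a \<noteq> 0 \<Longrightarrow> b \<noteq> 0 \<Longrightarrow> \<not> dnp z a b \<Longrightarrow> a \<in> col z \<or> b \<in> row_sp z \<Longrightarrow>
     \<Phi> (z + outer a b) = \<Psi> (z + outer a b)"
  shows "smS z \<Phi> = smS z \<Psi>"
proof -
  have "(\<Sum>a\<in>col z - {0}. \<Sum>b\<in>- row_sp z. \<Phi> (z + outer a b)) = (\<Sum>a\<in>col z - {0}. \<Sum>b\<in>- row_sp z. \<Psi> (z + outer a b))"
    by (intro sum.cong refl assms) (auto simp: dnp_def)
  moreover have "(\<Sum>a\<in>- col z. \<Sum>b\<in>row_sp z - {0}. \<Phi> (z + outer a b)) = (\<Sum>a\<in>- col z. \<Sum>b\<in>row_sp z - {0}. \<Psi> (z + outer a b))"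
    by (intro sum.cong refl assms) (auto dest: dnp_in_col)
  moreover have "(\<Sum>a\<in>col z - {0}. \<Sum>b\<in>row_sp z - {0}. of_bool (\<not> dnp z a b) * \<Phi> (z + outer a b))
      = (\<Sum>a\<in>col z - {0}. \<Sum>b\<in>row_sp z - {0}. of_bool (\<not> dnp z a b) * \<Psi> (z + outer a b))"
    using assms by (intro sum.cong refl) auto
  ultimately show ?thesis by (simp only: smS_def)
qed

lemma cN_dnp_row:
  assumes "a \<in> col z"
  shows "cN {b \<in> row_sp z. dnp z a b} = of_bool (a \<noteq> 0) * (s / q)"
proof -
  obtain p where p: "a = z *v p" using assms by (auto simp: col_def)
  have "{b \<in> row_sp z. dnp z a b} = {b \<in> row_sp z. dotp b p = - 1}"
    unfolding p using dnp_iff by blast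
  then show ?thesis
    using cN_row_sp_dotp[of p "- 1"] row_sp_zero_dotp[of p] p by (cases "a = 0") auto
qed

lemma cN_dnp_col:
  assumes "b \<in> row_sp z"
  shows "cN {a \<in> col z. dnp z a b} = of_bool (b \<noteq> 0) * (s / q)"
  using rank_data.cN_dnp_row[OF transposed assms] by (simp add: dnp_transpose)

lemma dn_one: "dnS z (\<lambda>_. 1) = (s - 1) * s / q"
proof -
  have "dnS z (\<lambda>_. 1) = (\<Sum>a\<in>col z. cN {b \<in> row_sp z. dnp z a b})"
    unfolding dnS_def cN_sum_bool[OF finite] by simp
  also have "\<dots> = (\<Sum>a\<in>col z. of_bool (a \<noteq> 0)) * (s / q)"
    unfolding sum_distrib_right by (intro sum.cong refl cN_dnp_row)
  also have "(\<Sum>a\<in>col z. of_bool (a \<noteq> 0)) = cN (col z - {0})"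
    unfolding cN_sum_bool[OF finite, symmetric] by (simp add: set_diff_eq)
  finally show ?thesis by (simp only: cN_col times_divide_eq_right)
qed

lemma up_one: "upS z (\<lambda>_. 1) = (P - s) * (Q - s)"
  by (simp add: upS_def cN_col)

lemma same_one: "smS z (\<lambda>_. 1) = (s - 1) * (Q - s) + (P - s) * (s - 1) + ((s - 1)^2 - (s - 1) * s / q)"
proof -
  have c: "cN (- {0 :: 'a^'m}) = P - 1" "cN (- {0 :: 'a^'n}) = Q - 1" by (simp_all add: cN_compl q_pow)
  have "totS z (\<lambda>_. 1) = (P - 1) * (Q - 1)" by (simp add: totS_def c)
  then have "smS z (\<lambda>_. 1) = (P - 1) * (Q - 1) - (P - s) * (Q - s) - (s - 1) * s / q"
    by (simp only: smS_eq up_one dn_one)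
  then show ?thesis by (simp add: algebra_simps power2_eq_square)
qed

text \<open>For \<open>u\<close> outside \<open>col z\<close> the admissible \<open>a\<close> are
  the vectors \<open>k *s u + c\<close> with \<open>k\<close> nonzero and \<open>c\<close> in
  \<open>col z\<close>, without repetition. For \<open>u\<close> inside, the coefficient 0 serves
  every \<open>a\<close>.\<close>

lemma cN_up_col:
  assumes u: "u \<noteq> 0"
  shows "cN {a \<in> - col z. \<exists>k. u - k *s a \<in> col z} = fF u z * (P - s) + (1 - fF u z) * ((q - 1) * s)"
proof (cases "u \<in> col z")
  case True
  then have "{a \<in> - col z. \<exists>k. u - k *s a \<in> col z} = - col z"
    by (auto intro!: exI[of _ 0])
  then have "cN {a \<in> - col z. \<exists>k. u - k *s a \<in> col z} = P - s" by (simp only: cN_col)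
  then show ?thesis using True by (simp add: fF_def)
next
  case False
  have "bij_betw (\<lambda>(k, c). k *s u + c) ((- {0}) \<times> col z) {a \<in> - col z. \<exists>k. u - k *s a \<in> col z}"
  proof (rule bij_betw_imageI)
    show "inj_on (\<lambda>(k, c). k *s u + c) ((- {0}) \<times> col z)"
    proof (clarsimp simp: inj_on_def)
      fix k c k' c' assume c: "c \<in> col z" "c' \<in> col z" and eq: "k *s u + c = k' *s u + c'"
      have "(k - k') *s u = c' - c" using eq by (simp add: vec_eq_iff algebra_simps)
      then have "(k - k') *s u \<in> col z" using c by (simp add: col_diff)
      then have "k = k'" using False col_scale_iff[of "k - k'" u z] by auto
      then show "k = k' \<and> c = c'" using eq by simp
    qed
    show "(\<lambda>(k, c). k *s u + c) ` ((- {0}) \<times> col z) = {a \<in> - col z. \<exists>k. u - k *s a \<in> col z}"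
    proof (intro equalityI subsetI)
      fix a assume "a \<in> (\<lambda>(k, c). k *s u + c) ` ((- {0}) \<times> col z)"
      then obtain k c where a: "a = k *s u + c" "k \<noteq> 0" "c \<in> col z" by auto
      have "u - inverse k *s a = (- inverse k) *s c"
        using a(2) by (simp add: a(1) vec_eq_iff field_simps)
      then have "u - inverse k *s a \<in> col z" using col_scale[OF a(3), of "- inverse k"] by (simp only:)
      moreover have "a \<notin> col z"
        using False a col_add_iff[of c z "k *s u"] col_scale_iff[of k u z] by (simp add: add.commute)
      ultimately show "a \<in> {a \<in> - col z. \<exists>k. u - k *s a \<in> col z}" by blast
    next
      fix a assume "a \<in> {a \<in> - col z. \<exists>k. u - k *s a \<in> col z}"
      then obtain k where k: "u - k *s a \<in> col z" by blast
      then have k0: "k \<noteq> 0" using False by auto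
      have "a - inverse k *s u = (- inverse k) *s (u - k *s a)"
        using k0 by (simp add: vec_eq_iff field_simps)
      then have "a - inverse k *s u \<in> col z" using col_scale[OF k, of "- inverse k"] by (simp only:)
      then show "a \<in> (\<lambda>(k, c). k *s u + c) ` ((- {0}) \<times> col z)"
        using k0 by (intro image_eqI[of _ _ "(inverse k, a - inverse k *s u)"]) auto
    qed
  qed
  from bij_betw_same_card[OF this, symmetric]
  have "cN {a \<in> - col z. \<exists>k. u - k *s a \<in> col z} = cN (- {0 :: 'a}) * s"
    by (simp only: card_cartesian_product of_nat_mult cN_col)
  also have "cN (- {0 :: 'a}) = q - 1" by (simp add: cN_compl q)
  finally show ?thesis using False by (simp add: fF_def)
qed

lemma fF_up: "b \<notin> row_sp z \<Longrightarrow> fF u (z + outer a b) = of_bool (\<exists>k. u - k *s a \<in> col z)"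
  by (simp add: fF_def col_up)

lemma gF_up: "a \<notin> col z \<Longrightarrow> gF v (z + outer a b) = of_bool (\<exists>k. v - k *s b \<in> row_sp z)"
  by (simp add: gF_def transpose_add_outer col_up)

lemma up_f:
  assumes u: "u \<noteq> 0"
  shows "upS z (fF u) = (Q - s) * (fF u z * (P - s) + (1 - fF u z) * ((q - 1) * s))"
proof -
  have "upS z (fF u) = (\<Sum>a\<in>- col z. of_bool (\<exists>k. u - k *s a \<in> col z) * (Q - s))"
    unfolding upS_def by (intro sum.cong refl) (simp add: fF_up cN_col)
  then show ?thesis
    unfolding sum_distrib_right[symmetric] cN_sum_bool[OF finite, symmetric] cN_up_col[OF u] by (simp only: mult.commute)
qed

text \<open>When both vectors are new, the column space of the neighbour depends only on
  \<open>a\<close> and its row space only on \<open>b\<close>. The sum therefore factors.\<close>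

lemma up_h:
  assumes u: "u \<noteq> 0" and v: "v \<noteq> 0"
  shows "upS z (hF u v) = (fF u z * (P - s) + (1 - fF u z) * ((q - 1) * s))
    * (gF v z * (Q - s) + (1 - gF v z) * ((q - 1) * s))"
proof -
  have "upS z (hF u v) = (\<Sum>a\<in>- col z. \<Sum>b\<in>- row_sp z.
      of_bool (\<exists>k. u - k *s a \<in> col z) * of_bool (\<exists>k. v - k *s b \<in> row_sp z))"
    unfolding upS_def hF_eq by (intro sum.cong refl) (simp add: fF_up gF_up)
  also have "\<dots> = cN {a \<in> - col z. \<exists>k. u - k *s a \<in> col z} * cN {b \<in> - row_sp z. \<exists>k. v - k *s b \<in> row_sp z}"
    unfolding cN_sum_bool[OF finite] sum_product ..
  finally show ?thesis
    using cN_up_col[OF u] rank_data.cN_up_col[OF transposed v] by (simp only: gF_transpose)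
qed

text \<open>Write \<open>u = z *v p\<close>. By \<open>col_dn\<close>, \<open>u\<close> survives iff
  \<open>dotp b p = 0\<close>, which leaves \<open>s / q - 1\<close> nonzero \<open>b\<close> in the
  row space, each with \<open>s / q\<close> partners \<open>a\<close>.\<close>

lemma dn_f:
  assumes u: "u \<noteq> 0"
  shows "dnS z (fF u) = fF u z * ((s / q) * (s / q - 1))"
proof (cases "u \<in> col z")
  case True
  then obtain p where p: "z *v p = u" by (auto simp: col_def)
  have "dnS z (fF u) = (\<Sum>b\<in>row_sp z. \<Sum>a\<in>col z. of_bool (dnp z a b) * of_bool (dotp b p = 0))"
    unfolding dnS_def
    by (subst sum.swap, intro sum.cong refl) (auto simp: fF_def p[symmetric] col_dn(1))
  also have "\<dots> = (\<Sum>b\<in>row_sp z. of_bool (dotp b p = 0) * (of_bool (b \<noteq> 0) * (s / q)))"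
  proof (intro sum.cong refl)
    fix b assume "b \<in> row_sp z"
    from cN_dnp_col[OF this] show "(\<Sum>a\<in>col z. of_bool (dnp z a b) * of_bool (dotp b p = 0))
        = of_bool (dotp b p = 0) * (of_bool (b \<noteq> 0) * (s / q))"
      unfolding cN_sum_bool[OF finite] sum_distrib_right[symmetric] by (simp only: mult.commute)
  qed
  also have "\<dots> = cN {b \<in> row_sp z. dotp b p = 0 \<and> b \<noteq> 0} * (s / q)"
    unfolding cN_sum_bool[OF finite] sum_distrib_right by (intro sum.cong refl) simp
  also have "{b \<in> row_sp z. dotp b p = 0 \<and> b \<noteq> 0} = {b \<in> row_sp z - {0}. dotp b p = 0}" by blast
  also have "cN \<dots> = s / q - 1" using cN_not_row_sp_dotp(4)[of p] u p by blast
  moreover have "fF u z = 1" using True by (simp add: fF_def)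
  ultimately show ?thesis by (simp only: mult_1 mult.commute)
next
  case False
  have "dnS z (fF u) = (\<Sum>a\<in>col z. \<Sum>b\<in>row_sp z. 0)"
    unfolding dnS_def using False col_dn(2) by (intro sum.cong refl) (auto simp: fF_def)
  then show ?thesis using False by (simp add: fF_def)
qed

lemma psi_UNIV: "psiT u UNIV z = Q / s * fF u z"
  by (simp add: psiT_def fF_def cN_fibre)

text \<open>These neighbours have the same rank as \<open>z\<close>, so on all of them
  \<open>psiT u UNIV\<close> is \<open>fF u\<close> times the common factor \<open>Q / s\<close>,
  which cancels from \<open>half_same_psi\<close>.\<close>

lemma half_same_f:
  assumes u: "u \<noteq> 0"
  shows "(\<Sum>a\<in>- col z. \<Sum>b\<in>row_sp z - {0}. fF u (z + outer a b))
    = fF u z * ((P - s) * (s / q - 1)) + (1 - fF u z) * ((s - 1) * (s - s / q))"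
proof -
  define X where "X = (\<Sum>a\<in>- col z. \<Sum>b\<in>row_sp z - {0}. fF u (z + outer a b))"
  have "(\<Sum>a\<in>- col z. \<Sum>b\<in>row_sp z - {0}. psiT u UNIV (z + outer a b)) = Q / s * X"
    unfolding X_def sum_distrib_left
    by (intro sum.cong refl rank_data.psi_UNIV[OF neighbour_rank_data(3)]) (auto dest: dnp_in_col)
  moreover have "cN {p \<in> (UNIV :: ('a^'n) set). z *v p \<noteq> 0} = Q - Q / s"
    using cN_fibre[of 0] unfolding cN_filter_not[OF finite] by (simp add: q_pow)
  moreover have "of_bool (u \<notin> col z) = 1 - fF u z" by (simp add: fF_def)
  ultimately have "Q / s * X
      = Q / s * fF u z * ((P - s) * (s / q - 1)) + (1 - fF u z) * (s * (1 - 1 / q)) * (Q - Q / s)"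
    using half_same_psi[OF u, of UNIV] by (simp only: psi_UNIV)
  also have "\<dots> = Q / s * (fF u z * ((P - s) * (s / q - 1)) + (1 - fF u z) * ((s - 1) * (s - s / q)))"
    using nz by (simp add: field_simps)
  finally show ?thesis unfolding X_def using nz by simp
qed

lemma sum_not_dnp:
  "(\<Sum>a\<in>col z - {0}. \<Sum>b\<in>row_sp z - {0}. of_bool (\<not> dnp z a b)) = (s - 1)^2 - (s - 1) * s / q"
proof -
  have "smS z (\<lambda>_. 1) = (s - 1) * (Q - s) + (P - s) * (s - 1)
      + (\<Sum>a\<in>col z - {0}. \<Sum>b\<in>row_sp z - {0}. of_bool (\<not> dnp z a b))"
    by (simp only: smS_def sum_constant cN_col mult_1_right)
  then show ?thesis unfolding same_one by (simp only: add_left_cancel)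
qed

lemma fF_same: "a \<in> col z \<Longrightarrow> \<not> dnp z a b \<Longrightarrow> fF u (z + outer a b) = fF u z"
  using col_same[of a z b] by (simp add: fF_def)

lemma gF_same: "b \<in> row_sp z \<Longrightarrow> \<not> dnp z a b \<Longrightarrow> gF v (z + outer a b) = gF v z"
  using col_same[of b "transpose z" a] by (simp add: gF_def transpose_add_outer dnp_transpose)

lemma fF_same_right: "a \<in> col z \<Longrightarrow> b \<notin> row_sp z \<Longrightarrow> fF u (z + outer a b) = fF u z"
  by (rule fF_same) (auto simp: dnp_def)

lemma gF_same_left: "b \<in> row_sp z \<Longrightarrow> a \<notin> col z \<Longrightarrow> gF v (z + outer a b) = gF v z"
  by (rule gF_same) (auto dest: dnp_in_col)

lemma of_bool_mult_cong: "(p \<Longrightarrow> x = y) \<Longrightarrow> of_bool p * x = of_bool p * (y :: complex)"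
  by simp

lemma same_f:
  assumes u: "u \<noteq> 0"
  shows "smS z (fF u) = fF u z * ((s - 1) * (Q - s))
    + (fF u z * ((P - s) * (s / q - 1)) + (1 - fF u z) * ((s - 1) * (s - s / q)))
    + fF u z * ((s - 1)^2 - (s - 1) * s / q)"
proof -
  have "(\<Sum>a\<in>col z - {0}. \<Sum>b\<in>- row_sp z. fF u (z + outer a b)) = (\<Sum>a\<in>col z - {0}. \<Sum>b\<in>- row_sp z. fF u z)"
    by (intro sum.cong refl) (simp add: fF_same_right)
  moreover have "(\<Sum>a\<in>col z - {0}. \<Sum>b\<in>row_sp z - {0}. of_bool (\<not> dnp z a b) * fF u (z + outer a b))
     = (\<Sum>a\<in>col z - {0}. \<Sum>b\<in>row_sp z - {0}. of_bool (\<not> dnp z a b)) * fF u z"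
    unfolding sum_distrib_right by (intro sum.cong refl of_bool_mult_cong) (simp add: fF_same)
  ultimately show ?thesis
    unfolding smS_def half_same_f[OF u] sum_not_dnp
    by (simp only: sum_constant cN_col mult_ac)
qed

lemma same_h:
  assumes u: "u \<noteq> 0" and v: "v \<noteq> 0"
  shows "smS z (hF u v) = fF u z * (gF v z * ((Q - s) * (s / q - 1)) + (1 - gF v z) * ((s - 1) * (s - s / q)))
    + gF v z * (fF u z * ((P - s) * (s / q - 1)) + (1 - fF u z) * ((s - 1) * (s - s / q)))
    + hF u v z * ((s - 1)^2 - (s - 1) * s / q)"
proof -
  have "(\<Sum>a\<in>col z - {0}. \<Sum>b\<in>- row_sp z. hF u v (z + outer a b))
      = fF u z * (\<Sum>a\<in>col z - {0}. \<Sum>b\<in>- row_sp z. gF v (z + outer a b))"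
    unfolding hF_eq sum_distrib_left by (intro sum.cong refl) (simp add: fF_same_right)
  also have "(\<Sum>a\<in>col z - {0}. \<Sum>b\<in>- row_sp z. gF v (z + outer a b))
      = (\<Sum>b\<in>- row_sp z. \<Sum>a\<in>col z - {0}. fF v (transpose z + outer b a))"
    by (subst sum.swap) (simp only: gF_transpose transpose_add_outer)
  also have "\<dots> = gF v z * ((Q - s) * (s / q - 1)) + (1 - gF v z) * ((s - 1) * (s - s / q))"
    using rank_data.half_same_f[OF transposed v] by (simp add: gF_transpose)
  finally have 1: "(\<Sum>a\<in>col z - {0}. \<Sum>b\<in>- row_sp z. hF u v (z + outer a b))
      = fF u z * (gF v z * ((Q - s) * (s / q - 1)) + (1 - gF v z) * ((s - 1) * (s - s / q)))" .
  have 2: "(\<Sum>a\<in>- col z. \<Sum>b\<in>row_sp z - {0}. hF u v (z + outer a b))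
      = gF v z * (\<Sum>a\<in>- col z. \<Sum>b\<in>row_sp z - {0}. fF u (z + outer a b))"
    unfolding hF_eq sum_distrib_left by (intro sum.cong refl) (simp add: gF_same_left)
  have "(\<Sum>a\<in>col z - {0}. \<Sum>b\<in>row_sp z - {0}. of_bool (\<not> dnp z a b) * hF u v (z + outer a b))
     = (\<Sum>a\<in>col z - {0}. \<Sum>b\<in>row_sp z - {0}. of_bool (\<not> dnp z a b)) * hF u v z"
    unfolding sum_distrib_right hF_eq by (intro sum.cong refl of_bool_mult_cong) (simp add: fF_same gF_same)
  then show ?thesis
    unfolding smS_def half_same_f[OF u] sum_not_dnp 1 2 by (simp only: mult.commute)
qed

end

lemma phiF_zero: "u \<notin> col z \<or> v \<notin> row_sp z \<Longrightarrow> phiF u v t z = 0"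
  by (auto simp: phiF_def)

lemma phiF_eq:
  assumes p: "z *v p = u" and v: "v \<in> row_sp z"
  shows "phiF u v t z = of_bool (dotp v p = t)"
proof -
  have "(\<exists>p'. z *v p' = u \<and> dotp v p' = t) \<longleftrightarrow> dotp v p = t"
  proof
    assume "\<exists>p'. z *v p' = u \<and> dotp v p' = t"
    then obtain p' where p': "z *v p' = u" "dotp v p' = t" by (elim exE conjE)
    have "dotp v p' = dotp v p" by (rule row_sp_dotp_cong[OF v]) (simp only: p p')
    then show "dotp v p = t" by (simp only: p')
  next
    assume "dotp v p = t"
    with p show "\<exists>p'. z *v p' = u \<and> dotp v p' = t" by (intro exI conjI)
  qed
  then show ?thesis unfolding phiF_def by (simp only: v simp_thms)
qed

context rank_data
begin

text \<open>With \<open>b = transpose z *v \<tau>\<close> both conditions become linear functionals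
  on the column space, with prescribed values \<open>- 1\<close> and 0. They are independent unless
  \<open>b\<close> is a multiple of \<open>v\<close>. In that case the first functional is a
  multiple of the second, and the prescribed values contradict each other.\<close>

lemma cN_col_dnp_dotp:
  assumes v: "v \<noteq> 0" "transpose z *v \<sigma> = v" and b: "b \<in> row_sp z"
  shows "cN {a \<in> col z. dnp z a b \<and> dotp a \<sigma> = 0} = of_bool (b \<notin> range (\<lambda>k. k *s v)) * (s / q / q)"
proof -
  obtain \<tau> where \<tau>: "b = transpose z *v \<tau>" using b by (auto simp: col_def)
  have "dnp z a b \<longleftrightarrow> dotp a \<tau> = - 1" if "a \<in> col z" for a
    using dnp_iff[of a "transpose z" \<tau>] that by (simp add: \<tau> dnp_transpose)
  then have eq: "{a \<in> col z. dnp z a b \<and> dotp a \<sigma> = 0} = {a \<in> col z. dotp a \<sigma> = 0 \<and> dotp a \<tau> = - 1}"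
    by blast
  show ?thesis
  proof (cases "b \<in> range (\<lambda>k. k *s v)")
    case True
    then obtain k where k: "b = k *s v" by blast
    have "dotp a \<tau> = 0" if a: "a \<in> col z" "dotp a \<sigma> = 0" for a
    proof -
      obtain p where p: "a = z *v p" using a by (auto simp: col_def)
      have "dotp a \<tau> = k * dotp a \<sigma>"
        using dotp_adjoint[of \<tau> z p] dotp_adjoint[of \<sigma> z p]
        by (simp add: p dotp_commute[of "z *v p"] v(2) k \<tau>[symmetric] dotp_scale_left)
      then show ?thesis using a by simp
    qed
    then have "{a \<in> col z. dotp a \<sigma> = 0 \<and> dotp a \<tau> = - 1} = {}" by force
    then show ?thesis using True by (simp only: eq card.empty of_nat_0) simp
  next
    case False
    then show ?thesis
      unfolding eq using rank_data.cN_row_sp_dotp2[OF transposed, of \<sigma> \<tau> 0 "- 1"] v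
      by (simp add: \<tau>)
  qed
qed

text \<open>The summand tests whether a lowering perturbation keeps both \<open>u\<close> and
  \<open>v\<close>. By the previous count the multiples of \<open>v\<close> drop out of the possible
  \<open>b\<close>: all \<open>q\<close> of them satisfy \<open>dotp b p = 0\<close> if the form
  vanishes at \<open>(u, v)\<close>, otherwise only 0 does. Here the form value enters, so
  \<open>hF\<close> alone is not closed under lowering.\<close>

lemma dn_incidence:
  assumes u: "u \<noteq> 0" "z *v p = u" and v: "v \<noteq> 0" "transpose z *v \<sigma> = v"
  shows "(\<Sum>a\<in>col z. \<Sum>b\<in>row_sp z. of_bool (dnp z a b) * (of_bool (dotp b p = 0) * of_bool (dotp a \<sigma> = 0)))
    = s / q / q * (s / q - (if dotp v p = 0 then q else 1))"
proof -
  have "(\<Sum>a\<in>col z. \<Sum>b\<in>row_sp z. of_bool (dnp z a b) * (of_bool (dotp b p = 0) * of_bool (dotp a \<sigma> = 0)))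
      = (\<Sum>b\<in>row_sp z. of_bool (dotp b p = 0) * cN {a \<in> col z. dnp z a b \<and> dotp a \<sigma> = 0})"
    unfolding cN_sum_bool[OF finite] sum_distrib_left
    by (subst sum.swap, intro sum.cong refl) auto
  also have "\<dots> = (\<Sum>b\<in>row_sp z. of_bool (dotp b p = 0) * (of_bool (b \<notin> range (\<lambda>k. k *s v)) * (s / q / q)))"
    by (rule sum.cong[OF refl]) (simp only: cN_col_dnp_dotp[OF v])
  also have "\<dots> = (\<Sum>b\<in>row_sp z. s / q / q * of_bool (dotp b p = 0 \<and> b \<notin> range (\<lambda>k. k *s v)))"
    by (rule sum.cong[OF refl]) (simp only: of_bool_conj mult_ac)
  also have "\<dots> = s / q / q * cN {b \<in> row_sp z. dotp b p = 0 \<and> b \<notin> range (\<lambda>k. k *s v)}"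
    unfolding cN_sum_bool[OF finite] sum_distrib_left ..
  also have "{b \<in> row_sp z. dotp b p = 0 \<and> b \<notin> range (\<lambda>k. k *s v)}
      = {b \<in> {b \<in> row_sp z. dotp b p = 0}. b \<notin> range (\<lambda>k. k *s v)}" by blast
  also have "cN {b \<in> {b \<in> row_sp z. dotp b p = 0}. b \<notin> range (\<lambda>k. k *s v)} = s / q - (if dotp v p = 0 then q else 1)"
  proof -
    have "v \<in> row_sp z" using v(2) mult_in_col by metis
    then have "{b \<in> {b \<in> row_sp z. dotp b p = 0}. b \<in> range (\<lambda>k. k *s v)} = (\<lambda>k. k *s v) ` {k. k * dotp v p = 0}"
      by (auto simp: dotp_scale_left col_scale)
    moreover have "card ((\<lambda>k. k *s v) ` {k. k * dotp v p = 0}) = card {k. k * dotp v p = 0}"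
      by (rule card_image) (use inj_scale[OF v(1)] in \<open>simp add: inj_on_def inj_def\<close>)
    moreover have "cN {k. k * dotp v p = 0} = (if dotp v p = 0 then q else 1)"
      by (simp add: q)
    ultimately have "cN {b \<in> {b \<in> row_sp z. dotp b p = 0}. b \<in> range (\<lambda>k. k *s v)} = (if dotp v p = 0 then q else 1)"
      by (simp only:)
    then show ?thesis
      unfolding cN_filter_not[OF finite] using cN_row_sp_dotp[of p 0] u by (simp only:) simp
  qed
  finally show ?thesis .
qed

lemma dn_membership:
  assumes d: "dnp z a b" and p: "z *v p = u" and \<sigma>: "transpose z *v \<sigma> = v"
  shows "u \<in> col (z + outer a b) \<longleftrightarrow> dotp b p = 0" "v \<in> row_sp (z + outer a b) \<longleftrightarrow> dotp a \<sigma> = 0"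
proof -
  show "u \<in> col (z + outer a b) \<longleftrightarrow> dotp b p = 0" using col_dn(1)[OF d, of p] p by simp
  have "dnp (transpose z) b a" using d by (simp add: dnp_transpose)
  from col_dn(1)[OF this, of \<sigma>] show "v \<in> row_sp (z + outer a b) \<longleftrightarrow> dotp a \<sigma> = 0"
    by (simp add: transpose_add_outer \<sigma>)
qed

lemma dn_h:
  assumes u: "u \<noteq> 0" and v: "v \<noteq> 0"
  shows "dnS z (hF u v) = s / q / q * (hF u v z * (s / q - 1) - phiF u v 0 z * (q - 1))"
proof (cases "u \<in> col z \<and> v \<in> row_sp z")
  case True
  then obtain p \<sigma> where p: "z *v p = u" and \<sigma>: "transpose z *v \<sigma> = v" by (auto simp: col_def)
  have "dnS z (hF u v) = (\<Sum>a\<in>col z. \<Sum>b\<in>row_sp z. of_bool (dnp z a b) * (of_bool (dotp b p = 0) * of_bool (dotp a \<sigma> = 0)))"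
    unfolding dnS_def
    by (intro sum.cong refl of_bool_mult_cong) (simp add: hF_def dn_membership[OF _ p \<sigma>])
  then have D: "dnS z (hF u v) = s / q / q * (s / q - (if dotp v p = 0 then q else 1))"
    unfolding dn_incidence[OF u p v \<sigma>] .
  have "hF u v z = 1" "phiF u v 0 z = of_bool (dotp v p = 0)"
    using True phiF_eq[OF p] by (simp_all add: hF_def)
  then show ?thesis unfolding D by (cases "dotp v p = 0") simp_all
next
  case False
  have "dnS z (hF u v) = (\<Sum>a\<in>col z. \<Sum>b\<in>row_sp z. of_bool (dnp z a b) * 0)"
    unfolding dnS_def
  proof (intro sum.cong refl of_bool_mult_cong)
    fix a b assume d: "dnp z a b"
    then have "dnp (transpose z) b a" by (simp add: dnp_transpose)
    from col_dn(2)[OF this] col_dn(2)[OF d] show "hF u v (z + outer a b) = 0"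
      using False by (auto simp: hF_def transpose_add_outer)
  qed
  then show ?thesis using False by (auto simp: hF_def phiF_zero)
qed

text \<open>A pair that survives keeps its form value: if \<open>dotp b p = 0\<close>, the same
  \<open>p\<close> still solves \<open>(z + outer a b) *v p = u\<close>.\<close>

lemma dn_phi:
  assumes u: "u \<noteq> 0" and v: "v \<noteq> 0"
  shows "dnS z (phiF u v t) = phiF u v t z * (s / q / q * (s / q - (if t = 0 then q else 1)))"
proof (cases "u \<in> col z \<and> v \<in> row_sp z")
  case True
  then obtain p \<sigma> where p: "z *v p = u" and \<sigma>: "transpose z *v \<sigma> = v" by (auto simp: col_def)
  have "dnS z (phiF u v t) = (\<Sum>a\<in>col z. \<Sum>b\<in>row_sp z. of_bool (dnp z a b) *
      ((of_bool (dotp b p = 0) * of_bool (dotp a \<sigma> = 0)) * phiF u v t z))"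
    unfolding dnS_def
  proof (intro sum.cong refl of_bool_mult_cong)
    fix a b assume d: "dnp z a b"
    note mem = dn_membership[OF d p \<sigma>]
    show "phiF u v t (z + outer a b) = (of_bool (dotp b p = 0) * of_bool (dotp a \<sigma> = 0)) * phiF u v t z"
    proof (cases "dotp b p = 0 \<and> dotp a \<sigma> = 0")
      case 1: True
      have "(z + outer a b) *v p = u" using 1 p by (simp add: add_outer_mult)
      moreover have "v \<in> row_sp (z + outer a b)" using mem 1 by simp
      ultimately have "phiF u v t (z + outer a b) = of_bool (dotp v p = t)"
        by (rule phiF_eq)
      then show ?thesis using 1 True by (simp add: phiF_eq[OF p])
    next
      case False
      have "phiF u v t (z + outer a b) = 0"
        by (rule phiF_zero) (use False mem in simp)
      moreover have "of_bool (dotp b p = 0) * of_bool (dotp a \<sigma> = 0) = (0 :: complex)"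
        using False by simp
      ultimately show ?thesis by (simp only: mult_zero_left)
    qed
  qed
  also have "\<dots> = (\<Sum>a\<in>col z. \<Sum>b\<in>row_sp z. of_bool (dnp z a b) *
      (of_bool (dotp b p = 0) * of_bool (dotp a \<sigma> = 0))) * phiF u v t z"
    unfolding sum_distrib_right by (simp only: mult.assoc)
  finally have D: "dnS z (phiF u v t) = s / q / q * (s / q - (if dotp v p = 0 then q else 1)) * phiF u v t z"
    unfolding dn_incidence[OF u p v \<sigma>] .
  have "phiF u v t z = of_bool (dotp v p = t)" using True phiF_eq[OF p] by simp
  then show ?thesis unfolding D by (cases "dotp v p = t") auto
next
  case False
  have "dnS z (phiF u v t) = (\<Sum>a\<in>col z. \<Sum>b\<in>row_sp z. of_bool (dnp z a b) * 0)"
    unfolding dnS_def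
  proof (intro sum.cong refl of_bool_mult_cong)
    fix a b assume d: "dnp z a b"
    then have "dnp (transpose z) b a" by (simp add: dnp_transpose)
    from col_dn(2)[OF this] col_dn(2)[OF d]
    have "u \<notin> col (z + outer a b) \<or> v \<notin> row_sp (z + outer a b)"
      using False by (auto simp: transpose_add_outer)
    then show "phiF u v t (z + outer a b) = 0" by (rule phiF_zero)
  qed
  then show ?thesis using False by (simp add: phiF_zero)
qed

text \<open>For \<open>v\<close> in the row space the fibre over \<open>u\<close> sits on a single
  level of \<open>dotp v\<close>. Otherwise a share \<open>1 / q\<close> of it lies on each level,
  which is the term with \<open>fF u z - hF u v z\<close>.\<close>

lemma psi_phi: "psiT u {p. dotp v p = t} z = Q / s * (phiF u v t z + (fF u z - hF u v z) / q)"
proof -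
  have eq: "psiT u {p. dotp v p = t} z = cN {p. z *v p = u \<and> dotp v p = t}"
    by (simp add: psiT_def conj_commute)
  show ?thesis
  proof (cases "v \<in> row_sp z")
    case True
    then show ?thesis unfolding eq cN_fibre_in[OF True] by (simp add: phiF_def fF_def hF_def)
  next
    case False
    then show ?thesis unfolding eq cN_fibre_out[OF False] by (simp add: phiF_def fF_def hF_def)
  qed
qed

lemma cN_level_nonzero:
  assumes v: "v \<noteq> 0"
  shows "cN {p \<in> {p. dotp v p = t}. p \<noteq> 0} = Q / q - of_bool (t = 0)"
    "cN {p \<in> {p. dotp v p = t}. z *v p \<noteq> 0}
      = Q / q - Q / s * (gF v z * of_bool (t = 0) + (1 - gF v z) / q)"
proof -
  have "{p \<in> {p. dotp v p = t}. p = 0} = (if t = 0 then {0} else {})" by auto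
  then show "cN {p \<in> {p. dotp v p = t}. p \<noteq> 0} = Q / q - of_bool (t = 0)"
    unfolding cN_filter_not[OF finite] cN_dotp(1)[OF v] by simp
  have eq: "{p \<in> {p. dotp v p = t}. z *v p = 0} = {p. z *v p = 0 \<and> dotp v p = t}" by auto
  have "cN {p. z *v p = 0 \<and> dotp v p = t} = Q / s * (gF v z * of_bool (t = 0) + (1 - gF v z) / q)"
  proof (cases "v \<in> row_sp z")
    case True
    have "(\<exists>p. z *v p = 0 \<and> dotp v p = t) \<longleftrightarrow> t = 0"
      using row_sp_annihilates_kernel[OF True] by (auto intro: exI[of _ 0])
    then show ?thesis unfolding cN_fibre_in[OF True] using True by (simp add: gF_def)
  next
    case False
    then show ?thesis unfolding cN_fibre_out[OF False] by (simp add: gF_def)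
  qed
  then show "cN {p \<in> {p. dotp v p = t}. z *v p \<noteq> 0}
      = Q / q - Q / s * (gF v z * of_bool (t = 0) + (1 - gF v z) / q)"
    unfolding cN_filter_not[OF finite] eq cN_dotp(1)[OF v] by simp
qed

lemma upS_lin:
  "upS z (\<lambda>w. \<Phi> w + \<Psi> w) = upS z \<Phi> + upS z \<Psi>" "upS z (\<lambda>w. \<Phi> w - \<Psi> w) = upS z \<Phi> - upS z \<Psi>"
  "upS z (\<lambda>w. c * \<Phi> w) = c * upS z \<Phi>"
  by (simp_all add: upS_def sum.distrib sum_subtractf sum_distrib_left)

lemma dnS_lin:
  "dnS z (\<lambda>w. \<Phi> w + \<Psi> w) = dnS z \<Phi> + dnS z \<Psi>" "dnS z (\<lambda>w. \<Phi> w - \<Psi> w) = dnS z \<Phi> - dnS z \<Psi>"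
  "dnS z (\<lambda>w. c * \<Phi> w) = c * dnS z \<Phi>"
  unfolding dnS_def sum_distrib_left sum_subtractf[symmetric] sum.distrib[symmetric]
  by (simp_all only: distrib_left right_diff_distrib mult.left_commute)

lemma smS_lin:
  "smS z (\<lambda>w. \<Phi> w + \<Psi> w) = smS z \<Phi> + smS z \<Psi>" "smS z (\<lambda>w. \<Phi> w - \<Psi> w) = smS z \<Phi> - smS z \<Psi>"
  "smS z (\<lambda>w. c * \<Phi> w) = c * smS z \<Phi>"
proof -
  have tot: "totS z (\<lambda>w. \<Phi> w + \<Psi> w) = totS z \<Phi> + totS z \<Psi>" "totS z (\<lambda>w. \<Phi> w - \<Psi> w) = totS z \<Phi> - totS z \<Psi>"
    "totS z (\<lambda>w. c * \<Phi> w) = c * totS z \<Phi>"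
    by (simp_all add: totS_def sum.distrib sum_subtractf sum_distrib_left)
  show "smS z (\<lambda>w. \<Phi> w + \<Psi> w) = smS z \<Phi> + smS z \<Psi>" "smS z (\<lambda>w. \<Phi> w - \<Psi> w) = smS z \<Phi> - smS z \<Psi>"
    "smS z (\<lambda>w. c * \<Phi> w) = c * smS z \<Phi>"
    unfolding smS_eq upS_lin dnS_lin tot by (simp_all add: algebra_simps)
qed

text \<open>All rising neighbours have the parameter \<open>q * s\<close>, so \<open>psi_phi\<close>
  holds on them with one common factor.\<close>

lemma up_phi_psi: "upS z (psiT u {p. dotp v p = t})
    = Q / (q * s) * (upS z (phiF u v t) + (1 / q) * (upS z (fF u) - upS z (hF u v)))"
proof -
  have "upS z (psiT u {p. dotp v p = t})
     = upS z (\<lambda>w. Q / (q * s) * (phiF u v t w + (1 / q) * (fF u w - hF u v w)))"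
    unfolding upS_def by (intro sum.cong refl) (simp add: rank_data.psi_phi[OF neighbour_rank_data(1)])
  then show ?thesis unfolding upS_lin .
qed

lemma dn_phi_psi: "dnS z (psiT u {p. dotp v p = t})
    = Q / (s / q) * (dnS z (phiF u v t) + (1 / q) * (dnS z (fF u) - dnS z (hF u v)))"
proof -
  have "dnS z (psiT u {p. dotp v p = t})
     = dnS z (\<lambda>w. Q / (s / q) * (phiF u v t w + (1 / q) * (fF u w - hF u v w)))"
    unfolding dnS_def by (intro sum.cong refl of_bool_mult_cong) (simp add: rank_data.psi_phi[OF neighbour_rank_data(2)])
  then show ?thesis unfolding dnS_lin .
qed

lemma same_phi_psi: "smS z (psiT u {p. dotp v p = t})
    = Q / s * (smS z (phiF u v t) + (1 / q) * (smS z (fF u) - smS z (hF u v)))"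
proof -
  have "smS z (psiT u {p. dotp v p = t})
     = smS z (\<lambda>w. Q / s * (phiF u v t w + (1 / q) * (fF u w - hF u v w)))"
    by (rule smS_scale_cong) (simp add: rank_data.psi_phi[OF neighbour_rank_data(3)])
  then show ?thesis unfolding smS_lin .
qed

lemma indicator_products:
  "fF u z * fF u z = fF u z" "gF v z * gF v z = gF v z" "fF u z * gF v z = hF u v z"
  "fF u z * hF u v z = hF u v z" "gF v z * hF u v z = hF u v z"
  "fF u z * phiF u v t z = phiF u v t z" "gF v z * phiF u v t z = phiF u v t z"
  by (auto simp: fF_def gF_def hF_def phiF_def)

text \<open>Obtained by solving \<open>up_phi_psi\<close> for its one unknown sum;
  \<open>up_psi\<close>, \<open>up_f\<close> and \<open>up_h\<close> supply the others.\<close>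

lemma up_phi:
  assumes u: "u \<noteq> 0" and v: "v \<noteq> 0"
  shows "upS z (phiF u v t) = phiF u v t z * ((P - s) * (Q - s))
    + (fF u z - hF u v z) * ((P - s) * (q - 1) * s / q)
    + (gF v z - hF u v z) * ((Q - s) * (q - 1) * s / q)
    + (1 - fF u z - gF v z + hF u v z) * ((q - 1) * ((if t = 0 then 0 else s) + (q - 1) * (s - 1) * s / q))"
proof -
  have "Q / (q * s) * (upS z (phiF u v t) + (1 / q) * (upS z (fF u) - upS z (hF u v)))
    = Q / s * (phiF u v t z + (fF u z - hF u v z) / q) * ((P - s) * (Q - s) / q)
    + (1 - fF u z) * (1 - 1 / q) * (Q * (Q / q - of_bool (t = 0)) - s * (Q / q - Q / s * (gF v z * of_bool (t = 0) + (1 - gF v z) / q)))"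
    unfolding up_phi_psi[symmetric] up_psi[OF u] psi_phi cN_level_nonzero[OF v] by (simp add: fF_def)
  then have "upS z (phiF u v t) = (q * s / Q) * (Q / s * (phiF u v t z + (fF u z - hF u v z) / q) * ((P - s) * (Q - s) / q)
    + (1 - fF u z) * (1 - 1 / q) * (Q * (Q / q - of_bool (t = 0)) - s * (Q / q - Q / s * (gF v z * of_bool (t = 0) + (1 - gF v z) / q))))
    - (1 / q) * (upS z (fF u) - upS z (hF u v))"
    using nz by (simp add: field_simps)
  also have "\<dots> = phiF u v t z * ((P - s) * (Q - s))
    + (fF u z - hF u v z) * ((P - s) * (q - 1) * s / q)
    + (gF v z - hF u v z) * ((Q - s) * (q - 1) * s / q)
    + (1 - fF u z - gF v z + hF u v z) * ((q - 1) * ((if t = 0 then 0 else s) + (q - 1) * (s - 1) * s / q))"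
  proof (cases "u \<in> col z"; cases "v \<in> row_sp z"; cases "t = 0")
  qed (use nz in \<open>simp_all add: up_f[OF u] up_h[OF u v] fF_def gF_def hF_def phiF_zero field_simps power2_eq_square\<close>)
  finally show ?thesis .
qed

text \<open>Tracking the form value through a rank-preserving update with both vectors inside is
  avoided: \<open>smS_eq\<close> gives the sum of \<open>psiT\<close>, and
  \<open>same_phi_psi\<close> is then solved for \<open>phiF\<close>. The value 0 is special because
  the level \<open>dotp v p = 0\<close> contains the zero vector and because \<open>dn_phi\<close>
  distinguishes it.\<close>

lemma same_phi:
  assumes u: "u \<noteq> 0" and v: "v \<noteq> 0"
  shows "t \<noteq> 0 \<Longrightarrow> smS z (phiF u v t)
     = phiF u v t z * ((s / q - 1) * (P + Q - 2 * s) + q * (s^2 / q^2 - (s / q^2) * (s / q - 1)) - (2 * s - 1))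
     + (fF u z + gF v z - 2 * hF u v z) * ((s - s / q) * (s / q))
     + (hF u v z - phiF u v 0 z) * ((q - 1) * (s^2 / q^2 - (s / q^2) * (s / q - 1)))
     + phiF u v 0 z * ((q - 1) * (s^2 / q^2 - s^2 / q^3))"
   (is "_ \<Longrightarrow> _ = ?r1")
   "smS z (phiF u v 0)
     = phiF u v 0 z * ((s / q - 1) * (P + Q - 2 * s) + (2 * q - 1) * (s^2 / q^2 - s^2 / q^3) + s / q - 2 * s + 1)
     + (fF u z + gF v z - 2 * hF u v z) * ((s - s / q) * (s / q - 1))
     + (hF u v z - phiF u v 0 z) * ((q - 1) * (s^2 / q^2 - (s / q^2) * (s / q - 1 + q)))"
   (is "_ = ?r0")
proof -
  have "Q / s * (smS z (phiF u v t) + (1 / q) * (smS z (fF u) - smS z (hF u v)))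
    = totS z (psiT u {p. dotp v p = t}) - upS z (psiT u {p. dotp v p = t}) - dnS z (psiT u {p. dotp v p = t})" for t
    unfolding same_phi_psi[symmetric] by (rule smS_eq)
  then have raw: "Q / s * (smS z (phiF u v t) + (1 / q) * (smS z (fF u) - smS z (hF u v)))
     = Q / s * (phiF u v t z + (fF u z - hF u v z) / q) * ((P - 1) * (Q / q - 1))
       + Q * (1 - 1 / q) * (Q / q - of_bool (t = 0) - Q / s * (phiF u v t z + (fF u z - hF u v z) / q))
       - (Q / s * (phiF u v t z + (fF u z - hF u v z) / q) * ((P - s) * (Q - s) / q)
       + (1 - fF u z) * (1 - 1 / q) * (Q * (Q / q - of_bool (t = 0)) - s * (Q / q - Q / s * (gF v z * of_bool (t = 0) + (1 - gF v z) / q))))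
       - Q / (s / q) * (phiF u v t z * (s / q / q * (s / q - (if t = 0 then q else 1)))
          + (1 / q) * (fF u z * ((s / q) * (s / q - 1))
          - s / q / q * (hF u v z * (s / q - 1) - phiF u v 0 z * (q - 1))))" for t
    unfolding tot_psi[OF u] up_psi[OF u] dn_phi_psi psi_phi cN_level_nonzero[OF v] dn_phi[OF u v] dn_f[OF u] dn_h[OF u v]
    by (simp add: fF_def)
  then have *: "smS z (phiF u v t) = (phiF u v t z + (fF u z - hF u v z) / q) * ((P - 1) * (Q / q - 1))
       + (1 - 1 / q) * (s * (Q / q - of_bool (t = 0)) - Q * (phiF u v t z + (fF u z - hF u v z) / q))
       - (phiF u v t z + (fF u z - hF u v z) / q) * ((P - s) * (Q - s) / q)
       - (1 - fF u z) * (1 - 1 / q) * (s * (Q / q - of_bool (t = 0)) - (s * (s / q) - s * (gF v z * of_bool (t = 0) + (1 - gF v z) / q)))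
       - (phiF u v t z * (s / q * (s / q - (if t = 0 then q else 1)))
          + fF u z * ((s / q) * (s / q - 1))
          - s / q / q * (hF u v z * (s / q - 1) - phiF u v 0 z * (q - 1)))
       - (1 / q) * (smS z (fF u) - smS z (hF u v))" (is "_ = ?m t") for t
  proof -
    \<comment> \<open>Multiplication by \<open>s / Q\<close>, carried out once with opaque
      coefficients so that the field arithmetic stays small.\<close>
    have inv: "x = \<alpha> * c1 + (1 - 1 / q) * (s * c2 - Q * \<alpha>) - \<alpha> * c3 - c4 * (s * c2 - (s * (s / q) - s * c5)) - (c6 + c7 - c8) - d"
      if "Q / s * (x + d) = Q / s * \<alpha> * c1 + Q * (1 - 1 / q) * (c2 - Q / s * \<alpha>)
        - (Q / s * \<alpha> * c3 + c4 * (Q * c2 - s * (Q / q - Q / s * c5)))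
        - Q / (s / q) * (c6 / q + (1 / q) * (c7 - c8))"
      for x d \<alpha> c1 c2 c3 c4 c5 c6 c7 c8 :: complex
    proof -
      have "x + d = (s / Q) * (Q / s * (x + d))" using nz by simp
      also have "\<dots> = \<alpha> * c1 + (1 - 1 / q) * (s * c2 - Q * \<alpha>) - \<alpha> * c3 - c4 * (s * c2 - (s * (s / q) - s * c5)) - (c6 + c7 - c8)"
        unfolding that using nz by (simp add: field_simps)
      finally show ?thesis by (simp add: algebra_simps)
    qed
    have c6: "phiF u v t z * (s / q / q * (s / q - (if t = 0 then q else 1)))
        = phiF u v t z * (s / q * (s / q - (if t = 0 then q else 1))) / q" by simp
    show ?thesis by (rule inv) (rule raw[of t, unfolded c6])
  qed
  \<comment> \<open>This substitution removes the denominators of \<open>s / q\<close> and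
    \<open>s / q^2\<close>.\<close>
  obtain x where x: "s = q * (q * x)" using nz by (metis nonzero_mult_div_cancel_left times_divide_eq_right)
  have "?m t = ?r1" if "t \<noteq> 0"
    using nz(1) that by (cases "u \<in> col z"; cases "v \<in> row_sp z")
      (simp_all add: same_f[OF u] same_h[OF u v] fF_def[of u z] gF_def[of v z] hF_def[of u v z] phiF_zero x,
       simp_all add: field_simps power2_eq_square power3_eq_cube)
  then show "t \<noteq> 0 \<Longrightarrow> smS z (phiF u v t) = ?r1" using *[of t] by simp
  have "?m 0 = ?r0"
    using nz(1) by (cases "u \<in> col z"; cases "v \<in> row_sp z")
      (simp_all add: same_f[OF u] same_h[OF u v] fF_def[of u z] gF_def[of v z] hF_def[of u v z] phiF_zero x,
       simp_all add: field_simps power2_eq_square power3_eq_cube)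
  then show "smS z (phiF u v 0) = ?r0" using *[of 0] by simp
qed

end

section \<open>The six families and their recurrences\<close>

definition comb :: "'a::{finite,field}^'m \<Rightarrow> 'a^'n \<Rightarrow> complex \<Rightarrow> complex \<Rightarrow> complex \<Rightarrow> complex \<Rightarrow> complex \<Rightarrow> complex \<Rightarrow>
    'a^'n^'m \<Rightarrow> complex" where
  "comb u v c0 c1 c2 c3 c4 c5 z = c0 + c1 * fF u z + c2 * gF v z + c3 * hF u v z
     + c4 * phiF u v 0 z + c5 * phiF u v 1 z"

text \<open>\<open>wfun q P Q u v k (q ^ i)\<close> describes the basis vectors supported on rank \<open>i\<close>: \<open>k = 1, \<dots>, 4\<close> belong
  to the thin modules, \<open>k = 5\<close> and \<open>k = 6\<close> are the families \<open>w\<^sup>-\<close> and \<open>w\<^sup>+\<close>. The thin ones and \<open>w\<^sup>-\<close> are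
  shaped by orthogonality to the constant functions of each rank; for \<open>k = 5\<close> the expanded product is
  \<open>(q - 1) ((t - 1) - (P - 1) f) ((t - 1) - (Q - 1) g)\<close>.\<close>

definition wfun :: "complex \<Rightarrow> complex \<Rightarrow> complex \<Rightarrow> 'a::{finite,field}^'m \<Rightarrow> 'a^'n \<Rightarrow> nat \<Rightarrow> complex \<Rightarrow>
    'a^'n^'m \<Rightarrow> complex" where
  "wfun q P Q u v k t =
    (if k = 1 then comb u v 1 0 0 0 0 0
     else if k = 2 then comb u v (- (t - 1) / t) ((P - 1) / t) 0 0 0 0
     else if k = 3 then comb u v (- (t - 1) / t) 0 ((Q - 1) / t) 0 0 0
     else if k = 4 then comb u v 0 0 0 (- 1 / t) (1 / t) ((q - 1) / t)
     else if k = 5 then comb u v ((q - 1) * (t - 1)^2) (- (q - 1) * (t - 1) * (P - 1))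
       (- (q - 1) * (t - 1) * (Q - 1)) ((q - 1) * (P - 1) * (Q - 1)) 0 0
     else comb u v 0 0 0 (- (P - 1) * (Q - 1) * (t / q - 1)) ((P - 1) * (Q - 1) * (t - 1)) 0)"

lemma wfun_simps:
  "wfun q P Q u v 1 t = comb u v 1 0 0 0 0 0"
  "wfun q P Q u v 2 t = comb u v (- (t - 1) / t) ((P - 1) / t) 0 0 0 0"
  "wfun q P Q u v 3 t = comb u v (- (t - 1) / t) 0 ((Q - 1) / t) 0 0 0"
  "wfun q P Q u v 4 t = comb u v 0 0 0 (- 1 / t) (1 / t) ((q - 1) / t)"
  "wfun q P Q u v 5 t = comb u v ((q - 1) * (t - 1)^2) (- (q - 1) * (t - 1) * (P - 1))
       (- (q - 1) * (t - 1) * (Q - 1)) ((q - 1) * (P - 1) * (Q - 1)) 0 0"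
  "wfun q P Q u v 6 t = comb u v 0 0 0 (- (P - 1) * (Q - 1) * (t / q - 1)) ((P - 1) * (Q - 1) * (t - 1)) 0"
  by (simp_all add: wfun_def)

text \<open>The deviation of the \<open>F\<close>-eigenvalue on \<open>wfun q P Q u v k t\<close> from \<open>a_i\<close>, where \<open>t = q ^ i\<close>.\<close>

definition edev :: "complex \<Rightarrow> complex \<Rightarrow> complex \<Rightarrow> nat \<Rightarrow> complex \<Rightarrow> complex" where
  "edev q P Q k t =
    (if k = 1 then 0 else if k = 2 then P - 1 else if k = 3 then Q - 1 else if k = 4 then Q + P - t - t / q
     else if k = 5 then Q + P - 2 else Q + P - t - t / q - 1 + 1 / q)"

lemma upS_comb: "upS z (comb u v c0 c1 c2 c3 c4 c5) = c0 * upS z (\<lambda>_. 1) + c1 * upS z (fF u) + c2 * upS z (gF v)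
    + c3 * upS z (hF u v) + c4 * upS z (phiF u v 0) + c5 * upS z (phiF u v 1)"
  by (simp add: upS_def comb_def sum.distrib sum_distrib_left)

lemma dnS_comb: "dnS z (comb u v c0 c1 c2 c3 c4 c5) = c0 * dnS z (\<lambda>_. 1) + c1 * dnS z (fF u) + c2 * dnS z (gF v)
    + c3 * dnS z (hF u v) + c4 * dnS z (phiF u v 0) + c5 * dnS z (phiF u v 1)"
  unfolding dnS_def comb_def sum_distrib_left sum.distrib[symmetric]
  by (intro sum.cong refl) (simp only: algebra_simps mult_1_left)

lemma totS_comb: "totS z (comb u v c0 c1 c2 c3 c4 c5) = c0 * totS z (\<lambda>_. 1) + c1 * totS z (fF u) + c2 * totS z (gF v)
    + c3 * totS z (hF u v) + c4 * totS z (phiF u v 0) + c5 * totS z (phiF u v 1)"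
  by (simp add: totS_def comb_def sum.distrib sum_distrib_left)

lemma smS_comb: "smS z (comb u v c0 c1 c2 c3 c4 c5) = c0 * smS z (\<lambda>_. 1) + c1 * smS z (fF u) + c2 * smS z (gF v)
    + c3 * smS z (hF u v) + c4 * smS z (phiF u v 0) + c5 * smS z (phiF u v 1)"
  unfolding smS_eq upS_comb dnS_comb totS_comb by (simp add: algebra_simps)

context rank_data
begin

lemma g_sums:
  assumes v: "v \<noteq> 0"
  shows "upS z (gF v) = (P - s) * (gF v z * (Q - s) + (1 - gF v z) * ((q - 1) * s))"
    "dnS z (gF v) = gF v z * ((s / q) * (s / q - 1))"
    "smS z (gF v) = gF v z * ((s - 1) * (P - s))
    + (gF v z * ((Q - s) * (s / q - 1)) + (1 - gF v z) * ((s - 1) * (s - s / q)))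
    + gF v z * ((s - 1)^2 - (s - 1) * s / q)"
proof -
  interpret T: rank_data "transpose z" q Q P s by (rule transposed)
  have eq: "(\<lambda>w. fF v (transpose w)) = gF v" by (rule ext) (simp add: gF_transpose)
  show "upS z (gF v) = (P - s) * (gF v z * (Q - s) + (1 - gF v z) * ((q - 1) * s))"
    "dnS z (gF v) = gF v z * ((s / q) * (s / q - 1))"
    "smS z (gF v) = gF v z * ((s - 1) * (P - s))
    + (gF v z * ((Q - s) * (s / q - 1)) + (1 - gF v z) * ((s - 1) * (s - s / q)))
    + gF v z * ((s - 1)^2 - (s - 1) * s / q)"
    using T.up_f[OF v] T.dn_f[OF v] T.same_f[OF v]
    by (simp_all only: sum_transpose eq gF_transpose[symmetric])
qed

end

lemma divide_out: "c \<noteq> 1 \<Longrightarrow> (c - 1) * X = a * Y - b * Z \<Longrightarrow> X = a / (c - 1) * Y - b / (c - 1) * Z"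
  for X :: complex
proof -
  assume c: "c \<noteq> 1" and eq: "(c - 1) * X = a * Y - b * Z"
  have "X = ((c - 1) * X) / (c - 1)" using c by simp
  then show ?thesis unfolding eq by (simp add: diff_divide_distrib)
qed

locale rank_data_pair = rank_data z q P Q s
  for z :: "'a::{finite,field}^'n^'m" and q P Q s +
  fixes u :: "'a^'m" and v :: "'a^'n"
  assumes u: "u \<noteq> 0" and v: "v \<noteq> 0"
begin

lemmas up_rules = upS_comb up_one up_f[OF u] g_sums(1)[OF v] up_h[OF u v] up_phi[OF u v]

lemmas dn_rules = dnS_comb dn_one dn_f[OF u] g_sums(2)[OF v] dn_h[OF u v] dn_phi[OF u v]

lemmas same_rules = smS_comb same_one same_f[OF u] g_sums(3)[OF v] same_h[OF u v]
  same_phi(1)[OF u v one_neq_zero] same_phi(2)[OF u v]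

text \<open>In the case \<open>both\<close> the two values of \<open>phiF\<close> stay symbolic. The
  recurrences are linear in them, so no split by form value is required.\<close>

lemma incidence_cases:
  obtains (none) "fF u z = 0" "gF v z = 0" "hF u v z = 0" "phiF u v 0 z = 0" "phiF u v 1 z = 0"
  | (left) "fF u z = 1" "gF v z = 0" "hF u v z = 0" "phiF u v 0 z = 0" "phiF u v 1 z = 0"
  | (right) "fF u z = 0" "gF v z = 1" "hF u v z = 0" "phiF u v 0 z = 0" "phiF u v 1 z = 0"
  | (both) "fF u z = 1" "gF v z = 1" "hF u v z = 1"
  by (cases "u \<in> col z"; cases "v \<in> row_sp z") (auto simp: fF_def gF_def hF_def phiF_zero)

lemmas expand = field_simps power2_eq_square power3_eq_cube

lemma up_rel1: "upS z (wfun q P Q u v 1 (q * s)) = (P - s) * (Q - s) * wfun q P Q u v 1 s z"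
  using nz unfolding wfun_simps up_rules comb_def by (cases rule: incidence_cases; simp; simp add: expand)

lemma up_rel2: "upS z (wfun q P Q u v 2 (q * s)) = (P - q * s) * (Q - s) / q * wfun q P Q u v 2 s z"
  using nz unfolding wfun_simps up_rules comb_def by (cases rule: incidence_cases; simp; simp add: expand)

lemma up_rel3: "upS z (wfun q P Q u v 3 (q * s)) = (P - s) * (Q - q * s) / q * wfun q P Q u v 3 s z"
  using nz unfolding wfun_simps up_rules comb_def by (cases rule: incidence_cases; simp; simp add: expand)

lemma up_rel4: "upS z (wfun q P Q u v 4 (q * s)) = (P - s) * (Q - s) / q * wfun q P Q u v 4 s z"
  using nz unfolding wfun_simps up_rules comb_def by (cases rule: incidence_cases; simp; simp add: expand)

lemma dn_rel1: "dnS z (wfun q P Q u v 1 (s / q)) = (s - 1) * (s / q) * wfun q P Q u v 1 s z"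
  using nz unfolding wfun_simps dn_rules comb_def by (cases rule: incidence_cases; simp; simp add: expand)

lemma dn_rel2: "dnS z (wfun q P Q u v 2 (s / q)) = s * (s / q - 1) * wfun q P Q u v 2 s z"
  using nz unfolding wfun_simps dn_rules comb_def by (cases rule: incidence_cases; simp; simp add: expand)

lemma dn_rel3: "dnS z (wfun q P Q u v 3 (s / q)) = s * (s / q - 1) * wfun q P Q u v 3 s z"
  using nz unfolding wfun_simps dn_rules comb_def by (cases rule: incidence_cases; simp; simp add: expand)

lemma dn_rel4: "dnS z (wfun q P Q u v 4 (s / q)) = (s / q) * (s / q - 1) * wfun q P Q u v 4 s z"
  using nz unfolding wfun_simps dn_rules comb_def by (cases rule: incidence_cases; simp; simp add: expand)

lemma dn_rel6: "dnS z (wfun q P Q u v 6 (s / q)) = (s / q^2) * (s / q^2 - 1) * wfun q P Q u v 6 s z"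
  using nz unfolding wfun_simps dn_rules comb_def by (cases rule: incidence_cases; simp; simp add: expand)

lemma same_rel1: "smS z (wfun q P Q u v 1 s)
    = ((s - 1) * (Q + P - s - s / q - 1) - (q - 1) * (s / q) * edev q P Q 1 s) * wfun q P Q u v 1 s z"
  using nz unfolding wfun_simps same_rules edev_def comb_def by (cases rule: incidence_cases; simp; simp add: expand)

lemma same_rel2: "smS z (wfun q P Q u v 2 s)
    = ((s - 1) * (Q + P - s - s / q - 1) - (q - 1) * (s / q) * edev q P Q 2 s) * wfun q P Q u v 2 s z"
  using nz unfolding wfun_simps same_rules edev_def comb_def by (cases rule: incidence_cases; simp; simp add: expand)

lemma same_rel3: "smS z (wfun q P Q u v 3 s)
    = ((s - 1) * (Q + P - s - s / q - 1) - (q - 1) * (s / q) * edev q P Q 3 s) * wfun q P Q u v 3 s z"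
  using nz unfolding wfun_simps same_rules edev_def comb_def by (cases rule: incidence_cases; simp; simp add: expand)

lemma same_rel4: "smS z (wfun q P Q u v 4 s)
    = ((s - 1) * (Q + P - s - s / q - 1) - (q - 1) * (s / q) * edev q P Q 4 s) * wfun q P Q u v 4 s z"
  using nz unfolding wfun_simps same_rules edev_def comb_def by (cases rule: incidence_cases; simp; simp add: expand)

lemma quotients:
  obtains r where "s = q * r" "s / q = r"
  using nz by (intro that[of "s / q"]) simp_all

lemma q_cancel:
  "q * y / q = y" "a * (q * y) / q = a * y" "q * (q * y) / q^2 = y"
  "(q * (q * y))^2 / q^2 = (q * y)^2" "(q * (q * y))^2 / q^3 = q * y^2"
  using nz by (simp_all add: power2_eq_square power3_eq_cube)

lemmas case_simps = q_cancel mult_zero_left mult_zero_right add_0_left add_0_right diff_zero diff_self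
  mult_1_right mult_1_left if_True if_False refl one_neq_zero simp_thms

text \<open>The function of family 5 is a product of a column factor and a row factor. The rising
  sum factors accordingly, and each factor reproduces itself, scaled by \<open>P - q * s\<close> or
  \<open>Q - q * s\<close>.\<close>

lemma up_rel5: "upS z (wfun q P Q u v 5 (q * s)) = (P - q * s) * (Q - q * s) * wfun q P Q u v 5 s z"
proof -
  define A where "A = fF u z * (P - s) + (1 - fF u z) * ((q - 1) * s)"
  define B where "B = gF v z * (Q - s) + (1 - gF v z) * ((q - 1) * s)"
  have "upS z (wfun q P Q u v 5 (q * s))
      = (q - 1) * (((q * s - 1) * (P - s) - (P - 1) * A) * ((q * s - 1) * (Q - s) - (Q - 1) * B))"
    unfolding wfun_simps up_rules A_def[symmetric] B_def[symmetric] power2_eq_square by algebra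
  also have "(q * s - 1) * (P - s) - (P - 1) * A = (P - q * s) * ((s - 1) - (P - 1) * fF u z)"
    unfolding A_def by algebra
  also have "(q * s - 1) * (Q - s) - (Q - 1) * B = (Q - q * s) * ((s - 1) - (Q - 1) * gF v z)"
    unfolding B_def by algebra
  finally show ?thesis
    unfolding wfun_simps comb_def indicator_products(3)[symmetric] power2_eq_square by algebra
qed

text \<open>Rising neighbours of a matrix that misses \<open>u\<close> or \<open>v\<close> may be
  incident with both, so the sum is also nonzero where family 6 vanishes. The excess is a multiple
  of family 5; this coupling is what makes the fifth module nonthin.\<close>

lemma up_rel6:
  assumes "s \<noteq> 1"
  shows "upS z (wfun q P Q u v 6 (q * s)) = (q * s - 1) * (P - s) * (Q - s) / (s - 1) * wfun q P Q u v 6 s z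
     - (q - 1) * (s / q) * (P - 1) * (Q - 1) / (s - 1) * wfun q P Q u v 5 s z"
proof -
  obtain r where r: "s = q * r" "s / q = r" by (rule quotients)
  have "(s - 1) * upS z (wfun q P Q u v 6 (q * s)) = (q * s - 1) * (P - s) * (Q - s) * wfun q P Q u v 6 s z
     - (q - 1) * r * (P - 1) * (Q - 1) * wfun q P Q u v 5 s z"
  proof (cases rule: incidence_cases)
    case none
    show ?thesis
      unfolding wfun_simps up_rules comb_def r(2) none r(1)
      by (simp only: case_simps; algebra)
  next
    case left
    show ?thesis
      unfolding wfun_simps up_rules comb_def r(2) left r(1)
      by (simp only: case_simps; algebra)
  next
    case right
    show ?thesis
      unfolding wfun_simps up_rules comb_def r(2) right r(1)
      by (simp only: case_simps; algebra)
  next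
    case both
    show ?thesis
      unfolding wfun_simps up_rules comb_def r(2) both r(1)
      by (simp only: case_simps; algebra)
  qed
  then show ?thesis unfolding r(2) by (rule divide_out[OF assms])
qed

text \<open>The \<open>hF\<close> part of family 5 produces \<open>phiF u v 0\<close> under
  \<open>dn_h\<close>, and this is accounted for by family 6.\<close>

lemma dn_rel5:
  assumes "s \<noteq> 1"
  shows "dnS z (wfun q P Q u v 5 (s / q)) = (s / q) * (s / q - 1)^2 / (s - 1) * wfun q P Q u v 5 s z
     - (s / q^2) * (q - 1)^2 / (s - 1) * wfun q P Q u v 6 s z"
proof -
  obtain r where r: "s = q * r" "s / q = r" by (rule quotients)
  obtain x where x: "r = q * x" "r / q = x" "s / q^2 = x"
    using nz r by (metis divide_divide_eq_left nonzero_mult_div_cancel_left power2_eq_square times_divide_eq_right)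
  have "(s - 1) * dnS z (wfun q P Q u v 5 r) = r * (r - 1)^2 * wfun q P Q u v 5 s z
     - x * (q - 1)^2 * wfun q P Q u v 6 s z"
  proof (cases rule: incidence_cases)
    case none
    show ?thesis
      unfolding wfun_simps dn_rules comb_def r(2) none r(1) x(1)
      by (simp only: case_simps; algebra)
  next
    case left
    show ?thesis
      unfolding wfun_simps dn_rules comb_def r(2) left r(1) x(1)
      by (simp only: case_simps; algebra)
  next
    case right
    show ?thesis
      unfolding wfun_simps dn_rules comb_def r(2) right r(1) x(1)
      by (simp only: case_simps; algebra)
  next
    case both
    show ?thesis
      unfolding wfun_simps dn_rules comb_def r(2) both r(1) x(1)
      by (simp only: case_simps; algebra)
  qed
  then show ?thesis unfolding r(2) x(3) by (rule divide_out[OF assms])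
qed

lemma same_rel5: "smS z (wfun q P Q u v 5 s)
    = ((s - 1) * (Q + P - s - s / q - 1) - (q - 1) * (s / q) * edev q P Q 5 s) * wfun q P Q u v 5 s z"
proof -
  obtain r where r: "s = q * r" "s / q = r" by (rule quotients)
  have "smS z (wfun q P Q u v 5 s)
    = ((s - 1) * (Q + P - s - r - 1) - (q - 1) * r * (Q + P - 2)) * wfun q P Q u v 5 s z"
  proof (cases rule: incidence_cases)
    case none
    show ?thesis
      unfolding wfun_simps same_rules comb_def r(2) none r(1)
      by (simp only: case_simps; algebra)
  next
    case left
    show ?thesis
      unfolding wfun_simps same_rules comb_def r(2) left r(1)
      by (simp only: case_simps; algebra)
  next
    case right
    show ?thesis
      unfolding wfun_simps same_rules comb_def r(2) right r(1)
      by (simp only: case_simps; algebra)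
  next
    case both
    show ?thesis
      unfolding wfun_simps same_rules comb_def r(2) both r(1)
      by (simp only: case_simps; algebra)
  qed
  moreover have "edev q P Q 5 s = Q + P - 2" by (simp add: edev_def)
  ultimately show ?thesis by (simp only: r(2))
qed

lemma same_rel6: "smS z (wfun q P Q u v 6 s)
    = ((s - 1) * (Q + P - s - s / q - 1) - (q - 1) * (s / q) * edev q P Q 6 s) * wfun q P Q u v 6 s z"
proof -
  obtain r where r: "s = q * r" "s / q = r" by (rule quotients)
  obtain x where x: "r = q * x" "r / q = x" "s / q^2 = x"
    using nz r by (metis divide_divide_eq_left nonzero_mult_div_cancel_left power2_eq_square times_divide_eq_right)
  \<comment> \<open>The \<open>1 / q\<close> in \<open>edev\<close> is absorbed by a factor
    \<open>q\<close> of \<open>r = q * x\<close>, which leaves a polynomial identity.\<close>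
  have e: "q * edev q P Q 6 s = q * (Q + P - s - r - 1) + 1"
    using nz r by (simp add: edev_def distrib_left)
  have "r * edev q P Q 6 s = x * (q * edev q P Q 6 s)" using x by simp
  then have e: "r * edev q P Q 6 s = x * (q * (Q + P - s - r - 1) + 1)" using e by simp
  have "smS z (wfun q P Q u v 6 s)
    = ((s - 1) * (Q + P - s - r - 1) - (q - 1) * (x * (q * (Q + P - s - r - 1) + 1))) * wfun q P Q u v 6 s z"
  proof (cases rule: incidence_cases)
    case none
    show ?thesis
      unfolding r(2) wfun_simps same_rules comb_def x(3) none r(1) x(1)
      by (simp only: case_simps; algebra)
  next
    case left
    show ?thesis
      unfolding r(2) wfun_simps same_rules comb_def x(3) left r(1) x(1)
      by (simp only: case_simps; algebra)
  next
    case right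
    show ?thesis
      unfolding r(2) wfun_simps same_rules comb_def x(3) right r(1) x(1)
      by (simp only: case_simps; algebra)
  next
    case both
    show ?thesis
      unfolding r(2) wfun_simps same_rules comb_def x(3) both r(1) x(1)
      by (simp only: case_simps; algebra)
  qed
  then show ?thesis by (simp only: mult.assoc[of "q - 1"] r(2) e)
qed

end

section \<open>From perturbation sums to the matrices L, F and R\<close>

lemma rank_uminus: "rank (- w) = rank w" for w :: "'a::{finite,field}^'n^'m"
proof -
  have eq: "(- w) *v p = w *v (- p)" for w :: "'a^'n^'m" and p
    by (simp add: matrix_vector_mult_def vec_eq_iff)
  have sub: "col (- w) \<subseteq> col w" for w :: "'a^'n^'m"
    unfolding col_def by (rule image_subsetI) (simp only: eq rangeI)
  from sub[of w] sub[of "- w"] have "col (- w) = col w" by simp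
  then show ?thesis by (simp add: rank_eq_iff_card_col card_col)
qed

lemma rank_diff_commute: "rank (a - b) = rank (b - a)" for a b :: "'a::{finite,field}^'n^'m"
  using rank_uminus[of "a - b"] by simp

text \<open>The factorisation of a rank one matrix is unique up to moving a nonzero scalar from one
  factor to the other, which leaves \<open>CARD('a) - 1\<close> of them.\<close>

lemma sum_outer_eq:
  fixes w :: "'a::{finite,field}^'n^'m"
  shows "(\<Sum>a\<in>- {0}. \<Sum>b\<in>- {0}. of_bool (outer a b = w) :: complex) = (of_nat CARD('a) - 1) * of_bool (rank w = 1)"
proof (cases "rank w = 1")
  case True
  then obtain a0 b0 where w: "a0 \<noteq> 0" "b0 \<noteq> 0" "w = outer a0 b0" by (rule rank_one_decomp)
  obtain i j where ij: "a0 $ i \<noteq> 0" "b0 $ j \<noteq> 0" using w by (auto simp: vec_eq_iff)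
  have "{c \<in> (- {0}) \<times> (- {0}). outer (fst c) (snd c) = w} = (\<lambda>k. (k *s a0, inverse k *s b0)) ` (- {0})"
  proof (intro equalityI subsetI)
    fix c assume "c \<in> {c \<in> (- {0}) \<times> (- {0}). outer (fst c) (snd c) = w}"
    obtain a b where ab: "c = (a, b)" by (cases c)
    then have c: "c = (a, b)" "a \<noteq> 0" "b \<noteq> 0" "outer a b = outer a0 b0"
      using \<open>c \<in> _\<close> by (simp_all add: w(3))
    have e: "a $ k * b $ l = a0 $ k * b0 $ l" for k l
      using c(4) by (simp add: outer_def vec_eq_iff)
    have bj: "a $ i \<noteq> 0" "b $ j \<noteq> 0" using e[of i j] ij by auto
    have 1: "a = (b0 $ j / b $ j) *s a0"
      using bj e by (simp add: vec_eq_iff field_simps)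
    have "b $ l * b0 $ j = b0 $ l * b $ j" for l
    proof -
      have "a0 $ i * (b $ l * b0 $ j) = a0 $ i * (b0 $ l * b $ j)"
        using e[of i l] e[of i j] by algebra
      then show ?thesis using ij(1) by simp
    qed
    then have "b = inverse (b0 $ j / b $ j) *s b0"
      using ij by (simp add: vec_eq_iff field_simps)
    then show "c \<in> (\<lambda>k. (k *s a0, inverse k *s b0)) ` (- {0})"
      using 1 c(1) bj ij by (intro image_eqI[of _ _ "b0 $ j / b $ j"]) auto
  next
    fix c assume "c \<in> (\<lambda>k. (k *s a0, inverse k *s b0)) ` (- {0})"
    then show "c \<in> {c \<in> (- {0}) \<times> (- {0}). outer (fst c) (snd c) = w}"
      using w by (auto simp: outer_def vec_eq_iff)
  qed
  moreover have "card ((\<lambda>k. (k *s a0, inverse k *s b0)) ` (- {0})) = card (- {0 :: 'a})"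
    by (rule card_image) (use inj_scale[OF w(1)] in \<open>auto simp: inj_on_def inj_def\<close>)
  ultimately have "cN {c \<in> (- {0}) \<times> (- {0}). outer (fst c) (snd c) = w} = of_nat CARD('a) - 1"
    by (simp add: cN_compl)
  then show ?thesis
    unfolding cN_sum_bool[OF finite] sum.cartesian_product using True by (simp add: case_prod_beta)
next
  case False
  then have "outer a b \<noteq> w" if "a \<noteq> 0" "b \<noteq> 0" for a b
    using rank_outer[OF that] by auto
  then show ?thesis using False by simp
qed

lemma sum_bf_adj:
  fixes G :: "'a::{finite,field}^'n^'m \<Rightarrow> complex"
  shows "(of_nat CARD('a) - 1) * (\<Sum>y\<in>UNIV. of_bool (bf_adj z y) * G y) = totS z G"
proof -
  have "totS z G = (\<Sum>a\<in>- {0}. \<Sum>b\<in>- {0}. \<Sum>y\<in>UNIV. of_bool (outer a b = y - z) * G y)"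
  proof -
    have "(\<Sum>y\<in>UNIV. of_bool (outer a b = y - z) * G y) = (\<Sum>y\<in>UNIV. if y = z + outer a b then G y else 0)" for a b
      by (intro sum.cong refl) (auto simp: algebra_simps)
    then show ?thesis by (simp add: totS_def)
  qed
  also have "\<dots> = (\<Sum>a\<in>- {0}. \<Sum>y\<in>UNIV. \<Sum>b\<in>- {0}. of_bool (outer a b = y - z) * G y)"
    by (intro sum.cong refl sum.swap)
  also have "\<dots> = (\<Sum>y\<in>UNIV. (\<Sum>a\<in>- {0}. \<Sum>b\<in>- {0}. of_bool (outer a b = y - z)) * G y)"
    unfolding sum_distrib_right by (rule sum.swap)
  also have "\<dots> = (of_nat CARD('a) - 1) * (\<Sum>y\<in>UNIV. of_bool (bf_adj z y) * G y)"
    unfolding sum_outer_eq bf_adj_def rank_diff_commute[of z] by (simp only: sum_distrib_left mult.assoc)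
  finally show ?thesis ..
qed

context rank_data
begin

lemma totS_rank:
  "totS z (\<lambda>w. of_bool (rank w = Suc (rank z)) * \<Phi> w) = upS z \<Phi>"
  "totS z (\<lambda>w. of_bool (Suc (rank w) = rank z) * \<Phi> w) = dnS z \<Phi>"
  "totS z (\<lambda>w. of_bool (rank w = rank z) * \<Phi> w) = smS z \<Phi>"
proof -
  have up: "upS z (\<lambda>w. of_bool (p (rank w)) * \<Phi> w) = of_bool (p (Suc (rank z))) * upS z \<Phi>" for p
    unfolding upS_def sum_distrib_left by (intro sum.cong refl) (simp add: rank_up)
  have dn: "dnS z (\<lambda>w. of_bool (p (Suc (rank w))) * \<Phi> w) = of_bool (p (rank z)) * dnS z \<Phi>" for p
    unfolding dnS_def sum_distrib_left by (intro sum.cong refl) (auto simp: rank_dn)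
  have sm: "smS z (\<lambda>w. of_bool (p (rank w)) * \<Phi> w) = of_bool (p (rank z)) * smS z \<Phi>" for p
    unfolding smS_lin(3)[symmetric] by (rule smS_scale_cong) (simp add: rank_same)
  show "totS z (\<lambda>w. of_bool (rank w = Suc (rank z)) * \<Phi> w) = upS z \<Phi>"
    unfolding totS_split up[of "\<lambda>r. r = Suc (rank z)"] sm[of "\<lambda>r. r = Suc (rank z)"]
    using dn[of "\<lambda>r. r = Suc (Suc (rank z))"] by simp
  show "totS z (\<lambda>w. of_bool (Suc (rank w) = rank z) * \<Phi> w) = dnS z \<Phi>"
    unfolding totS_split up[of "\<lambda>r. Suc r = rank z"] sm[of "\<lambda>r. Suc r = rank z"] dn[of "\<lambda>r. r = rank z"] by simp
  show "totS z (\<lambda>w. of_bool (rank w = rank z) * \<Phi> w) = smS z \<Phi>"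
    unfolding totS_split up[of "\<lambda>r. r = rank z"] sm[of "\<lambda>r. r = rank z"]
    using dn[of "\<lambda>r. r = Suc (rank z)"] by simp
qed

end

lemma bf_dist_eq: "bf_dist x z = rank (z - x)"
  by (simp add: bf_dist_def rank_diff_commute)

lemma bf_dist_le: "bf_dist x z \<le> CARD('m)" for x :: "'a::{finite,field}^'n^'m"
  by (simp add: bf_dist_def rank_le)

lemma Es_apply: "(Es x i *v w) $ z = of_bool (bf_dist x z = i) * w $ z"
proof -
  have "(Es x i *v w) $ z = (\<Sum>y\<in>UNIV. Es x i $ z $ y * w $ y)"
    by (simp add: matrix_vector_mult_def)
  also have "\<dots> = (\<Sum>y\<in>UNIV. if y = z then of_bool (bf_dist x z = i) * w $ z else 0)"
    by (intro sum.cong refl) (auto simp: Es_def)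
  finally show ?thesis by simp
qed

lemma Adj_apply: "(Adj *v w) $ z = (\<Sum>y\<in>UNIV. of_bool (bf_adj z y) * w $ y)"
proof -
  have "(Adj *v w) $ z = (\<Sum>y\<in>UNIV. Adj $ z $ y * w $ y)"
    by (simp add: matrix_vector_mult_def)
  also have "\<dots> = (\<Sum>y\<in>UNIV. of_bool (bf_adj z y) * w $ y)"
    by (intro sum.cong refl) (auto simp: Adj_def)
  finally show ?thesis .
qed

lemma Es_Adj_Es_apply: "((Es x i ** Adj ** Es x j) *v w) $ z
    = of_bool (bf_dist x z = i) * (\<Sum>y\<in>UNIV. of_bool (bf_adj z y) * (of_bool (bf_dist x y = j) * w $ y))"
  by (simp only: matrix_vector_mul_assoc[symmetric] Es_apply Adj_apply)

lemma sum_matrix_vector_apply: "((\<Sum>i\<in>I. A i) *v w) $ z = (\<Sum>i\<in>I. (A i *v w) $ z)" for A :: "_ \<Rightarrow> complex^'k^'k"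
  by (induction I rule: infinite_finite_induct) (simp_all add: matrix_vector_mult_add_rdistrib)

text \<open>\<open>Lop x\<close> lowers the level of a vector, so its entry at \<open>z\<close>
  collects the values at neighbours one step further away from \<open>x\<close>.\<close>

lemma Lop_apply: "(Lop x *v w) $ z = (\<Sum>y\<in>UNIV. of_bool (bf_adj z y) * (of_bool (bf_dist x y = Suc (bf_dist x z)) * w $ y))"
  for x :: "'a::{finite,field}^'n^'m"
proof -
  let ?S = "\<lambda>j. \<Sum>y\<in>UNIV. of_bool (bf_adj z y) * (of_bool (bf_dist x y = j) * w $ y)"
  have "(Lop x *v w) $ z = (\<Sum>i = 1..CARD('m). if i = Suc (bf_dist x z) then ?S i else 0)"
    unfolding Lop_def sum_matrix_vector_apply Es_Adj_Es_apply by (intro sum.cong refl) auto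
  also have "\<dots> = (if Suc (bf_dist x z) \<le> CARD('m) then ?S (Suc (bf_dist x z)) else 0)"
    by simp
  also have "\<dots> = ?S (Suc (bf_dist x z))"
  proof -
    have "bf_dist x y \<noteq> Suc (bf_dist x z)" if "\<not> Suc (bf_dist x z) \<le> CARD('m)" for y
      using bf_dist_le[of x y] that by auto
    then show ?thesis by auto
  qed
  finally show ?thesis .
qed

lemma Rop_apply: "(Rop x *v w) $ z = (\<Sum>y\<in>UNIV. of_bool (bf_adj z y) * (of_bool (Suc (bf_dist x y) = bf_dist x z) * w $ y))"
  for x :: "'a::{finite,field}^'n^'m"
proof -
  let ?S = "\<lambda>j. \<Sum>y\<in>UNIV. of_bool (bf_adj z y) * (of_bool (bf_dist x y = j) * w $ y)"
  show ?thesis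
  proof (cases "bf_dist x z")
    case 0
    then show ?thesis by (simp add: Rop_def sum_matrix_vector_apply Es_Adj_Es_apply)
  next
    case (Suc k)
    have "(Rop x *v w) $ z = (\<Sum>i = 0..CARD('m) - 1. if i = k then ?S i else 0)"
      unfolding Rop_def sum_matrix_vector_apply Es_Adj_Es_apply by (intro sum.cong refl) (auto simp: Suc)
    also have "\<dots> = ?S k" using bf_dist_le[of x z] Suc by simp
    finally show ?thesis by (simp only: Suc nat.inject)
  qed
qed

lemma Fop_apply: "(Fop x *v w) $ z = (\<Sum>y\<in>UNIV. of_bool (bf_adj z y) * (of_bool (bf_dist x y = bf_dist x z) * w $ y))"
  for x :: "'a::{finite,field}^'n^'m"
proof -
  let ?S = "\<lambda>j. \<Sum>y\<in>UNIV. of_bool (bf_adj z y) * (of_bool (bf_dist x y = j) * w $ y)"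
  have "(Fop x *v w) $ z = (\<Sum>i = 0..CARD('m). if i = bf_dist x z then ?S i else 0)"
    unfolding Fop_def sum_matrix_vector_apply Es_Adj_Es_apply by (intro sum.cong refl) auto
  then show ?thesis using bf_dist_le[of x z] by simp
qed

text \<open>A rank one perturbation changes the rank by at most 1, so every edge is accounted for by
  exactly one of the three matrices.\<close>

lemma Adj_eq_LFR: "Adj *v w = Lop x *v w + Fop x *v w + Rop x *v w"
  for x :: "'a::{finite,field}^'n^'m"
proof -
  have adj: "bf_dist x y = Suc (bf_dist x z) \<or> bf_dist x y = bf_dist x z \<or> Suc (bf_dist x y) = bf_dist x z"
    if "bf_adj z y" for y z
  proof -
    have "rank (y - z) = 1" using that by (simp add: bf_adj_def rank_diff_commute[of z])
    then obtain a b where "y - z = outer a b" by (rule rank_one_decomp)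
    then have y: "y - x = (z - x) + outer a b" by (simp add: algebra_simps)
    interpret rank_data "z - x" "of_nat CARD('a)" "of_nat CARD('a) ^ CARD('m)" "of_nat CARD('a) ^ CARD('n)" "of_nat CARD('a) ^ rank (z - x)"
      by unfold_locales simp_all
    show ?thesis
      unfolding bf_dist_eq y using rank_up[of a b] rank_same[of a b] rank_dn[of a b] by blast
  qed
  have "(Adj *v w) $ z = (Lop x *v w + Fop x *v w + Rop x *v w) $ z" for z
    unfolding vector_add_component Adj_apply Lop_apply Fop_apply Rop_apply sum.distrib[symmetric]
    by (intro sum.cong refl) (use adj in auto)
  then show ?thesis by (simp add: vec_eq_iff)
qed

definition bv :: "'a::{finite,field}^'n^'m \<Rightarrow> ('a^'n^'m \<Rightarrow> complex) \<Rightarrow> nat \<Rightarrow> complex^('a^'n^'m)" where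
  "bv x \<Phi> i = (\<chi> z. of_bool (rank (z - x) = i) * \<Phi> (z - x))"

lemma bv_apply: "bv x \<Phi> i $ z = of_bool (rank (z - x) = i) * \<Phi> (z - x)"
  by (simp add: bv_def)

lemma bv_cong: "(\<And>w. rank w = i \<Longrightarrow> \<Phi> w = \<Psi> w) \<Longrightarrow> bv x \<Phi> i = bv x \<Psi> i"
  by (auto simp: bv_def vec_eq_iff)

lemma bv_lin: "bv x (\<lambda>w. c * \<Phi> w) i = c *s bv x \<Phi> i"
  "bv x (\<lambda>w. \<Phi> w - \<Psi> w) i = bv x \<Phi> i - bv x \<Psi> i"
  by (simp_all add: bv_def vec_eq_iff algebra_simps)

lemma bv_eq_0: "(\<And>w. rank w = i \<Longrightarrow> \<Phi> w = 0) \<Longrightarrow> bv x \<Phi> i = 0"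
  by (auto simp: bv_def vec_eq_iff)

lemma totS_shift: "totS z (\<lambda>y. G (y - x)) = totS (z - x) G"
  by (simp add: totS_def algebra_simps)

text \<open>Note the reversal: lowering the level of a vector is a rising sum at the target, and
  raising it is a lowering sum. Division by \<open>q - 1\<close> undoes the overcounting by
  pairs.\<close>

lemma bv_ops:
  fixes x :: "'a::{finite,field}^'n^'m"
  defines "q \<equiv> of_nat CARD('a) :: complex"
  shows "Lop x *v bv x \<Phi> (Suc i) = bv x (\<lambda>w. upS w \<Phi> / (q - 1)) i"
    "Lop x *v bv x \<Phi> 0 = 0"
    "Rop x *v bv x \<Phi> i = bv x (\<lambda>w. dnS w \<Phi> / (q - 1)) (Suc i)"
    "Fop x *v bv x \<Phi> i = bv x (\<lambda>w. smS w \<Phi> / (q - 1)) i"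
    "Es x j *v bv x \<Phi> i = (if j = i then bv x \<Phi> i else 0)"
proof -
  have q1: "q - 1 \<noteq> 0" using CARD_field_gt_1[where 'a = 'a] by (simp add: q_def)
  have sum: "(\<Sum>y\<in>UNIV. of_bool (bf_adj z y) * G (y - x)) = totS (z - x) G / (q - 1)" for z and G :: "_ \<Rightarrow> complex"
    using sum_bf_adj[of z "\<lambda>y. G (y - x)"] q1 unfolding totS_shift q_def[symmetric] by (simp add: field_simps)
  have rd: "rank_data w q (q ^ CARD('m)) (q ^ CARD('n)) (q ^ rank w)" for w :: "'a^'n^'m"
    by unfold_locales (simp_all add: q_def)
  have pull: "(\<Sum>y\<in>UNIV. A y * (c * B y)) = c * (\<Sum>y\<in>UNIV. A y * B y)" for c and A B :: "'a^'n^'m \<Rightarrow> complex"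
    unfolding sum_distrib_left by (rule sum.cong[OF refl]) (rule mult.left_commute)
  note tot = rank_data.totS_rank[OF rd]
  have "(Lop x *v bv x \<Phi> k) $ z = of_bool (Suc (rank (z - x)) = k) * (upS (z - x) \<Phi> / (q - 1))" for z k
  proof -
    have "(Lop x *v bv x \<Phi> k) $ z = (\<Sum>y\<in>UNIV. of_bool (bf_adj z y) *
        (of_bool (Suc (rank (z - x)) = k) * (of_bool (rank (y - x) = Suc (rank (z - x))) * \<Phi> (y - x))))"
      unfolding Lop_apply bf_dist_eq bv_apply by (intro sum.cong refl) auto
    also have "\<dots> = of_bool (Suc (rank (z - x)) = k) * (totS (z - x) (\<lambda>w. of_bool (rank w = Suc (rank (z - x))) * \<Phi> w) / (q - 1))"
      unfolding pull sum[of z "\<lambda>w. of_bool (rank w = Suc (rank (z - x))) * \<Phi> w"] ..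
    finally show ?thesis unfolding tot .
  qed
  then show "Lop x *v bv x \<Phi> (Suc i) = bv x (\<lambda>w. upS w \<Phi> / (q - 1)) i" "Lop x *v bv x \<Phi> 0 = 0"
    by (simp_all add: vec_eq_iff bv_apply)
  have "(Rop x *v bv x \<Phi> i) $ z = of_bool (rank (z - x) = Suc i) * (dnS (z - x) \<Phi> / (q - 1))" for z
  proof -
    have "(Rop x *v bv x \<Phi> i) $ z = (\<Sum>y\<in>UNIV. of_bool (bf_adj z y) *
        (of_bool (rank (z - x) = Suc i) * (of_bool (Suc (rank (y - x)) = rank (z - x)) * \<Phi> (y - x))))"
      unfolding Rop_apply bf_dist_eq bv_apply by (intro sum.cong refl) auto
    also have "\<dots> = of_bool (rank (z - x) = Suc i) * (totS (z - x) (\<lambda>w. of_bool (Suc (rank w) = rank (z - x)) * \<Phi> w) / (q - 1))"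
      unfolding pull sum[of z "\<lambda>w. of_bool (Suc (rank w) = rank (z - x)) * \<Phi> w"] ..
    finally show ?thesis unfolding tot .
  qed
  then show "Rop x *v bv x \<Phi> i = bv x (\<lambda>w. dnS w \<Phi> / (q - 1)) (Suc i)"
    by (simp add: vec_eq_iff bv_apply)
  have "(Fop x *v bv x \<Phi> i) $ z = of_bool (rank (z - x) = i) * (smS (z - x) \<Phi> / (q - 1))" for z
  proof -
    have "(Fop x *v bv x \<Phi> i) $ z = (\<Sum>y\<in>UNIV. of_bool (bf_adj z y) *
        (of_bool (rank (z - x) = i) * (of_bool (rank (y - x) = rank (z - x)) * \<Phi> (y - x))))"
      unfolding Fop_apply bf_dist_eq bv_apply by (intro sum.cong refl) auto
    also have "\<dots> = of_bool (rank (z - x) = i) * (totS (z - x) (\<lambda>w. of_bool (rank w = rank (z - x)) * \<Phi> w) / (q - 1))"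
      unfolding pull sum[of z "\<lambda>w. of_bool (rank w = rank (z - x)) * \<Phi> w"] ..
    finally show ?thesis unfolding tot .
  qed
  then show "Fop x *v bv x \<Phi> i = bv x (\<lambda>w. smS w \<Phi> / (q - 1)) i"
    by (simp add: vec_eq_iff bv_apply)
  show "Es x j *v bv x \<Phi> i = (if j = i then bv x \<Phi> i else 0)"
    by (auto simp: vec_eq_iff Es_apply bv_apply bf_dist_eq)
qed

subsection \<open>Common neighbours and the partition\<close>

text \<open>\<open>incid u v t z\<close>: the bilinear form on column space times row space induced by a generalised
  inverse of \<open>z\<close> is defined at \<open>(u, v)\<close> and has the value \<open>t\<close> there.\<close>

definition incid :: "'a::{finite,field}^'m \<Rightarrow> 'a^'n \<Rightarrow> 'a \<Rightarrow> 'a^'n^'m \<Rightarrow> bool" where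
  "incid u v t z \<longleftrightarrow> v \<in> row_sp z \<and> (\<exists>p. z *v p = u \<and> dotp v p = t)"

lemma phiF_incid: "phiF u v t z = of_bool (incid u v t z)"
  by (simp add: phiF_def incid_def)

lemma incidD: "incid u v t z \<Longrightarrow> u \<in> col z \<and> v \<in> row_sp z"
  by (auto simp: incid_def)

lemma incid_iff: "z *v p = u \<Longrightarrow> v \<in> row_sp z \<Longrightarrow> incid u v t z \<longleftrightarrow> dotp v p = t"
  using phiF_eq[of z p u v t] unfolding phiF_incid of_bool_eq_iff .

lemma incid_unique: "incid u v t z \<Longrightarrow> incid u v t' z \<Longrightarrow> t = t'"
proof -
  assume t: "incid u v t z" and t': "incid u v t' z"
  then obtain p where "z *v p = u" "v \<in> row_sp z" by (auto simp: incid_def)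
  from t[unfolded incid_iff[OF this]] t'[unfolded incid_iff[OF this]] show ?thesis by simp
qed

lemma dnp_uminus: "dnp z (- a) b \<longleftrightarrow> dnp z a (- b)"
proof -
  have "dnp z a (- b)" if d: "dnp z (- a) b" for a b
  proof -
    obtain p where "z *v p = - a" "dotp b p = - 1" "b \<in> row_sp z" using d by (auto simp: dnp_def)
    then have "z *v (- p) = a" "dotp (- b) (- p) = - 1" "- b \<in> row_sp z"
      using matrix_vector_mult_diff_distrib[of z 0 p] by (simp_all add: dotp_simps col_uminus)
    then show ?thesis by (auto simp: dnp_def)
  qed
  from this[of a b] this[of "- a" "- b"] show ?thesis
  proof -
    have "dnp z (- a) b" if d: "dnp z a (- b)"
    proof -
      obtain p where "z *v p = a" "dotp (- b) p = - 1" "- b \<in> row_sp z" using d by (auto simp: dnp_def)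
      then have "z *v (- p) = - a" "dotp b (- p) = - 1" "b \<in> row_sp z"
        using matrix_vector_mult_diff_distrib[of z 0 p] col_uminus[of "- b" "transpose z"] by (simp_all add: dotp_simps)
      then show ?thesis by (auto simp: dnp_def)
    qed
    then show ?thesis using \<open>dnp z (- a) b \<Longrightarrow> dnp z a (- b)\<close> by blast
  qed
qed

text \<open>Since \<open>y\<close> will be \<open>x + outer u v\<close>, distances to
  \<open>y\<close> come from subtracting \<open>outer u v\<close>. The sign change turns the
  critical value \<open>- 1\<close> of \<open>dnp\<close> into 1, which is why the value 1 is
  singled out among the nonzero ones.\<close>

lemma dnp_incid: "dnp z (- u) v \<longleftrightarrow> incid u v 1 z"
proof
  assume "dnp z (- u) v"
  then obtain p where "z *v p = - u" "dotp v p = - 1" "v \<in> row_sp z" by (auto simp: dnp_def)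
  then have "z *v (- p) = u" "dotp v (- p) = 1" "v \<in> row_sp z"
    using matrix_vector_mult_diff_distrib[of z 0 p] by (simp_all add: dotp_simps)
  then show "incid u v 1 z" by (auto simp: incid_def)
next
  assume "incid u v 1 z"
  then obtain p where "z *v p = u" "dotp v p = 1" "v \<in> row_sp z" by (auto simp: incid_def)
  then have "z *v (- p) = - u" "dotp v (- p) = - 1" "v \<in> row_sp z"
    using matrix_vector_mult_diff_distrib[of z 0 p] by (simp_all add: dotp_simps)
  then show "dnp z (- u) v" by (auto simp: dnp_def)
qed

lemma minus_outer: "z - outer a b = z + outer (- a) b"
  by (simp add: outer_def vec_eq_iff)

lemma rank_minus_outer:
  fixes z :: "'a::{finite,field}^'n^'m"
  shows "rank (z - outer a b) = Suc (rank z) \<longleftrightarrow> a \<notin> col z \<and> b \<notin> row_sp z"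
    "Suc (rank (z - outer a b)) = rank z \<longleftrightarrow> dnp z (- a) b"
    "rank (z - outer a b) = rank z \<longleftrightarrow> \<not> (a \<notin> col z \<and> b \<notin> row_sp z) \<and> \<not> dnp z (- a) b"
proof -
  interpret rank_data z "of_nat CARD('a)" "of_nat CARD('a) ^ CARD('m)" "of_nat CARD('a) ^ CARD('n)" "of_nat CARD('a) ^ rank z"
    by unfold_locales simp_all
  have a: "- a \<in> col z \<longleftrightarrow> a \<in> col z" using col_uminus[of a z] col_uminus[of "- a" z] by auto
  have "rank (z - outer a b) = Suc (rank z)" if "a \<notin> col z" "b \<notin> row_sp z"
    using rank_up[of "- a" b] that by (simp add: minus_outer a)
  moreover have "Suc (rank (z - outer a b)) = rank z" if "dnp z (- a) b"
    using rank_dn[OF that] by (simp add: minus_outer)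
  moreover have "rank (z - outer a b) = rank z" if "\<not> dnp z (- a) b" "a \<in> col z \<or> b \<in> row_sp z"
    using rank_same[of "- a" b] that by (simp add: minus_outer a)
  moreover have "\<not> (dnp z (- a) b \<and> a \<notin> col z)" using a dnp_in_col(1) by blast
  ultimately show "rank (z - outer a b) = Suc (rank z) \<longleftrightarrow> a \<notin> col z \<and> b \<notin> row_sp z"
    "Suc (rank (z - outer a b)) = rank z \<longleftrightarrow> dnp z (- a) b"
    "rank (z - outer a b) = rank z \<longleftrightarrow> \<not> (a \<notin> col z \<and> b \<notin> row_sp z) \<and> \<not> dnp z (- a) b"
    by (cases "dnp z (- a) b"; cases "a \<in> col z"; cases "b \<in> row_sp z"; simp; linarith?)+
qed

lemma outer_scale: "outer (k *s a) b = outer a (k *s b)"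
  by (simp add: outer_def vec_eq_iff mult_ac)

lemma outer_left_inj: "u \<noteq> 0 \<Longrightarrow> outer u b = outer u b' \<longleftrightarrow> b = b'"
proof -
  assume "u \<noteq> 0"
  then obtain i where "u $ i \<noteq> 0" by (auto simp: vec_eq_iff)
  then show ?thesis by (auto simp: outer_def vec_eq_iff)
qed

lemma outer_right_inj: "v \<noteq> 0 \<Longrightarrow> outer a v = outer a' v \<longleftrightarrow> a = a'"
proof -
  assume "v \<noteq> 0"
  then obtain i where "v $ i \<noteq> 0" by (auto simp: vec_eq_iff)
  then show ?thesis by (auto simp: outer_def vec_eq_iff)
qed

lemma outer_eq_outer:
  fixes u a :: "'a::field^'m" and b v :: "'a^'n"
  assumes "u \<noteq> 0" "v \<noteq> 0" "outer u b = outer a v"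
  shows "\<exists>k. a = k *s u"
proof -
  obtain j where j: "v $ j \<noteq> 0" using assms(2) by (auto simp: vec_eq_iff)
  have "u $ i * b $ j = a $ i * v $ j" for i
    using assms(3) by (simp add: outer_def vec_eq_iff)
  then have "a = (b $ j / v $ j) *s u" using j by (simp add: vec_eq_iff field_simps)
  then show ?thesis ..
qed

text \<open>If \<open>w\<close> shares neither its column line nor its row line with
  \<open>outer u v\<close>, then subtraction raises the rank to 2. If it shares one, the rank of the
  difference is at most 1, and it is 0 only for \<open>w = outer u v\<close>.\<close>

lemma common_neighbours:
  fixes u :: "'a::{finite,field}^'m" and v :: "'a^'n"
  assumes u: "u \<noteq> 0" and v: "v \<noteq> 0"
  shows "rank w = 1 \<and> rank (w - outer u v) = 1 \<longleftrightarrow>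
    w \<noteq> outer u v \<and> ((\<exists>b. b \<noteq> 0 \<and> w = outer u b) \<or> (\<exists>a. a \<noteq> 0 \<and> w = outer a v))"
proof
  assume w: "rank w = 1 \<and> rank (w - outer u v) = 1"
  then obtain a b where ab: "a \<noteq> 0" "b \<noteq> 0" "w = outer a b" using rank_one_decomp by metis
  have "u \<in> col w \<or> v \<in> row_sp w" using rank_minus_outer(1)[of w u v] w by simp
  then have "(\<exists>b. b \<noteq> 0 \<and> w = outer u b) \<or> (\<exists>a. a \<noteq> 0 \<and> w = outer a v)"
  proof
    assume "u \<in> col w"
    then obtain k where k: "u = k *s a" using ab by (auto simp: col_outer)
    then have "k \<noteq> 0" using u by auto
    then have "w = outer u (inverse k *s b)" by (simp add: ab(3) k outer_scale)
    moreover have "inverse k *s b \<noteq> 0" using ab \<open>k \<noteq> 0\<close> by simp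
    ultimately show ?thesis by blast
  next
    assume "v \<in> row_sp w"
    then obtain k where k: "v = k *s b" using ab by (auto simp: transpose_outer col_outer)
    then have "k \<noteq> 0" using v by auto
    then have "w = outer (inverse k *s a) v" by (simp add: ab(3) k outer_scale)
    moreover have "inverse k *s a \<noteq> 0" using ab \<open>k \<noteq> 0\<close> by simp
    ultimately show ?thesis by blast
  qed
  moreover have "w \<noteq> outer u v" using w rank_zero_iff[of "0 :: 'a^'n^'m"] by auto
  ultimately show "w \<noteq> outer u v \<and> ((\<exists>b. b \<noteq> 0 \<and> w = outer u b) \<or> (\<exists>a. a \<noteq> 0 \<and> w = outer a v))" by blast
next
  assume w: "w \<noteq> outer u v \<and> ((\<exists>b. b \<noteq> 0 \<and> w = outer u b) \<or> (\<exists>a. a \<noteq> 0 \<and> w = outer a v))"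
  then have r1: "rank w = 1" using rank_outer u v by blast
  have "rank (w - outer u v) \<noteq> 0" using w by (simp add: rank_zero_iff)
  moreover have "u \<in> col w \<or> v \<in> row_sp w"
    using w
  proof (elim conjE disjE exE)
    fix b assume "b \<noteq> 0" "w = outer u b"
    then show ?thesis by (auto simp: col_outer intro!: range_eqI[of _ _ 1])
  next
    fix a assume "a \<noteq> 0" "w = outer a v"
    then show ?thesis by (auto simp: transpose_outer col_outer intro!: range_eqI[of _ _ 1])
  qed
  ultimately show "rank w = 1 \<and> rank (w - outer u v) = 1"
    using rank_minus_outer(2,3)[of w u v] r1 by fastforce
qed

text \<open>Inclusion and exclusion for the cliques \<open>outer u b\<close> and
  \<open>outer a v\<close>, which meet in the multiples of \<open>outer u v\<close>. The assumption
  on \<open>G\<close> discards the one multiple that is not itself a common neighbour.\<close>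

lemma card_common_neighbours:
  fixes u :: "'a::{finite,field}^'m" and v :: "'a^'n"
  assumes u: "u \<noteq> 0" and v: "v \<noteq> 0" and G: "\<not> G (outer u v)"
  shows "cN {w. (rank w = 1 \<and> rank (w - outer u v) = 1) \<and> G w}
    = cN {b \<in> - {0}. G (outer u b)} + cN {a \<in> - {0}. G (outer a v)} - cN {k \<in> - {0}. G (outer (k *s u) v)}"
proof -
  let ?B = "outer u ` {b \<in> - {0}. G (outer u b)}" and ?A = "(\<lambda>a. outer a v) ` {a \<in> - {0}. G (outer a v)}"
  have "{w. (rank w = 1 \<and> rank (w - outer u v) = 1) \<and> G w} = ?B \<union> ?A"
    unfolding common_neighbours[OF u v] using G by auto
  moreover have "cN (?B \<union> ?A) + cN (?B \<inter> ?A) = cN ?B + cN ?A"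
    unfolding of_nat_add[symmetric] by (subst card_Un_Int) simp_all
  moreover have "?B \<inter> ?A = (\<lambda>k. outer (k *s u) v) ` {k \<in> - {0}. G (outer (k *s u) v)}"
  proof (intro equalityI subsetI)
    fix w assume "w \<in> ?B \<inter> ?A"
    then obtain b where b: "w = outer u b" by blast
    from \<open>w \<in> ?B \<inter> ?A\<close> obtain a where w: "w = outer a v" "a \<noteq> 0" "G (outer a v)" by blast
    from b w have "outer u b = outer a v" by simp
    then obtain k where "a = k *s u" using outer_eq_outer[OF u v, of b a] by auto
    then show "w \<in> (\<lambda>k. outer (k *s u) v) ` {k \<in> - {0}. G (outer (k *s u) v)}"
      using w by (intro image_eqI[of _ _ k]) auto
  next
    fix w assume "w \<in> (\<lambda>k. outer (k *s u) v) ` {k \<in> - {0}. G (outer (k *s u) v)}"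
    then obtain k where k: "k \<noteq> 0" "w = outer (k *s u) v" "G w" by auto
    have "w \<in> ?B" using k v by (intro image_eqI[of _ _ "k *s v"]) (auto simp: outer_scale)
    moreover have "w \<in> ?A" using k u by (intro image_eqI[of _ _ "k *s u"]) auto
    ultimately show "w \<in> ?B \<inter> ?A" by blast
  qed
  moreover have "cN ?B = cN {b \<in> - {0}. G (outer u b)}"
    by (subst card_image) (auto simp: inj_on_def outer_left_inj[OF u])
  moreover have "cN ?A = cN {a \<in> - {0}. G (outer a v)}"
    by (subst card_image) (auto simp: inj_on_def outer_right_inj[OF v])
  moreover have "cN ((\<lambda>k. outer (k *s u) v) ` {k \<in> - {0}. G (outer (k *s u) v)}) = cN {k \<in> - {0}. G (outer (k *s u) v)}"
    using inj_scale[OF u] by (subst card_image) (auto simp: inj_on_def outer_right_inj[OF v] inj_def)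
  ultimately show ?thesis by (simp only: eq_diff_eq)
qed

context rank_data_pair
begin

text \<open>Each clique contributes \<open>s / q\<close> if its fixed vector is incident with
  \<open>z\<close>. The overlap consists of the \<open>k\<close> whose product with the form value
  at \<open>(u, v)\<close> is 1: a single one for a nonzero value, none for 0.\<close>

lemma card_minus:
  assumes n: "\<not> incid u v 1 z"
  shows "cN {w. (rank w = 1 \<and> rank (w - outer u v) = 1) \<and> Suc (rank (z - w)) = rank z}
    = of_bool (u \<in> col z) * (s / q) + of_bool (v \<in> row_sp z) * (s / q)
      - of_bool (u \<in> col z \<and> v \<in> row_sp z \<and> \<not> incid u v 0 z)"
proof -
  have c: "- u \<in> col z \<longleftrightarrow> u \<in> col z" using col_uminus[of u z] col_uminus[of "- u" z] by auto
  have c': "- v \<in> row_sp z \<longleftrightarrow> v \<in> row_sp z" using col_uminus[of v "transpose z"] col_uminus[of "- v" "transpose z"] by auto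
  have "{b \<in> - {0}. dnp z (- u) b} = {b \<in> row_sp z. dnp z (- u) b}"
    using dnp_in_col(2) dnp_nonzero(2) by blast
  moreover have "cN {b \<in> row_sp z. dnp z (- u) b} = of_bool (u \<in> col z) * (s / q)"
  proof (cases "u \<in> col z")
    case True
    then show ?thesis using cN_dnp_row[of "- u"] c u by simp
  next
    case False
    then have "{b \<in> row_sp z. dnp z (- u) b} = {}" using dnp_in_col(1)[of z "- u"] c by blast
    then show ?thesis using False by (simp only: card.empty of_nat_0) simp
  qed
  moreover have "{a \<in> - {0}. dnp z (- a) v} = {a \<in> col z. dnp z a (- v)}"
    unfolding dnp_uminus using dnp_in_col(1) dnp_nonzero(1) by blast
  moreover have "cN {a \<in> col z. dnp z a (- v)} = of_bool (v \<in> row_sp z) * (s / q)"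
  proof (cases "v \<in> row_sp z")
    case True
    then show ?thesis using cN_dnp_col[of "- v"] c' v by simp
  next
    case False
    then have "{a \<in> col z. dnp z a (- v)} = {}" using dnp_in_col(2)[of z _ "- v"] c' by blast
    then show ?thesis using False by (simp only: card.empty of_nat_0) simp
  qed
  moreover have "cN {k \<in> - {0}. dnp z (- (k *s u)) v} = of_bool (u \<in> col z \<and> v \<in> row_sp z \<and> \<not> incid u v 0 z)"
  proof (cases "u \<in> col z \<and> v \<in> row_sp z")
    case True
    then obtain p where p: "z *v p = u" by (auto simp: col_def)
    have eq: "dnp z (- (k *s u)) v \<longleftrightarrow> k * dotp v p = 1" for k
    proof -
      have "- (k *s u) = z *v ((- k) *s p)"
        by (simp only: vector_scalar_commute p) (simp add: vec_eq_iff)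
      then have "dnp z (- (k *s u)) v \<longleftrightarrow> dotp v ((- k) *s p) = - 1"
        using dnp_iff[of v z "(- k) *s p"] True by simp
      then show ?thesis by (simp add: dotp_simps)
    qed
    show ?thesis
    proof (cases "dotp v p = 0")
      case 0: True
      then show ?thesis unfolding eq using True incid_iff[OF p, of v 0] by simp
    next
      case 0: False
      then have "{k \<in> - {0}. k * dotp v p = 1} = {1 / dotp v p}"
        unfolding nonzero_eq_divide_eq[OF 0, symmetric] by auto
      then have "cN {k \<in> - {0}. dnp z (- (k *s u)) v} = 1"
        unfolding eq by (simp only: card.insert finite.emptyI card.empty empty_iff) simp
      then show ?thesis using 0 True incid_iff[OF p, of v 0] by simp
    qed
  next
    case False
    have "\<not> dnp z (- (k *s u)) v" if "k \<noteq> 0" for k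
    proof
      assume d: "dnp z (- (k *s u)) v"
      have "- (k *s u) \<in> col z" using dnp_in_col(1)[OF d] .
      then have "u \<in> col z" using col_uminus[of "- (k *s u)" z] col_scale_iff[OF that, of u z] by simp
      then show False using False dnp_in_col(2)[OF d] by simp
    qed
    then have "{k \<in> - {0}. dnp z (- (k *s u)) v} = {}" by blast
    then show ?thesis using False by (simp only: card.empty of_nat_0) auto
  qed
  moreover have G0: "\<not> Suc (rank (z - outer u v)) = rank z"
    using n by (simp only: rank_minus_outer dnp_incid) simp
  ultimately show ?thesis
    using card_common_neighbours[OF u v, of "\<lambda>w. Suc (rank (z - w)) = rank z", OF G0]
    by (simp only: rank_minus_outer)
qed

text \<open>One of \<open>u\<close> and \<open>v\<close> is incident with \<open>z\<close>, so
  subtracting a multiple of \<open>outer u v\<close> never raises the rank, and the cliques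
  contribute without overlap.\<close>

lemma card_plus:
  assumes n: "\<not> (u \<notin> col z \<and> v \<notin> row_sp z)"
  shows "cN {w. (rank w = 1 \<and> rank (w - outer u v) = 1) \<and> rank (z - w) = Suc (rank z)}
    = of_bool (u \<notin> col z) * (Q - s) + of_bool (v \<notin> row_sp z) * (P - s)"
proof -
  have "{b \<in> - {0}. u \<notin> col z \<and> b \<notin> row_sp z} = (if u \<in> col z then {} else - row_sp z)" by auto
  moreover have "{a \<in> - {0}. a \<notin> col z \<and> v \<notin> row_sp z} = (if v \<in> row_sp z then {} else - col z)" by auto
  moreover have "{k \<in> - {0}. k *s u \<notin> col z \<and> v \<notin> row_sp z} = {}" using n col_scale by blast
  ultimately show ?thesis
    using card_common_neighbours[OF u v, of "\<lambda>w. rank (z - w) = Suc (rank z)"] n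
    by (simp only: rank_minus_outer simp_thms) (simp add: cN_col)
qed

end

text \<open>The codes follow the order of \<open>xy_partition\<close>: 1 and 2 are the off-diagonal
  cells closer to \<open>y\<close> and closer to \<open>x\<close>, and 3 to 6 are the types A, B, C,
  D. They are unrelated to the family index of \<open>wfun\<close>.\<close>

definition cell_type :: "'a::{finite,field}^'m \<Rightarrow> 'a^'n \<Rightarrow> nat \<Rightarrow> 'a^'n^'m \<Rightarrow> bool" where
  "cell_type u v k z \<longleftrightarrow>
    (if k = 1 then incid u v 1 z
     else if k = 2 then u \<notin> col z \<and> v \<notin> row_sp z
     else if k = 3 then incid u v 0 z
     else if k = 4 then u \<in> col z \<and> v \<in> row_sp z \<and> \<not> incid u v 0 z \<and> \<not> incid u v 1 z
     else if k = 5 then u \<in> col z \<and> v \<notin> row_sp z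
     else u \<notin> col z \<and> v \<in> row_sp z)"

lemma card_shift: "card {w. P (w - x)} = card {w. P w}" for x :: "'k::{finite,ab_group_add}"
  by (rule bij_betw_same_card[of "\<lambda>w. w - x"], rule bij_betw_byWitness[where f' = "\<lambda>w. w + x"]) auto

lemma full_rank_col:
  fixes z :: "'a::{finite,field}^'n^'m"
  assumes "rank z = CARD('m)"
  shows "u \<in> col z"
proof -
  have "card (col z) = card (UNIV :: ('a^'m) set)" using assms by (simp add: card_col)
  then have "col z = UNIV" by (metis card_subset_eq finite subset_UNIV)
  then show ?thesis by simp
qed

text \<open>In rank one \<open>u\<close> and \<open>v\<close> are nonzero multiples of the two
  factors, on which the form is nonzero. This is why type A starts at level 2.\<close>

lemma rank_one_not_incid_0:
  fixes z :: "'a::{finite,field}^'n^'m"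
  assumes u: "u \<noteq> 0" and v: "v \<noteq> 0" and r: "rank z = 1"
  shows "\<not> incid u v 0 z"
proof
  assume i: "incid u v 0 z"
  obtain a b where ab: "a \<noteq> 0" "b \<noteq> 0" "z = outer a b" using rank_one_decomp[OF r] by blast
  obtain p where p: "z *v p = u" "dotp v p = 0" "v \<in> row_sp z" using i by (auto simp: incid_def)
  obtain k where "v = k *s b" using p(3) ab by (auto simp: transpose_outer col_outer)
  then have "k \<noteq> 0" "k * dotp b p = 0" using v p(2) by (auto simp: dotp_scale_left)
  then have "u = 0" using p(1) ab(3) by (simp add: outer_mult)
  then show False using u by simp
qed

section \<open>The cells of the partition as incidence classes\<close>

locale adjacent_vertices =
  fixes x y :: "'a::{finite,field}^'n^'m" and u :: "'a^'m" and v :: "'a^'n"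
  assumes u: "u \<noteq> 0" and v: "v \<noteq> 0" and y: "y = x + outer u v"
    and D2: "CARD('m) \<ge> 2" and DM: "CARD('m) < CARD('n)"
begin

lemma pair: "rank_data_pair z (of_nat CARD('a)) (of_nat CARD('a) ^ CARD('m)) (of_nat CARD('a) ^ CARD('n))
    (of_nat CARD('a) ^ rank z) u v" for z :: "'a^'n^'m"
  by unfold_locales (simp_all add: u v)

lemma Gam_x: "z \<in> Gam i x \<longleftrightarrow> rank (z - x) = i"
  by (simp add: Gam_def bf_dist_eq)

lemma Gam_y: "z \<in> Gam i y \<longleftrightarrow> rank ((z - x) - outer u v) = i"
  by (simp add: Gam_def bf_dist_eq y algebra_simps)

lemma Gam_shift: "w \<in> Gam i z \<longleftrightarrow> rank ((z - x) - (w - x)) = i"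
  by (simp add: Gam_def bf_dist_def)

text \<open>The correction for the overlap stands on the left, which avoids subtraction of natural
  numbers.\<close>

lemma mminus_eq:
  assumes "rank (z - x) = Suc i" "\<not> incid u v 1 (z - x)"
  shows "mminus x y (Suc i) z + of_bool (u \<in> col (z - x) \<and> v \<in> row_sp (z - x) \<and> \<not> incid u v 0 (z - x))
    = of_bool (u \<in> col (z - x)) * CARD('a) ^ i + of_bool (v \<in> row_sp (z - x)) * CARD('a) ^ i"
proof -
  interpret rank_data_pair "z - x" "of_nat CARD('a)" "of_nat CARD('a) ^ CARD('m)" "of_nat CARD('a) ^ CARD('n)"
    "of_nat CARD('a) ^ rank (z - x)" u v by (rule pair)
  have "Gam 1 x \<inter> Gam 1 y \<inter> Gam (Suc i - 1) z
      = {w. (rank (w - x) = 1 \<and> rank (w - x - outer u v) = 1) \<and> Suc (rank (z - x - (w - x))) = rank (z - x)}"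
    unfolding assms(1) by (auto simp: Gam_x Gam_y Gam_shift[of _ _ z])
  then have "mminus x y (Suc i) z
      = card {w. (rank w = 1 \<and> rank (w - outer u v) = 1) \<and> Suc (rank (z - x - w)) = rank (z - x)}"
    unfolding mminus_def by (simp only: card_shift[of "\<lambda>w. (rank w = 1 \<and> rank (w - outer u v) = 1) \<and> Suc (rank (z - x - w)) = rank (z - x)"])
  then have "of_nat (mminus x y (Suc i) z + of_bool (u \<in> col (z - x) \<and> v \<in> row_sp (z - x) \<and> \<not> incid u v 0 (z - x)))
    = (of_nat (of_bool (u \<in> col (z - x)) * CARD('a) ^ i + of_bool (v \<in> row_sp (z - x)) * CARD('a) ^ i) :: complex)"
    using card_minus[OF assms(2)] nz(1) by (simp add: assms(1))
  then show ?thesis by (simp only: of_nat_eq_iff)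
qed

lemma mplus_eq:
  assumes "rank (z - x) = i" "\<not> (u \<notin> col (z - x) \<and> v \<notin> row_sp (z - x))"
  shows "mplus x y i z = of_bool (u \<notin> col (z - x)) * (CARD('a) ^ CARD('n) - CARD('a) ^ i)
      + of_bool (v \<notin> row_sp (z - x)) * (CARD('a) ^ CARD('m) - CARD('a) ^ i)"
proof -
  interpret rank_data_pair "z - x" "of_nat CARD('a)" "of_nat CARD('a) ^ CARD('m)" "of_nat CARD('a) ^ CARD('n)"
    "of_nat CARD('a) ^ rank (z - x)" u v by (rule pair)
  have le: "CARD('a) ^ i \<le> CARD('a) ^ CARD('m)" "CARD('a) ^ i \<le> CARD('a) ^ CARD('n)"
    using rank_le[of "z - x"] assms(1) by (simp_all add: power_increasing)
  have "Gam 1 x \<inter> Gam 1 y \<inter> Gam (i + 1) z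
      = {w. (rank (w - x) = 1 \<and> rank (w - x - outer u v) = 1) \<and> rank (z - x - (w - x)) = Suc (rank (z - x))}"
    unfolding assms(1) by (auto simp: Gam_x Gam_y Gam_shift[of _ _ z])
  then have "mplus x y i z
      = card {w. (rank w = 1 \<and> rank (w - outer u v) = 1) \<and> rank (z - x - w) = Suc (rank (z - x))}"
    unfolding mplus_def by (simp only: card_shift[of "\<lambda>w. (rank w = 1 \<and> rank (w - outer u v) = 1) \<and> rank (z - x - w) = Suc (rank (z - x))"])
  then have "of_nat (mplus x y i z) = (of_nat (of_bool (u \<notin> col (z - x)) * (CARD('a) ^ CARD('n) - CARD('a) ^ i)
      + of_bool (v \<notin> row_sp (z - x)) * (CARD('a) ^ CARD('m) - CARD('a) ^ i)) :: complex)"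
    using card_plus[OF assms(2)] le by (simp add: assms(1) of_nat_diff)
  then show ?thesis by (simp only: of_nat_eq_iff)
qed

lemma Gam_xy:
  "z \<in> Gam (Suc i) x \<inter> Gam i y \<longleftrightarrow> rank (z - x) = Suc i \<and> cell_type u v 1 (z - x)"
  "z \<in> Gam i x \<inter> Gam (Suc i) y \<longleftrightarrow> rank (z - x) = i \<and> cell_type u v 2 (z - x)"
  "z \<in> Gam i x \<inter> Gam i y \<longleftrightarrow> rank (z - x) = i \<and> \<not> cell_type u v 1 (z - x) \<and> \<not> cell_type u v 2 (z - x)"
proof -
  have 1: "rank (z - x - outer u v) = i \<longleftrightarrow> cell_type u v 1 (z - x)" if "rank (z - x) = Suc i"
    using rank_minus_outer(2)[of "z - x" u v] that by (simp add: cell_type_def dnp_incid)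
  have 2: "rank (z - x - outer u v) = Suc i \<longleftrightarrow> cell_type u v 2 (z - x)" if "rank (z - x) = i"
    using rank_minus_outer(1)[of "z - x" u v] that by (simp add: cell_type_def)
  have 3: "rank (z - x - outer u v) = i \<longleftrightarrow> \<not> cell_type u v 1 (z - x) \<and> \<not> cell_type u v 2 (z - x)" if "rank (z - x) = i"
    using rank_minus_outer(3)[of "z - x" u v] that by (simp add: cell_type_def dnp_incid) blast
  show "z \<in> Gam (Suc i) x \<inter> Gam i y \<longleftrightarrow> rank (z - x) = Suc i \<and> cell_type u v 1 (z - x)"
    using 1 by (simp add: Gam_x Gam_y) blast
  show "z \<in> Gam i x \<inter> Gam (Suc i) y \<longleftrightarrow> rank (z - x) = i \<and> cell_type u v 2 (z - x)"
    using 2 by (simp add: Gam_x Gam_y) blast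
  show "z \<in> Gam i x \<inter> Gam i y \<longleftrightarrow> rank (z - x) = i \<and> \<not> cell_type u v 1 (z - x) \<and> \<not> cell_type u v 2 (z - x)"
    using 3 by (simp add: Gam_x Gam_y) blast
qed

text \<open>Incidence determines the pair \<open>(mminus, mplus)\<close>, and the four possible
  pairs differ, so each pair determines the incidence type. At full rank type C also has
  \<open>mplus = 0\<close> and is told apart by \<open>mminus\<close>, since then
  \<open>a > 1\<close>. Types C and D differ because \<open>CARD('m) < CARD('n)\<close>.\<close>

lemma diag_cells:
  fixes i :: nat
  defines "a \<equiv> CARD('a) ^ i"
  assumes i: "Suc i \<le> CARD('m)"
  shows "diag_cell x y (Suc i) (2 * a) 0 = {z. rank (z - x) = Suc i \<and> cell_type u v 3 (z - x)}"
    "diag_cell x y (Suc i) (2 * a - 1) 0 = {z. rank (z - x) = Suc i \<and> cell_type u v 4 (z - x)}"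
    "diag_cell x y (Suc i) a (CARD('a) ^ CARD('m) - CARD('a) ^ Suc i) = {z. rank (z - x) = Suc i \<and> cell_type u v 5 (z - x)}"
    "diag_cell x y (Suc i) a (CARD('a) ^ CARD('n) - CARD('a) ^ Suc i) = {z. rank (z - x) = Suc i \<and> cell_type u v 6 (z - x)}"
proof -
  have q1: "CARD('a) > 1" by (rule CARD_field_gt_1)
  have a: "a \<ge> 1" using q1 by (simp add: a_def)
  have lt: "CARD('a) ^ Suc i < CARD('a) ^ CARD('n)"
    using i DM q1 by (intro power_strict_increasing) auto
  have le: "CARD('a) ^ Suc i \<le> CARD('a) ^ CARD('m)"
    using i q1 by (intro power_increasing) auto
  have mn: "CARD('a) ^ CARD('m) < CARD('a) ^ CARD('n)"
    using DM q1 by (intro power_strict_increasing) auto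
  \<comment> \<open>Level 1 is the delicate one: there \<open>2 * a - 1 = a\<close>, and B differs
    from C only because \<open>mplus\<close> is positive for C.\<close>
  have a1: "CARD('a) ^ Suc i < CARD('a) ^ CARD('m)" if "a = 1"
  proof -
    have "i = 0" using that q1 by (simp add: a_def)
    then show ?thesis using D2 q1 by (intro power_strict_increasing) auto
  qed
  have val: "cell_type u v 3 (z - x) \<Longrightarrow> mminus x y (Suc i) z = 2 * a \<and> mplus x y (Suc i) z = 0"
    "cell_type u v 4 (z - x) \<Longrightarrow> mminus x y (Suc i) z = 2 * a - 1 \<and> mplus x y (Suc i) z = 0"
    "cell_type u v 5 (z - x) \<Longrightarrow> mminus x y (Suc i) z = a \<and> mplus x y (Suc i) z = CARD('a) ^ CARD('m) - CARD('a) ^ Suc i"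
    "cell_type u v 6 (z - x) \<Longrightarrow> mminus x y (Suc i) z = a \<and> mplus x y (Suc i) z = CARD('a) ^ CARD('n) - CARD('a) ^ Suc i"
    if r: "rank (z - x) = Suc i" and n: "\<not> cell_type u v 1 (z - x)" "\<not> cell_type u v 2 (z - x)" for z
  proof -
    have n': "\<not> incid u v 1 (z - x)" "\<not> (u \<notin> col (z - x) \<and> v \<notin> row_sp (z - x))"
      using n by (auto simp: cell_type_def)
    note m = mminus_eq[OF r n'(1), folded a_def] mplus_eq[OF r n'(2)]
    show "cell_type u v 3 (z - x) \<Longrightarrow> mminus x y (Suc i) z = 2 * a \<and> mplus x y (Suc i) z = 0"
      using m incidD[of u v 0 "z - x"] by (simp add: cell_type_def)
    show "cell_type u v 4 (z - x) \<Longrightarrow> mminus x y (Suc i) z = 2 * a - 1 \<and> mplus x y (Suc i) z = 0"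
      using m by (simp add: cell_type_def)
    show "cell_type u v 5 (z - x) \<Longrightarrow> mminus x y (Suc i) z = a \<and> mplus x y (Suc i) z = CARD('a) ^ CARD('m) - CARD('a) ^ Suc i"
      using m by (simp add: cell_type_def)
    show "cell_type u v 6 (z - x) \<Longrightarrow> mminus x y (Suc i) z = a \<and> mplus x y (Suc i) z = CARD('a) ^ CARD('n) - CARD('a) ^ Suc i"
      using m by (simp add: cell_type_def)
  qed
  have ex: "cell_type u v 3 w \<or> cell_type u v 4 w \<or> cell_type u v 5 w \<or> cell_type u v 6 w"
    if "\<not> cell_type u v 1 w" "\<not> cell_type u v 2 w" for w
    using that by (auto simp: cell_type_def)
  have excl: "cell_type u v k w \<Longrightarrow> \<not> cell_type u v 1 w \<and> \<not> cell_type u v 2 w" if "k \<in> {3, 4, 5, 6}" for k w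
    using that incid_unique[of u v 0 w 1] incidD[of u v 0 w] incidD[of u v 1 w] by (auto simp: cell_type_def)
  have cell: "diag_cell x y (Suc i) r t = {z. rank (z - x) = Suc i \<and> cell_type u v k (z - x)}"
    if k: "k \<in> {3, 4, 5, 6}"
      and iff: "\<And>z. rank (z - x) = Suc i \<Longrightarrow> \<not> cell_type u v 1 (z - x) \<Longrightarrow> \<not> cell_type u v 2 (z - x) \<Longrightarrow>
        mminus x y (Suc i) z = r \<and> mplus x y (Suc i) z = t \<longleftrightarrow> cell_type u v k (z - x)" for r t k
  proof (rule set_eqI)
    fix z
    show "z \<in> diag_cell x y (Suc i) r t \<longleftrightarrow> z \<in> {z. rank (z - x) = Suc i \<and> cell_type u v k (z - x)}"
      unfolding diag_cell_def mem_Collect_eq Gam_xy(3) using iff[of z] excl[OF k, of "z - x"] by blast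
  qed
  have d: "cell_type u v 3 w \<Longrightarrow> \<not> cell_type u v 4 w \<and> \<not> cell_type u v 5 w \<and> \<not> cell_type u v 6 w"
    "cell_type u v 4 w \<Longrightarrow> \<not> cell_type u v 3 w \<and> \<not> cell_type u v 5 w \<and> \<not> cell_type u v 6 w"
    "cell_type u v 5 w \<Longrightarrow> \<not> cell_type u v 3 w \<and> \<not> cell_type u v 4 w \<and> \<not> cell_type u v 6 w"
    "cell_type u v 6 w \<Longrightarrow> \<not> cell_type u v 3 w \<and> \<not> cell_type u v 4 w \<and> \<not> cell_type u v 5 w" for w
    using incidD[of u v 0 w] by (auto simp: cell_type_def)
  \<comment> \<open>Naming the powers reduces the comparison of the pairs to linear
    arithmetic.\<close>
  define B Pm Qn where "B = CARD('a) ^ Suc i" and "Pm = CARD('a) ^ CARD('m)" and "Qn = CARD('a) ^ CARD('n)"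
  have V: "(cell_type u v 3 (z - x) \<and> \<not> cell_type u v 4 (z - x) \<and> \<not> cell_type u v 5 (z - x) \<and> \<not> cell_type u v 6 (z - x)
        \<and> mminus x y (Suc i) z = 2 * a \<and> mplus x y (Suc i) z = 0)
    \<or> (\<not> cell_type u v 3 (z - x) \<and> cell_type u v 4 (z - x) \<and> \<not> cell_type u v 5 (z - x) \<and> \<not> cell_type u v 6 (z - x)
        \<and> mminus x y (Suc i) z = 2 * a - 1 \<and> mplus x y (Suc i) z = 0)
    \<or> (\<not> cell_type u v 3 (z - x) \<and> \<not> cell_type u v 4 (z - x) \<and> cell_type u v 5 (z - x) \<and> \<not> cell_type u v 6 (z - x)
        \<and> mminus x y (Suc i) z = a \<and> mplus x y (Suc i) z = Pm - B)
    \<or> (\<not> cell_type u v 3 (z - x) \<and> \<not> cell_type u v 4 (z - x) \<and> \<not> cell_type u v 5 (z - x) \<and> cell_type u v 6 (z - x)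
        \<and> mminus x y (Suc i) z = a \<and> mplus x y (Suc i) z = Qn - B)"
    if z: "rank (z - x) = Suc i" "\<not> cell_type u v 1 (z - x)" "\<not> cell_type u v 2 (z - x)" for z
  using ex[OF z(2,3)]
  proof (elim disjE)
    assume c: "cell_type u v 3 (z - x)"
    from c d(1)[OF c] val(1)[OF z c] show ?thesis unfolding B_def Pm_def Qn_def by (intro disjI1 conjI) simp_all
  next
    assume c: "cell_type u v 4 (z - x)"
    from c d(2)[OF c] val(2)[OF z c] show ?thesis unfolding B_def Pm_def Qn_def by (intro disjI2 disjI1 conjI) simp_all
  next
    assume c: "cell_type u v 5 (z - x)"
    from c d(3)[OF c] val(3)[OF z c] show ?thesis unfolding B_def Pm_def Qn_def by (intro disjI2 disjI1 conjI) simp_all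
  next
    assume c: "cell_type u v 6 (z - x)"
    from c d(4)[OF c] val(4)[OF z c] show ?thesis unfolding B_def Pm_def Qn_def by (intro disjI2 conjI) simp_all
  qed
  show "diag_cell x y (Suc i) (2 * a) 0 = {z. rank (z - x) = Suc i \<and> cell_type u v 3 (z - x)}"
  proof (rule cell)
    fix z assume z: "rank (z - x) = Suc i" "\<not> cell_type u v 1 (z - x)" "\<not> cell_type u v 2 (z - x)"
    show "mminus x y (Suc i) z = 2 * a \<and> mplus x y (Suc i) z = 0 \<longleftrightarrow> cell_type u v 3 (z - x)"
      using V[OF z] a a1 lt le mn unfolding B_def[symmetric] Pm_def[symmetric] Qn_def[symmetric]
      by (elim disjE conjE; simp; linarith?)
  qed simp
  show "diag_cell x y (Suc i) (2 * a - 1) 0 = {z. rank (z - x) = Suc i \<and> cell_type u v 4 (z - x)}"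
  proof (rule cell)
    fix z assume z: "rank (z - x) = Suc i" "\<not> cell_type u v 1 (z - x)" "\<not> cell_type u v 2 (z - x)"
    show "mminus x y (Suc i) z = 2 * a - 1 \<and> mplus x y (Suc i) z = 0 \<longleftrightarrow> cell_type u v 4 (z - x)"
      using V[OF z] a a1 lt le mn unfolding B_def[symmetric] Pm_def[symmetric] Qn_def[symmetric]
      by (elim disjE conjE; simp; linarith?)
  qed simp
  show "diag_cell x y (Suc i) a (CARD('a) ^ CARD('m) - CARD('a) ^ Suc i) = {z. rank (z - x) = Suc i \<and> cell_type u v 5 (z - x)}"
  proof (rule cell)
    fix z assume z: "rank (z - x) = Suc i" "\<not> cell_type u v 1 (z - x)" "\<not> cell_type u v 2 (z - x)"
    show "mminus x y (Suc i) z = a \<and> mplus x y (Suc i) z = CARD('a) ^ CARD('m) - CARD('a) ^ Suc i \<longleftrightarrow> cell_type u v 5 (z - x)"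
      using V[OF z] a a1 lt le mn unfolding B_def[symmetric] Pm_def[symmetric] Qn_def[symmetric]
      by (elim disjE conjE; simp; linarith?)
  qed simp
  show "diag_cell x y (Suc i) a (CARD('a) ^ CARD('n) - CARD('a) ^ Suc i) = {z. rank (z - x) = Suc i \<and> cell_type u v 6 (z - x)}"
  proof (rule cell)
    fix z assume z: "rank (z - x) = Suc i" "\<not> cell_type u v 1 (z - x)" "\<not> cell_type u v 2 (z - x)"
    show "mminus x y (Suc i) z = a \<and> mplus x y (Suc i) z = CARD('a) ^ CARD('n) - CARD('a) ^ Suc i \<longleftrightarrow> cell_type u v 6 (z - x)"
      using V[OF z] a a1 lt le mn unfolding B_def[symmetric] Pm_def[symmetric] Qn_def[symmetric]
      by (elim disjE conjE; simp; linarith?)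
  qed simp
qed

text \<open>A nonempty class never falls on a level that the partition omits: only type 2 occurs at
  level 0, type 3 needs level at least 2, and types 2 and 6 need \<open>u\<close> outside the column
  space, hence less than full rank.\<close>

lemma cell_in_partition:
  assumes k: "k \<in> {1..6}" and ne: "rank (z0 - x) = i" "cell_type u v k (z0 - x)"
  shows "{z. rank (z - x) = i \<and> cell_type u v k (z - x)} \<in> xy_partition x y"
proof -
  let ?S = "{z. rank (z - x) = i \<and> cell_type u v k (z - x)}"
  have iD: "i \<le> CARD('m)" using rank_le(1)[of "z0 - x"] ne by simp
  have i0: "i \<noteq> 0" if "k \<noteq> 2"
  proof
    assume "i = 0"
    then have z: "z0 - x = 0" using ne by (simp add: rank_zero_iff)
    have "u \<notin> col (z0 - x)" "v \<notin> row_sp (z0 - x)"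
      using u v by (auto simp: z col_def transpose_def matrix_vector_mult_def vec_eq_iff)
    then show False using ne(2) that k incidD[of u v 0 "z0 - x"] incidD[of u v 1 "z0 - x"] by (auto simp: cell_type_def split: if_splits)
  qed
  consider "k = 1" | "k = 2" | "k = 3" | "k = 4" | "k = 5" | "k = 6" using k by force
  then show ?thesis
  proof cases
    case 1
    then obtain j where j: "i = Suc j" using i0 by (cases i) auto
    have "?S = Gam i x \<inter> Gam (i - 1) y" using Gam_xy(1)[of _ j] by (auto simp: 1 j)
    then show ?thesis using iD j unfolding xy_partition_def Let_def by auto
  next
    case 2
    then have "u \<notin> col (z0 - x)" using ne by (simp add: cell_type_def)
    then have "i \<noteq> CARD('m)" using full_rank_col[of "z0 - x" u] ne(1) by auto
    then have "Suc i \<le> CARD('m)" using iD by simp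
    moreover have "?S = Gam (Suc i - 1) x \<inter> Gam (Suc i) y" using Gam_xy(2)[of _ i] by (auto simp: 2)
    ultimately have "?S \<in> {Gam (i - 1) x \<inter> Gam i y |i. 1 \<le> i \<and> i \<le> CARD('m)}"
      by (intro CollectI exI[of _ "Suc i"]) simp
    then show ?thesis unfolding xy_partition_def Let_def by blast
  next
    case 3
    then obtain j where j: "i = Suc j" using i0 by (cases i) auto
    have "i \<noteq> 1" using rank_one_not_incid_0[OF u v] ne 3 by (auto simp: cell_type_def)
    then have "?S \<in> {diag_cell x y i (2 * CARD('a) ^ (i - 1)) 0 |i. 2 \<le> i \<and> i \<le> CARD('m)}"
      using iD diag_cells(1)[of j] j by (intro CollectI exI[of _ i]) (simp add: 3)
    then show ?thesis unfolding xy_partition_def Let_def by blast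
  next
    case 4
    then obtain j where j: "i = Suc j" using i0 by (cases i) auto
    have "?S \<in> {diag_cell x y i (2 * CARD('a) ^ (i - 1) - 1) 0 |i. 1 \<le> i \<and> i \<le> CARD('m)}"
      using iD diag_cells(2)[of j] j by (intro CollectI exI[of _ i]) (simp add: 4)
    then show ?thesis unfolding xy_partition_def Let_def by blast
  next
    case 5
    then obtain j where j: "i = Suc j" using i0 by (cases i) auto
    have "?S \<in> {diag_cell x y i (CARD('a) ^ (i - 1)) (CARD('a) ^ CARD('m) - CARD('a) ^ i) |i. 1 \<le> i \<and> i \<le> CARD('m)}"
      using iD diag_cells(3)[of j] j by (intro CollectI exI[of _ i]) (simp add: 5)
    then show ?thesis unfolding xy_partition_def Let_def by blast
  next
    case 6
    then obtain j where j: "i = Suc j" using i0 by (cases i) auto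
    have "u \<notin> col (z0 - x)" using ne 6 by (simp add: cell_type_def)
    then have "i \<noteq> CARD('m)" using full_rank_col[of "z0 - x" u] ne(1) by auto
    then have "?S \<in> {diag_cell x y i (CARD('a) ^ (i - 1)) (CARD('a) ^ CARD('n) - CARD('a) ^ i) |i. 1 \<le> i \<and> i \<le> CARD('m) - 1}"
      using iD diag_cells(4)[of j] j by (intro CollectI exI[of _ i]) (simp add: 6)
    then show ?thesis unfolding xy_partition_def Let_def by blast
  qed
qed

lemma char_vec_apply: "char_vec S $ z = of_bool (z \<in> S)"
proof -
  have "char_vec S $ z = (\<Sum>w\<in>S. axis w 1 $ z)" by (simp add: char_vec_def)
  also have "\<dots> = (\<Sum>w\<in>S. if w = z then 1 else 0)" by (intro sum.cong refl) (auto simp: axis_def)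
  finally show ?thesis by simp
qed

lemma char_vec_cell_in_U:
  assumes "k \<in> {1..6}"
  shows "char_vec {z. rank (z - x) = i \<and> cell_type u v k (z - x)} \<in> U_space x y"
proof (cases "\<exists>z0. rank (z0 - x) = i \<and> cell_type u v k (z0 - x)")
  case True
  then show ?thesis unfolding U_space_def
    using cell_in_partition[OF assms] by (blast intro: vec.span_base)
next
  case False
  then have "{z. rank (z - x) = i \<and> cell_type u v k (z - x)} = {}" by blast
  then have "char_vec {z. rank (z - x) = i \<and> cell_type u v k (z - x)} = 0"
    by (simp only: char_vec_def sum.empty)
  then show ?thesis unfolding U_space_def by (simp only: vec.span_zero)
qed

lemma comb_in_U: "bv x (comb u v c0 c1 c2 c3 c4 c5) i \<in> U_space x y"
proof -
  let ?e = "\<lambda>k. char_vec {z. rank (z - x) = i \<and> cell_type u v k (z - x)}"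
  \<comment> \<open>The coefficients are the values of the combination on the six types of
    cells.\<close>
  have "bv x (comb u v c0 c1 c2 c3 c4 c5) i = (c0 + c1 + c2 + c3 + c5) *s ?e 1 + c0 *s ?e 2
     + (c0 + c1 + c2 + c3 + c4) *s ?e 3 + (c0 + c1 + c2 + c3) *s ?e 4 + (c0 + c1) *s ?e 5 + (c0 + c2) *s ?e 6"
    (is "_ = ?r")
  proof (subst vec_eq_iff, rule allI)
    fix z
    show "bv x (comb u v c0 c1 c2 c3 c4 c5) i $ z = ?r $ z"
    proof (cases "rank (z - x) = i")
      case True
      have "incid u v 0 (z - x) \<Longrightarrow> \<not> incid u v 1 (z - x)" using incid_unique[of u v 0 "z - x" 1] by auto
      then show ?thesis using True incidD[of u v 0 "z - x"] incidD[of u v 1 "z - x"]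
        by (cases "u \<in> col (z - x)"; cases "v \<in> row_sp (z - x)"; cases "incid u v 0 (z - x)"; cases "incid u v 1 (z - x)")
          (simp_all add: bv_apply char_vec_apply comb_def fF_def gF_def hF_def phiF_incid cell_type_def)
    qed (simp add: bv_apply char_vec_apply)
  qed
  also have "?r \<in> U_space x y"
    unfolding U_space_def
    by (intro vec.span_add vec.span_scale char_vec_cell_in_U[unfolded U_space_def]) simp_all
  finally show ?thesis .
qed

lemma wfun_in_U: "bv x (wfun q P Q u v k t) i \<in> U_space x y"
  unfolding wfun_def by (auto intro: comb_in_U)

text \<open>Counts the listed cells by family. The opposite inequality comes later from
  \<open>6 * D - 2\<close> independent vectors inside \<open>U_space x y\<close>.\<close>

lemma dim_U_le: "vec.dim (U_space x y) \<le> 6 * CARD('m) - 2"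
proof -
  let ?D = "CARD('m)"
  have c: "finite {f i |i. l \<le> i \<and> i \<le> h}" "card {f i |i. l \<le> i \<and> i \<le> h} \<le> Suc h - l"
    for f :: "nat \<Rightarrow> ('a^'n^'m) set" and l h
  proof -
    have "{f i |i. l \<le> i \<and> i \<le> h} = f ` {l..h}" by auto
    then show "finite {f i |i. l \<le> i \<and> i \<le> h}" "card {f i |i. l \<le> i \<and> i \<le> h} \<le> Suc h - l"
      using card_image_le[of "{l..h}" f] by simp_all
  qed
  have un: "card (A \<union> B) \<le> a + b" if "card A \<le> a" "card B \<le> b" for A B :: "('a^'n^'m) set set" and a b
    using card_Un_le[of A B] that by simp
  have "card (xy_partition x y) \<le> ?D + ?D + (?D - 1) + ?D + ?D + (?D - 1)"
    unfolding xy_partition_def Let_def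
    by (intro un order.trans[OF c(2)]) simp_all
  then have "card (char_vec ` xy_partition x y) \<le> 6 * ?D - 2"
    using card_image_le[of "xy_partition x y" char_vec] D2 by simp
  moreover have "vec.dim (U_space x y) \<le> card (char_vec ` xy_partition x y)"
    unfolding U_space_def vec.dim_span by (rule vec.dim_le_card') simp
  ultimately show ?thesis by simp
qed

end

subsection \<open>Modules with a graded basis of eigenvectors\<close>

lemma herm_add_right: "herm a (b + c) = herm a b + herm a c"
  by (simp add: herm_def algebra_simps sum.distrib)

lemma herm_scale_right: "herm a (k *s b) = k * herm a b"
  by (simp add: herm_def sum_distrib_left mult_ac)

lemma herm_scale_left: "herm (k *s a) b = cnj k * herm a b"
  by (simp add: herm_def sum_distrib_left mult_ac)

lemma herm_zero [simp]: "herm a 0 = 0" "herm 0 a = 0"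
  by (simp_all add: herm_def)

lemma herm_sum_right: "herm a (\<Sum>i\<in>I. f i) = (\<Sum>i\<in>I. herm a (f i))"
  by (induction I rule: infinite_finite_induct) (simp_all add: herm_add_right)

lemma herm_cnj: "herm b a = cnj (herm a b)"
  by (simp add: herm_def mult.commute)

lemma herm_self_eq_0: "herm a a = 0 \<longleftrightarrow> a = 0"
proof
  assume h: "herm a a = 0"
  have "herm a a = of_real (\<Sum>z\<in>UNIV. (cmod (a $ z))^2)"
    unfolding herm_def of_real_sum complex_norm_square
    by (intro sum.cong refl) (rule mult.commute)
  then have "(\<Sum>z\<in>UNIV. (cmod (a $ z))^2) = 0"
    using h by (metis of_real_eq_0_iff)
  then have "\<forall>z. a $ z = 0"
    by (subst (asm) sum_nonneg_eq_0_iff) simp_all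
  then show "a = 0" by (simp add: vec_eq_iff)
qed simp

lemma bf_adj_commute: "bf_adj z y = bf_adj y z" for y z :: "'a::{finite,field}^'n^'m"
  by (simp add: bf_adj_def rank_diff_commute)

lemma herm_Fop: "herm (Fop x *v a) b = herm a (Fop x *v b)"
  for x :: "'a::{finite,field}^'n^'m"
proof -
  have "herm (Fop x *v a) b = (\<Sum>z\<in>UNIV. \<Sum>y\<in>UNIV. of_bool (bf_adj z y) * (of_bool (bf_dist x y = bf_dist x z) * (cnj (a $ y) * b $ z)))"
    unfolding herm_def Fop_apply cnj_sum sum_distrib_right by (intro sum.cong refl) simp
  also have "\<dots> = (\<Sum>y\<in>UNIV. \<Sum>z\<in>UNIV. of_bool (bf_adj z y) * (of_bool (bf_dist x y = bf_dist x z) * (cnj (a $ y) * b $ z)))"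
    by (rule sum.swap)
  also have "\<dots> = herm a (Fop x *v b)"
    unfolding herm_def Fop_apply sum_distrib_left by (intro sum.cong refl) (auto simp: bf_adj_commute)
  finally show ?thesis .
qed

lemma T_alg_sum: "(\<And>i. i \<in> I \<Longrightarrow> A i \<in> T_alg x) \<Longrightarrow> (\<Sum>i\<in>I. A i) \<in> T_alg x"
proof (induction I rule: infinite_finite_induct)
  case (insert i I)
  then show ?case unfolding T_alg_def by (auto intro: generated_algebra.add)
qed (use generated_algebra.scalar[of 0] in \<open>simp_all add: T_alg_def mat_0\<close>)

lemma ops_in_T_alg:
  fixes x :: "'a::{finite,field}^'n^'m"
  shows "i \<le> CARD('m) \<Longrightarrow> Es x i \<in> T_alg x" "Lop x \<in> T_alg x" "Fop x \<in> T_alg x" "Rop x \<in> T_alg x"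
proof -
  have Es: "Es x i \<in> T_alg x" if "i \<le> CARD('m)" for i
    unfolding T_alg_def using that by (intro generated_algebra.gen) auto
  have A: "Adj \<in> T_alg x" unfolding T_alg_def by (intro generated_algebra.gen) auto
  have m: "Es x i ** Adj ** Es x j \<in> T_alg x" if "i \<le> CARD('m)" "j \<le> CARD('m)" for i j
    using Es[OF that(1)] Es[OF that(2)] A unfolding T_alg_def by (intro generated_algebra.mult)
  show "i \<le> CARD('m) \<Longrightarrow> Es x i \<in> T_alg x" by (rule Es)
  show "Lop x \<in> T_alg x" unfolding Lop_def by (intro T_alg_sum m) auto
  show "Fop x \<in> T_alg x" unfolding Fop_def by (intro T_alg_sum m) auto
  show "Rop x \<in> T_alg x" unfolding Rop_def
  proof (intro T_alg_sum m)
    fix i assume "i \<in> {0..CARD('m) - 1}"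
    moreover have "CARD('m) > 0" by simp
    ultimately show "i + 1 \<le> CARD('m)" "i \<le> CARD('m)" by (simp_all, linarith+)
  qed
qed

lemma mat_mult_vector: "mat c *v g = c *s g" for g :: "complex^'k::finite"
proof -
  have "(mat c *v g) $ z = (c *s g) $ z" for z
  proof -
    have "(mat c *v g) $ z = (\<Sum>y\<in>UNIV. mat c $ z $ y * g $ y)"
      by (simp add: matrix_vector_mult_def)
    also have "\<dots> = (\<Sum>y\<in>UNIV. if y = z then c * g $ z else 0)"
      by (intro sum.cong refl) (auto simp: mat_def)
    finally show ?thesis by simp
  qed
  then show ?thesis by (simp only: vec_eq_iff) simp
qed

lemma T_moduleI:
  fixes x :: "'a::{finite,field}^'n^'m"
  assumes sub: "vec.subspace W" and A: "\<And>w. w \<in> W \<Longrightarrow> Adj *v w \<in> W"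
    and E: "\<And>i w. w \<in> W \<Longrightarrow> Es x i *v w \<in> W"
  shows "T_module x W"
proof -
  have "\<forall>w\<in>W. M *v w \<in> W" if "M \<in> generated_algebra (insert Adj (Es x ` {0..CARD('m)}))" for M
    using that
  proof induction
    case (gen M)
    then show ?case using A E by auto
  next
    case (scalar c)
    show ?case unfolding mat_mult_vector using vec.subspace_scale[OF sub] by simp
  next
    case (add M M')
    then show ?case by (simp add: matrix_vector_mult_add_rdistrib vec.subspace_add[OF sub])
  next
    case (mult M M')
    then show ?case by (simp add: matrix_vector_mul_assoc[symmetric])
  qed
  then show ?thesis using sub by (simp add: T_module_def T_alg_def)
qed

lemma span_matrix_closed:
  fixes A :: "complex^'k^'k"
  assumes "\<And>k. k \<in> J \<Longrightarrow> A *v w k \<in> vec.span (w ` J)" and v: "v \<in> vec.span (w ` J)"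
  shows "A *v v \<in> vec.span (w ` J)"
  using v
proof (induction rule: vec.span_induct_alt)
  case base
  show ?case by (simp only: matrix_vector_mult_0_right vec.span_zero)
next
  case (step c b y)
  then have "A *v b \<in> vec.span (w ` J)" using assms(1) by blast
  then show ?case
    unfolding matrix_vector_right_distrib vector_scalar_commute
    by (intro vec.span_add vec.span_scale step.IH)
qed

lemma Es_sum: "(\<Sum>i = 0..CARD('m). Es x i *v w) = w" for x :: "'a::{finite,field}^'n^'m"
proof -
  have "(\<Sum>i = 0..CARD('m). Es x i *v w) $ z = w $ z" for z
  proof -
    have "(\<Sum>i = 0..CARD('m). Es x i *v w) $ z = (\<Sum>i = 0..CARD('m). if i = bf_dist x z then w $ z else 0)"
      unfolding sum_component Es_apply by (intro sum.cong refl) auto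
    then show ?thesis using bf_dist_le[of x z] by simp
  qed
  then show ?thesis by (simp add: vec_eq_iff)
qed

text \<open>Isolates what the module theory requires of the six families: common eigenvectors of all
  \<open>Es x j\<close> and of \<open>Fop x\<close>, told apart by level and eigenvalue.
  Orthogonality, dimensions and the structure of submodules follow from this alone, without the
  explicit formulas.\<close>

locale graded_family =
  fixes x :: "'a::{finite,field}^'n^'m" and I :: "'i set" and w :: "'i \<Rightarrow> complex^('a^'n^'m)"
    and d :: "'i \<Rightarrow> nat" and e :: "'i \<Rightarrow> complex"
  assumes fin: "finite I"
    and nonzero: "k \<in> I \<Longrightarrow> w k \<noteq> 0"
    and level: "k \<in> I \<Longrightarrow> Es x j *v w k = (if j = d k then w k else 0)"
    and level_le: "k \<in> I \<Longrightarrow> d k \<le> CARD('m)"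
    and eigen: "k \<in> I \<Longrightarrow> Fop x *v w k = e k *s w k"
    and real: "k \<in> I \<Longrightarrow> cnj (e k) = e k"
    and separated: "k \<in> I \<Longrightarrow> l \<in> I \<Longrightarrow> k \<noteq> l \<Longrightarrow> d k = d l \<Longrightarrow> e k \<noteq> e l"
begin

text \<open>Vectors on different levels have disjoint supports. On a common level the Hermitian
  \<open>Fop x\<close> has distinct real eigenvalues on them.\<close>

lemma orthogonal:
  assumes "k \<in> I" "l \<in> I" "k \<noteq> l"
  shows "herm (w k) (w l) = 0"
proof (cases "d k = d l")
  case True
  have "e k * herm (w k) (w l) = herm (Fop x *v w k) (w l)"
    by (simp add: eigen assms herm_scale_left real)
  also have "\<dots> = e l * herm (w k) (w l)"
    unfolding herm_Fop[of x "w k" "w l"] eigen[OF assms(2)] herm_scale_right ..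
  finally show ?thesis using separated[OF assms True] by simp
next
  case False
  have "cnj (w k $ z) * w l $ z = 0" for z
  proof -
    have "w k $ z = of_bool (bf_dist x z = d k) * w k $ z" "w l $ z = of_bool (bf_dist x z = d l) * w l $ z"
      unfolding Es_apply[symmetric] by (simp_all add: level assms)
    then show ?thesis using False by (cases "bf_dist x z = d k") auto
  qed
  then show ?thesis unfolding herm_def by (intro sum.neutral ballI)
qed

lemma inj: "J \<subseteq> I \<Longrightarrow> inj_on w J"
proof (rule inj_onI, rule ccontr)
  fix k l assume J: "J \<subseteq> I" "k \<in> J" "l \<in> J" "w k = w l" "k \<noteq> l"
  then have "k \<in> I" "l \<in> I" by auto
  then have "herm (w k) (w k) = 0" using orthogonal[of k l] J by simp
  then show False using nonzero \<open>k \<in> I\<close> by (simp add: herm_self_eq_0)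
qed

lemma sum_image: "J \<subseteq> I \<Longrightarrow> (\<Sum>a\<in>w ` J. c a *s a) = (\<Sum>k\<in>J. c (w k) *s w k)"
proof -
  assume "J \<subseteq> I"
  from sum.reindex[OF inj[OF this], of "\<lambda>a. c a *s a"] show ?thesis by (simp only: o_def)
qed

lemma span_eq:
  assumes "J \<subseteq> I"
  shows "v \<in> vec.span (w ` J) \<longleftrightarrow> (\<exists>c. v = (\<Sum>k\<in>J. c k *s w k))"
proof
  have fJ: "finite J" using assms fin finite_subset by blast
  assume "v \<in> vec.span (w ` J)"
  then obtain c where "v = (\<Sum>a\<in>w ` J. c a *s a)"
    using vec.span_finite[of "w ` J"] fJ by auto
  also have "\<dots> = (\<Sum>k\<in>J. c (w k) *s w k)"
    by (rule sum_image[OF assms])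
  finally show "\<exists>c. v = (\<Sum>k\<in>J. c k *s w k)" by (intro exI[of _ "\<lambda>k. c (w k)"])
next
  assume "\<exists>c. v = (\<Sum>k\<in>J. c k *s w k)"
  then obtain c where "v = (\<Sum>k\<in>J. c k *s w k)" by blast
  then show "v \<in> vec.span (w ` J)"
    by (simp only:) (intro vec.span_sum vec.span_scale vec.span_base imageI)
qed

lemma herm_expansion:
  assumes "J \<subseteq> I" "k \<in> J"
  shows "herm (w k) (\<Sum>l\<in>J. c l *s w l) = c k * herm (w k) (w k)"
proof -
  have fJ: "finite J" using assms fin finite_subset by blast
  have "herm (w k) (\<Sum>l\<in>J. c l *s w l) = (\<Sum>l\<in>J. if l = k then c k * herm (w k) (w k) else 0)"
    unfolding herm_sum_right herm_scale_right
    by (intro sum.cong refl) (use assms orthogonal[of k] in auto)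
  then show ?thesis using assms fJ by simp
qed

lemma independent:
  assumes "J \<subseteq> I"
  shows "vec.independent (w ` J)"
proof -
  have fJ: "finite J" using assms fin finite_subset by blast
  have "c a = 0" if s: "(\<Sum>a\<in>w ` J. c a *s a) = 0" and "a \<in> w ` J" for c a
  proof -
    obtain k where k: "k \<in> J" "a = w k" using \<open>a \<in> w ` J\<close> by blast
    have "(\<Sum>k\<in>J. c (w k) *s w k) = 0"
      using s unfolding sum_image[OF assms] .
    then have "c (w k) * herm (w k) (w k) = 0"
      using herm_expansion[OF assms k(1), of "\<lambda>k. c (w k)"] by simp
    then show ?thesis using k assms nonzero by (auto simp: herm_self_eq_0)
  qed
  note zero = this
  show ?thesis
  proof
    assume "vec.dependent (w ` J)"
    then obtain c a where "(\<Sum>a\<in>w ` J. c a *s a) = 0" "a \<in> w ` J" "c a \<noteq> 0"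
      unfolding vec.dependent_finite[OF finite_imageI[OF fJ]] by (elim exE conjE bexE)
    then show False using zero[of c a] by simp
  qed
qed

lemma spans_orthogonal:
  assumes "J \<subseteq> I" "J' \<subseteq> I" "J \<inter> J' = {}" "a \<in> vec.span (w ` J)" "b \<in> vec.span (w ` J')"
  shows "herm a b = 0"
proof -
  obtain c c' where a: "a = (\<Sum>k\<in>J. c k *s w k)" and b: "b = (\<Sum>k\<in>J'. c' k *s w k)"
    using assms span_eq by meson
  have 1: "herm (w l) a = 0" if "l \<in> J'" for l
    unfolding a herm_sum_right herm_scale_right
    by (intro sum.neutral ballI) (use orthogonal[of l] that assms in auto)
  have "herm (w l) a = 0 \<Longrightarrow> herm a (w l) = 0" for l
    using herm_cnj[of a "w l"] by simp
  then show ?thesis unfolding b herm_sum_right herm_scale_right using 1 by (intro sum.neutral) auto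
qed

text \<open>One unwanted term \<open>l\<close> is removed at a time, by projecting to the level of
  \<open>k\<close> if the levels differ and by applying \<open>Fop x - e l\<close> otherwise. Both
  operators act diagonally and keep the coefficient of \<open>k\<close> nonzero.\<close>

lemma separate:
  assumes W: "T_module x W"
  shows "finite J \<Longrightarrow> J \<subseteq> I \<Longrightarrow> (\<Sum>k\<in>J. c k *s w k) \<in> W \<Longrightarrow> k \<in> J \<Longrightarrow> c k \<noteq> 0 \<Longrightarrow> w k \<in> W"
proof (induction "card J" arbitrary: J c rule: less_induct)
  case less
  have sub: "vec.subspace W" using W by (simp add: T_module_def)
  have E: "Es x j *v v \<in> W" if "v \<in> W" "j \<le> CARD('m)" for v j
    using W that ops_in_T_alg(1) unfolding T_module_def by blast
  have F: "Fop x *v v \<in> W" if "v \<in> W" for v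
    using W that ops_in_T_alg(3) unfolding T_module_def by blast
  show ?case
  proof (cases "J = {k}")
    case True
    then have "c k *s w k \<in> W" using less.prems by simp
    then have "inverse (c k) *s (c k *s w k) \<in> W" by (rule vec.subspace_scale[OF sub])
    then show ?thesis using less.prems by (simp add: vector_smult_assoc)
  next
    case False
    then obtain l where l: "l \<in> J" "l \<noteq> k" using less.prems by blast
    have J: "k \<in> I" "l \<in> I" using less.prems l by auto
    have "\<exists>c'. (\<Sum>j\<in>J. (c' j * c j) *s w j) \<in> W \<and> c' l = 0 \<and> c' k \<noteq> 0"
    proof (cases "d l = d k")
      case False
      have "Es x (d k) *v (\<Sum>j\<in>J. c j *s w j) = (\<Sum>j\<in>J. (of_bool (d j = d k) * c j) *s w j)"
        unfolding vec.linear_sum[OF matrix_vector_mul_linear_gen] vector_scalar_commute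
        by (intro sum.cong refl) (use less.prems in \<open>auto simp: level\<close>)
      then show ?thesis
        using E[OF less.prems(3) level_le[OF J(1)]] False by (intro exI[of _ "\<lambda>j. of_bool (d j = d k)"]) simp
    next
      case True
      have "Fop x *v (\<Sum>j\<in>J. c j *s w j) - e l *s (\<Sum>j\<in>J. c j *s w j) = (\<Sum>j\<in>J. ((e j - e l) * c j) *s w j)"
        unfolding vec.linear_sum[OF matrix_vector_mul_linear_gen] vector_scalar_commute vec.scale_sum_right sum_subtractf[symmetric]
        by (intro sum.cong refl) (use less.prems in \<open>auto simp: eigen vec_eq_iff algebra_simps\<close>)
      moreover have "Fop x *v (\<Sum>j\<in>J. c j *s w j) - e l *s (\<Sum>j\<in>J. c j *s w j) \<in> W"
        by (intro vec.subspace_diff[OF sub] vec.subspace_scale[OF sub] F less.prems)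
      moreover have "e k - e l \<noteq> 0" using separated[OF J] l True by auto
      ultimately show ?thesis by (intro exI[of _ "\<lambda>j. e j - e l"]) simp
    qed
    then obtain c' where c': "(\<Sum>j\<in>J. (c' j * c j) *s w j) \<in> W" "c' l = 0" "c' k \<noteq> 0" by blast
    have "(\<Sum>j\<in>J. (c' j * c j) *s w j) = (\<Sum>j\<in>J - {l}. (c' j * c j) *s w j)"
      using sum.remove[OF less.prems(1) l(1), of "\<lambda>j. (c' j * c j) *s w j"] c'(2) by simp
    then show ?thesis
      using c' less.prems l card_Diff1_less[OF less.prems(1) l(1)]
      by (intro less.hyps[of "J - {l}" "\<lambda>j. c' j * c j"]) auto
  qed
qed

lemma T_module_span:
  assumes "J \<subseteq> I"
    and "\<And>k. k \<in> J \<Longrightarrow> Lop x *v w k \<in> vec.span (w ` J)"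
    and "\<And>k. k \<in> J \<Longrightarrow> Rop x *v w k \<in> vec.span (w ` J)"
  shows "T_module x (vec.span (w ` J))"
proof (rule T_moduleI)
  show "vec.subspace (vec.span (w ` J))" by (rule vec.subspace_span)
  fix v assume v: "v \<in> vec.span (w ` J)"
  have mem: "w k \<in> vec.span (w ` J)" if "k \<in> J" for k
    using that by (intro vec.span_base imageI)
  have "Fop x *v w k \<in> vec.span (w ` J)" if k: "k \<in> J" for k
  proof -
    have "k \<in> I" using k assms(1) by blast
    from vec.span_scale[OF mem[OF k], of "e k"] show ?thesis unfolding eigen[OF \<open>k \<in> I\<close>] .
  qed
  then show "Adj *v v \<in> vec.span (w ` J)"
    unfolding Adj_eq_LFR[of v x] by (intro vec.span_add span_matrix_closed[OF _ v] assms)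
  show "Es x i *v v \<in> vec.span (w ` J)" for i
  proof (rule span_matrix_closed[OF _ v])
    fix k assume k: "k \<in> J"
    then have "k \<in> I" using assms(1) by blast
    then show "Es x i *v w k \<in> vec.span (w ` J)"
      using level[of k i] mem[OF k] by (simp add: vec.span_zero)
  qed
qed

text \<open>By \<open>separate\<close> a nonzero submodule contains some basis vector, so it is
  enough that each basis vector generates all the others.\<close>

lemma irreducible_span:
  assumes J: "J \<subseteq> I" "J \<noteq> {}" and T: "T_module x (vec.span (w ` J))"
    and connected: "\<And>W k l. T_module x W \<Longrightarrow> k \<in> J \<Longrightarrow> w k \<in> W \<Longrightarrow> l \<in> J \<Longrightarrow> w l \<in> W"
  shows "irreducible_T_module x (vec.span (w ` J))"
  unfolding irreducible_T_module_def
proof (intro conjI allI impI T)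
  obtain k where k: "k \<in> J" using J by blast
  then have "w k \<in> vec.span (w ` J)" "w k \<noteq> 0" using nonzero J by (auto intro: vec.span_base)
  then show "vec.span (w ` J) \<noteq> {0}" by blast
  fix W' assume W': "T_module x W' \<and> W' \<subseteq> vec.span (w ` J)"
  then have sub: "vec.subspace W'" by (simp add: T_module_def)
  show "W' = {0} \<or> W' = vec.span (w ` J)"
  proof (cases "W' = {0}")
    case False
    moreover have "0 \<in> W'" using vec.subspace_0[OF sub] .
    ultimately obtain v where v: "v \<in> W'" "v \<noteq> 0" by blast
    then obtain c where c: "v = (\<Sum>k\<in>J. c k *s w k)" using W' span_eq[OF J(1)] by blast
    have fJ: "finite J" using J fin finite_subset by blast
    have "\<exists>k\<in>J. c k \<noteq> 0"
    proof (rule ccontr)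
      assume "\<not> (\<exists>k\<in>J. c k \<noteq> 0)"
      then have "v = 0" unfolding c by (intro sum.neutral) simp
      then show False using v by simp
    qed
    then obtain k where k: "k \<in> J" "c k \<noteq> 0" by blast
    have "(\<Sum>k\<in>J. c k *s w k) \<in> W'" using v(1) c by simp
    then have "w k \<in> W'"
      using separate[where W = W' and J = J and c = c and k = k] W' fJ J(1) k by simp
    then have "w ` J \<subseteq> W'" using connected[of W' k] W' k by blast
    then have "vec.span (w ` J) \<subseteq> W'" using sub by (rule vec.span_minimal)
    then show ?thesis using W' by blast
  qed simp
qed

lemma Es_image_span:
  assumes "J \<subseteq> I"
  shows "Es_image x i (vec.span (w ` J)) = vec.span (w ` {k \<in> J. d k = i})"
proof -
  have "Es_image x i (vec.span (w ` J)) = vec.span ((\<lambda>v. Es x i *v v) ` w ` J)"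
    unfolding Es_image_def by (rule vec.linear_span_image[OF matrix_vector_mul_linear_gen, symmetric])
  also have "\<dots> = vec.span (w ` {k \<in> J. d k = i})"
  proof (rule antisym; rule vec.span_minimal[OF _ vec.subspace_span])
    show "(\<lambda>v. Es x i *v v) ` w ` J \<subseteq> vec.span (w ` {k \<in> J. d k = i})"
    proof (rule subsetI)
      fix a assume "a \<in> (\<lambda>v. Es x i *v v) ` w ` J"
      then obtain k where k: "k \<in> J" "a = Es x i *v w k" by blast
      then have "k \<in> I" using assms by blast
      then have a: "a = (if i = d k then w k else 0)" using level[of k i] k(2) by simp
      show "a \<in> vec.span (w ` {k \<in> J. d k = i})"
      proof (cases "i = d k")
        case True
        then show ?thesis using a k(1) by (intro vec.span_base) simp
      qed (simp add: a vec.span_zero)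
    qed
    have "w k \<in> (\<lambda>v. Es x i *v v) ` w ` J" if k: "k \<in> J" "d k = i" for k
    proof -
      have "k \<in> I" using k assms by blast
      then have "w k = Es x i *v w k" using level[of k i] k(2) by simp
      then show ?thesis using k(1) by blast
    qed
    then have "w ` {k \<in> J. d k = i} \<subseteq> (\<lambda>v. Es x i *v v) ` w ` J" by blast
    then show "w ` {k \<in> J. d k = i} \<subseteq> vec.span ((\<lambda>v. Es x i *v v) ` w ` J)"
      using vec.span_superset by blast
  qed
  finally show ?thesis .
qed

lemma dim_Es_image_span: "J \<subseteq> I \<Longrightarrow> vec.dim (Es_image x i (vec.span (w ` J))) = card {k \<in> J. d k = i}"
proof -
  assume J: "J \<subseteq> I"
  then have J': "{k \<in> J. d k = i} \<subseteq> I" by blast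
  show ?thesis
    unfolding Es_image_span[OF J] vec.dim_span vec.dim_eq_card_independent[OF independent[OF J']]
    by (rule card_image[OF inj[OF J']])
qed

lemma module_support_span: "J \<subseteq> I \<Longrightarrow> module_support x (vec.span (w ` J)) = d ` J"
proof -
  assume J: "J \<subseteq> I"
  have "Es_image x i (vec.span (w ` J)) \<noteq> {0} \<longleftrightarrow> i \<in> d ` J" for i
  proof
    assume "i \<in> d ` J"
    then obtain k where k: "k \<in> J" "d k = i" by blast
    then have "w k \<in> Es_image x i (vec.span (w ` J))"
      unfolding Es_image_span[OF J] by (intro vec.span_base) blast
    then show "Es_image x i (vec.span (w ` J)) \<noteq> {0}" using nonzero[of k] k J by auto
  next
    assume ne: "Es_image x i (vec.span (w ` J)) \<noteq> {0}"
    show "i \<in> d ` J"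
    proof (rule ccontr)
      assume "i \<notin> d ` J"
      then have "w ` {k \<in> J. d k = i} = {}" by blast
      then show False using ne unfolding Es_image_span[OF J] by (simp only: vec.span_empty simp_thms)
    qed
  qed
  then show ?thesis unfolding module_support_def using J level_le by auto
qed

lemma basis_span: "J \<subseteq> I \<Longrightarrow> is_basis_family w J (vec.span (w ` J))"
  by (simp add: is_basis_family_def inj independent)

lemma span_eq_space:
  assumes "w ` I \<subseteq> U" "vec.subspace U" "vec.dim U \<le> card I"
  shows "vec.span (w ` I) = U"
proof (rule antisym)
  show "vec.span (w ` I) \<subseteq> U" using assms by (intro vec.span_minimal)
  have "card (w ` I) = card I" by (rule card_image[OF inj]) simp
  then show "U \<subseteq> vec.span (w ` I)"
    using assms by (intro vec.card_ge_dim_independent independent) auto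
qed

lemma direct_sum:
  assumes K: "finite K" and J: "I = (\<Union>k\<in>K. J k)" "\<And>k l. k \<in> K \<Longrightarrow> l \<in> K \<Longrightarrow> k \<noteq> l \<Longrightarrow> J k \<inter> J l = {}"
  shows "orthogonal_direct_sum (vec.span (w ` I)) K (\<lambda>k. vec.span (w ` J k))"
proof -
  have JI: "J k \<subseteq> I" if "k \<in> K" for k using that J by blast
  have orth: "herm a b = 0" if "k \<in> K" "l \<in> K" "k \<noteq> l" "a \<in> vec.span (w ` J k)" "b \<in> vec.span (w ` J l)" for k l a b
    using spans_orthogonal[OF JI JI J(2)] that by blast
  have "vec.span (w ` I) = {\<Sum>k\<in>K. f k |f. \<forall>k\<in>K. f k \<in> vec.span (w ` J k)}"
  proof (intro equalityI subsetI)
    fix v assume "v \<in> vec.span (w ` I)"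
    then obtain c where "v = (\<Sum>k\<in>I. c k *s w k)" using span_eq by blast
    also have "\<dots> = (\<Sum>k\<in>K. \<Sum>j\<in>J k. c j *s w j)"
      unfolding J(1)
    proof (rule sum.UNION_disjoint[OF K])
      show "\<forall>i\<in>K. finite (J i)" using JI fin finite_subset by blast
    qed (use J(2) in blast)
    finally show "v \<in> {\<Sum>k\<in>K. f k |f. \<forall>k\<in>K. f k \<in> vec.span (w ` J k)}"
      using span_eq[OF JI] by blast
  next
    fix v assume "v \<in> {\<Sum>k\<in>K. f k |f. \<forall>k\<in>K. f k \<in> vec.span (w ` J k)}"
    then obtain f where f: "v = (\<Sum>k\<in>K. f k)" "\<forall>k\<in>K. f k \<in> vec.span (w ` J k)" by blast
    have "vec.span (w ` J k) \<subseteq> vec.span (w ` I)" if "k \<in> K" for k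
      by (intro vec.span_mono image_mono JI that)
    then show "v \<in> vec.span (w ` I)" unfolding f(1) using f(2) by (intro vec.span_sum) blast
  qed
  moreover have "f k = 0" if f: "\<forall>k\<in>K. f k \<in> vec.span (w ` J k)" "(\<Sum>k\<in>K. f k) = 0" "k \<in> K" for f k
  proof -
    have "herm (f k) (\<Sum>l\<in>K. f l) = (\<Sum>l\<in>K. if l = k then herm (f k) (f k) else 0)"
      unfolding herm_sum_right by (intro sum.cong refl) (use f orth[of k] in auto)
    then have "herm (f k) (f k) = 0" using f K by simp
    then show ?thesis by (simp add: herm_self_eq_0)
  qed
  ultimately show ?thesis unfolding orthogonal_direct_sum_def using orth by blast
qed

end

subsection \<open>The five modules\<close>

locale bf_modules = adjacent_vertices x y u v
  for x y :: "'a::{finite,field}^'n^'m" and u :: "'a^'m" and v :: "'a^'n" +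
  fixes q :: complex and D N :: nat
  assumes q: "q = of_nat CARD('a)" and D: "CARD('m) = D" and cols: "CARD('n) = N - D"
    and N: "N > 2 * D" and D3: "D \<ge> 3" and q2: "q \<noteq> 2"
begin

abbreviation "P \<equiv> q ^ D"

abbreviation "Q \<equiv> q ^ (N - D)"

text \<open>Defined for every level \<open>i\<close>. For \<open>k\<close> from 1 to 6 the vectors
  outside the proper range are 0 (see \<open>w_out\<close>), so the recurrences already contain the
  boundary formulas.\<close>

definition "w k i = bv x (wfun q P Q u v k (q ^ i)) i"

definition "ev k i = anum q D N i - q ^ (i - 1) * edev q P Q k (q ^ i)"

lemma pair': "rank z = i \<Longrightarrow> rank_data_pair z q P Q (q ^ i) u v" for z :: "'a^'n^'m"
  using pair[of z] by (simp add: q D cols)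

lemma q_nz: "q \<noteq> 0" "q \<noteq> 1" "q - 1 \<noteq> 0"
  using rank_data.nz[OF rank_data_pair.axioms(1)[OF pair'[OF refl, of 0]]] by blast+

lemma q_real: "q = of_real (Re q)" "Re q \<ge> 3"
proof -
  have "CARD('a) \<noteq> 2" using q q2 by auto
  then have "CARD('a) \<ge> 3" using CARD_field_gt_1[where 'a = 'a] by simp
  then show "q = of_real (Re q)" "Re q \<ge> 3" by (simp_all add: q)
qed

lemma q_power_eq: "q ^ i = q ^ j \<longleftrightarrow> i = j"
proof -
  have "q ^ i = of_nat (CARD('a) ^ i)" for i by (simp add: q)
  then show ?thesis
    using CARD_field_gt_1[where 'a = 'a] by (simp only: of_nat_eq_iff power_inject_exp)
qed

lemma q_power_1: "q ^ i = 1 \<longleftrightarrow> i = 0"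
  using q_power_eq[of i 0] by simp

lemma q_power_div: "q ^ Suc i / q = q ^ i" "q ^ Suc (Suc i) / q^2 = q ^ i"
  using q_nz by (simp_all add: power2_eq_square)

lemma L_step:
  assumes "\<And>z :: 'a^'n^'m. rank_data_pair z q P Q (q ^ i) u v \<Longrightarrow> upS z \<Phi> = c * \<Psi> z - c' * \<Psi>' z"
  shows "Lop x *v bv x \<Phi> (Suc i) = (c / (q - 1)) *s bv x \<Psi> i - (c' / (q - 1)) *s bv x \<Psi>' i"
  unfolding bv_ops(1) bv_lin[symmetric] q[symmetric]
  by (rule bv_cong) (simp add: assms[OF pair'] diff_divide_distrib)

lemma R_step:
  assumes "\<And>z :: 'a^'n^'m. rank_data_pair z q P Q (q ^ Suc i) u v \<Longrightarrow> dnS z \<Phi> = c * \<Psi> z - c' * \<Psi>' z"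
  shows "Rop x *v bv x \<Phi> i = (c / (q - 1)) *s bv x \<Psi> (Suc i) - (c' / (q - 1)) *s bv x \<Psi>' (Suc i)"
  unfolding bv_ops(3) bv_lin[symmetric] q[symmetric]
  by (rule bv_cong) (simp only: assms[OF pair'] diff_divide_distrib times_divide_eq_left)

lemma L_step1:
  assumes "\<And>z :: 'a^'n^'m. rank_data_pair z q P Q (q ^ i) u v \<Longrightarrow> upS z \<Phi> = c * \<Psi> z"
  shows "Lop x *v bv x \<Phi> (Suc i) = (c / (q - 1)) *s bv x \<Psi> i"
  using L_step[of i \<Phi> c \<Psi> 0] assms by simp

lemma R_step1:
  assumes "\<And>z :: 'a^'n^'m. rank_data_pair z q P Q (q ^ Suc i) u v \<Longrightarrow> dnS z \<Phi> = c * \<Psi> z"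
  shows "Rop x *v bv x \<Phi> i = (c / (q - 1)) *s bv x \<Psi> (Suc i)"
  using R_step[of i \<Phi> c \<Psi> 0] assms by simp

lemma F_step:
  assumes "\<And>z :: 'a^'n^'m. rank_data_pair z q P Q (q ^ i) u v \<Longrightarrow> smS z \<Phi> = c * \<Psi> z"
  shows "Fop x *v bv x \<Phi> i = (c / (q - 1)) *s bv x \<Psi> i"
  unfolding bv_ops(4) bv_lin[symmetric] q[symmetric] by (rule bv_cong) (simp add: assms[OF pair'])

lemma L_w:
  "Lop x *v w 1 (Suc i) = ((P - q ^ i) * (Q - q ^ i) / (q - 1)) *s w 1 i"
  "Lop x *v w 2 (Suc i) = ((P - q ^ Suc i) * (Q - q ^ i) / (q * (q - 1))) *s w 2 i"
  "Lop x *v w 3 (Suc i) = ((P - q ^ i) * (Q - q ^ Suc i) / (q * (q - 1))) *s w 3 i"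
  "Lop x *v w 4 (Suc i) = ((P - q ^ i) * (Q - q ^ i) / (q * (q - 1))) *s w 4 i"
  "Lop x *v w 5 (Suc i) = ((P - q ^ Suc i) * (Q - q ^ Suc i) / (q - 1)) *s w 5 i"
  unfolding w_def power_Suc
  using L_step1[OF rank_data_pair.up_rel1, of i] L_step1[OF rank_data_pair.up_rel2, of i]
    L_step1[OF rank_data_pair.up_rel3, of i] L_step1[OF rank_data_pair.up_rel4, of i]
    L_step1[OF rank_data_pair.up_rel5, of i]
  by (simp_all only: divide_divide_eq_left)

lemma L_w6:
  "Lop x *v w 6 (Suc (Suc i)) = ((q ^ Suc (Suc i) - 1) * (P - q ^ Suc i) * (Q - q ^ Suc i) / ((q - 1) * (q ^ Suc i - 1))) *s w 6 (Suc i)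
     - (q ^ i * (P - 1) * (Q - 1) / (q ^ Suc i - 1)) *s w 5 (Suc i)"
proof -
  \<comment> \<open>The recurrence divides by \<open>s - 1\<close> at the target level, so that
    level must be at least 1.\<close>
  have ne: "q ^ Suc i \<noteq> 1" using q_power_1[of "Suc i"] by simp
  have c: "(q - 1) * A * B * C / E / (q - 1) = A * B * C / E" for A B C E
    using q_nz by simp
  show ?thesis
    using L_step[OF rank_data_pair.up_rel6[where q = q and P = P and Q = Q and u = u and v = v, OF _ ne], of "Suc i"]
    unfolding w_def power_Suc[of q "Suc i"] q_power_div c by (simp only: divide_divide_eq_left mult.commute)
qed

lemma w_0: "k \<in> {2..6} \<Longrightarrow> w k 0 = 0"
  unfolding w_def
proof (rule bv_eq_0)
  fix z :: "'a^'n^'m" assume k: "k \<in> {2..6}" and "rank z = 0"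
  then have z: "z = 0" by (simp only: rank_zero_iff)
  have "transpose 0 = (0 :: 'a^'m^'n)" by (simp add: transpose_def vec_eq_iff)
  then have "u \<notin> col z" "v \<notin> row_sp z" using u v unfolding z by (simp_all add: col_def)
  moreover have "k \<in> {2, 3, 4, 5, 6}" using k by auto
  ultimately show "wfun q P Q u v k (q ^ 0) z = 0"
    by (auto simp: wfun_def comb_def fF_def gF_def hF_def phiF_zero)
qed

text \<open>For \<open>t = q\<close> the coefficient \<open>t / q - 1\<close> of \<open>hF\<close>
  is 0, and \<open>phiF u v 0\<close> vanishes in rank one.\<close>

lemma w6_1: "w 6 1 = 0"
  unfolding w_def
proof (rule bv_eq_0)
  fix z :: "'a^'n^'m" assume z: "rank z = 1"
  then show "wfun q P Q u v 6 (q ^ 1) z = 0"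
    using rank_one_not_incid_0[OF u v z] q_nz by (simp add: wfun_simps comb_def phiF_incid)
qed

text \<open>At full rank \<open>fF\<close> is constantly 1, which cancels families 2 and 5. Beyond
  it there are no matrices.\<close>

lemma w_top: "w 2 D = 0" "w 5 D = 0" "w k (Suc D) = 0"
proof -
  have f: "fF u z = 1" "hF u v z = gF v z" if "rank z = D" for z :: "'a^'n^'m"
  proof -
    have "u \<in> col z" using that by (intro full_rank_col) (simp add: D)
    then show "fF u z = 1" by (simp add: fF_def)
    then show "hF u v z = gF v z" by (simp add: hF_eq)
  qed
  show "w 2 D = 0" unfolding w_def
    by (rule bv_eq_0) (simp add: wfun_simps comb_def f add_divide_distrib[symmetric])
  show "w 5 D = 0" unfolding w_def
    by (rule bv_eq_0) (simp add: wfun_simps comb_def f power2_eq_square algebra_simps)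
  have "rank z \<noteq> Suc D" for z :: "'a^'n^'m"
    using bf_dist_le[of x "z + x"] by (simp add: bf_dist_eq D)
  then show "w k (Suc D) = 0" unfolding w_def by (intro bv_eq_0) blast
qed

lemma R_w:
  "Rop x *v w 1 i = cnum q (Suc i) *s w 1 (Suc i)"
  "Rop x *v w 2 i = (q ^ Suc i * ((q ^ i - 1) / (q - 1))) *s w 2 (Suc i)"
  "Rop x *v w 3 i = (q ^ Suc i * ((q ^ i - 1) / (q - 1))) *s w 3 (Suc i)"
  "Rop x *v w 4 i = (q ^ i * ((q ^ i - 1) / (q - 1))) *s w 4 (Suc i)"
  unfolding w_def cnum_def
  using R_step1[OF rank_data_pair.dn_rel1[where s = "q ^ Suc i" and q = q], of i] R_step1[OF rank_data_pair.dn_rel2[where s = "q ^ Suc i" and q = q], of i]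
    R_step1[OF rank_data_pair.dn_rel3[where s = "q ^ Suc i" and q = q], of i] R_step1[OF rank_data_pair.dn_rel4[where s = "q ^ Suc i" and q = q], of i]
  unfolding q_power_div by (simp_all only: times_divide_eq_right diff_Suc_1 mult.commute)

lemma R_w6:
  "Rop x *v w 6 (Suc i) = (q ^ i * ((q ^ i - 1) / (q - 1))) *s w 6 (Suc (Suc i))"
  unfolding w_def using R_step1[OF rank_data_pair.dn_rel6[where s = "q ^ Suc (Suc i)" and q = q], of "Suc i"]
  unfolding q_power_div by (simp only: times_divide_eq_right)

lemma R_w5:
  "Rop x *v w 5 (Suc i) = (q ^ Suc i * (q ^ Suc i - 1)^2 / ((q - 1) * (q ^ Suc (Suc i) - 1))) *s w 5 (Suc (Suc i))
     - (q ^ i * (q - 1) / (q ^ Suc (Suc i) - 1)) *s w 6 (Suc (Suc i))"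
proof -
  have ne: "q ^ Suc (Suc i) \<noteq> 1" using q_power_1[of "Suc (Suc i)"] by simp
  have c: "A * (q - 1)^2 / E / (q - 1) = A * (q - 1) / E" for A E
    using q_nz by (simp add: power2_eq_square)
  show ?thesis
    using R_step[OF rank_data_pair.dn_rel5[where q = q and P = P and Q = Q and u = u and v = v, OF _ ne], of "Suc i"]
    unfolding w_def q_power_div c by (simp only: divide_divide_eq_left mult.commute)
qed

text \<open>Level 0 is left to family 1, because the truncated exponent \<open>i - 1\<close> in
  \<open>ev\<close> agrees with division by \<open>q\<close> only for positive \<open>i\<close>; for
  family 1 the deviation is 0 anyway.\<close>

lemma F_w:
  assumes k: "k \<in> {1..6}" and i: "i > 0 \<or> k = 1"
  shows "Fop x *v w k i = ev k i *s w k i"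
proof -
  have k: "k = 1 \<or> k = 2 \<or> k = 3 \<or> k = 4 \<or> k = 5 \<or> k = 6" using k by auto
  have "Fop x *v w k i = (((q ^ i - 1) * (Q + P - q ^ i - q ^ i / q - 1) - (q - 1) * (q ^ i / q) * edev q P Q k (q ^ i)) / (q - 1)) *s w k i"
    unfolding w_def
  proof (rule F_step)
    fix z :: "'a^'n^'m" assume "rank_data_pair z q P Q (q ^ i) u v"
    note rel = rank_data_pair.same_rel1[OF this] rank_data_pair.same_rel2[OF this] rank_data_pair.same_rel3[OF this]
      rank_data_pair.same_rel4[OF this] rank_data_pair.same_rel5[OF this] rank_data_pair.same_rel6[OF this]
    show "smS z (wfun q P Q u v k (q ^ i)) = ((q ^ i - 1) * (Q + P - q ^ i - q ^ i / q - 1)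
        - (q - 1) * (q ^ i / q) * edev q P Q k (q ^ i)) * wfun q P Q u v k (q ^ i) z"
      using k by (elim disjE) (simp_all only: rel)
  qed
  also have "((q ^ i - 1) * (Q + P - q ^ i - q ^ i / q - 1) - (q - 1) * (q ^ i / q) * edev q P Q k (q ^ i)) / (q - 1) = ev k i"
  proof (cases i)
    case 0
    then show ?thesis using i by (simp add: ev_def anum_def edev_def)
  next
    case (Suc j)
    have "(A * B - (q - 1) * C * E) / (q - 1) = A / (q - 1) * B - C * E" for A B C E
      using q_nz by (simp add: diff_divide_distrib)
    then show ?thesis unfolding Suc q_power_div ev_def anum_def diff_Suc_1 .
  qed
  finally show ?thesis .
qed

end

section \<open>Nonvanishing of the vectors and separation of the eigenvalues\<close>

context bf_modules
begin

text \<open>The levels on which family \<open>k\<close> survives. Their sizes add up to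
  \<open>6 * D - 2\<close>.\<close>

definition lv :: "nat \<Rightarrow> nat set" where
  "lv k = {(if k = 1 then 0 else if k = 6 then 2 else 1)..(if k = 2 \<or> k = 5 then D - 1 else D)}"

lemma lv_simps:
  "lv 1 = {0..D}" "lv 2 = {1..D - 1}" "lv 3 = {1..D}" "lv 4 = {1..D}" "lv 5 = {1..D - 1}" "lv 6 = {2..D}"
  by (simp_all add: lv_def)

lemma q_powers_distinct: "q ^ i - 1 = 0 \<longleftrightarrow> i = 0" "P - q ^ i = 0 \<longleftrightarrow> i = D" "Q - q ^ i = 0 \<longleftrightarrow> i = N - D"
  "P - 1 \<noteq> 0" "Q - 1 \<noteq> 0"
  using q_power_eq[of D i] q_power_eq[of "N - D" i] D3 N by (auto simp: q_power_1)

lemma ks: "k \<in> {1..6} \<Longrightarrow> k = 1 \<or> k = 2 \<or> k = 3 \<or> k = 4 \<or> k = 5 \<or> k = (6 :: nat)"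
  by auto

lemma ex_nonzero_scalar: "a = c *s b \<Longrightarrow> c \<noteq> 0 \<Longrightarrow> \<exists>c. c \<noteq> 0 \<and> a = c *s b" for c :: complex
  by blast

lemma L_nonzero:
  assumes "k \<in> {1..5}" "i \<in> lv k" "Suc i \<in> lv k"
  shows "\<exists>c. c \<noteq> 0 \<and> Lop x *v w k (Suc i) = c *s w k i"
proof -
  have ne: "i \<noteq> D" "i \<noteq> N - D" "Suc i \<noteq> N - D" and ne': "k = 2 \<or> k = 5 \<Longrightarrow> Suc i \<noteq> D"
    using assms(3) D3 N by (auto simp: lv_def split: if_splits)
  note nz = divide_eq_0_iff mult_eq_0_iff q_powers_distinct q_nz simp_thms
  have "k = 1 \<or> k = 2 \<or> k = 3 \<or> k = 4 \<or> k = 5" using assms(1) by auto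
  then show ?thesis
  proof (elim disjE)
    assume k: "k = 1"
    show ?thesis unfolding k by (rule ex_nonzero_scalar[OF L_w(1)]) (simp only: nz ne)
  next
    assume k: "k = 2"
    then have "Suc i \<noteq> D" using ne' by simp
    then show ?thesis unfolding k by (intro ex_nonzero_scalar[OF L_w(2)]) (simp only: nz ne)
  next
    assume k: "k = 3"
    show ?thesis unfolding k by (rule ex_nonzero_scalar[OF L_w(3)]) (simp only: nz ne)
  next
    assume k: "k = 4"
    show ?thesis unfolding k by (rule ex_nonzero_scalar[OF L_w(4)]) (simp only: nz ne)
  next
    assume k: "k = 5"
    then have "Suc i \<noteq> D" using ne' by simp
    then show ?thesis unfolding k by (intro ex_nonzero_scalar[OF L_w(5)]) (simp only: nz ne)
  qed
qed

lemma R_nonzero: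
  assumes "k \<in> {1..4}" "i \<in> lv k"
  shows "\<exists>c. c \<noteq> 0 \<and> Rop x *v w k i = c *s w k (Suc i)"
proof -
  have ne: "i \<noteq> 0" if "k \<noteq> 1" using assms that by (auto simp: lv_def)
  note nz = divide_eq_0_iff mult_eq_0_iff power_eq_0_iff q_powers_distinct q_nz simp_thms cnum_def nat.distinct
  have "k = 1 \<or> k = 2 \<or> k = 3 \<or> k = 4" using assms(1) by auto
  then show ?thesis
  proof (elim disjE)
    assume k: "k = 1"
    show ?thesis unfolding k by (rule ex_nonzero_scalar[OF R_w(1)]) (simp only: nz)
  next
    assume k: "k = 2"
    then have "i \<noteq> 0" using ne by simp
    then show ?thesis unfolding k by (intro ex_nonzero_scalar[OF R_w(2)]) (simp only: nz)
  next
    assume k: "k = 3"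
    then have "i \<noteq> 0" using ne by simp
    then show ?thesis unfolding k by (intro ex_nonzero_scalar[OF R_w(3)]) (simp only: nz)
  next
    assume k: "k = 4"
    then have "i \<noteq> 0" using ne by simp
    then show ?thesis unfolding k by (intro ex_nonzero_scalar[OF R_w(4)]) (simp only: nz)
  qed
qed

text \<open>The deviations are compared by size. With \<open>t = r ^ i\<close>,
  \<open>y = t / r\<close> and \<open>r \<ge> 3\<close>, the numbers \<open>y\<close>,
  \<open>t\<close>, \<open>r ^ D\<close>, \<open>r ^ (N - D)\<close> grow by factors of at least 3,
  except that \<open>t\<close> and \<open>r ^ D\<close> coincide on the top level.\<close>

lemma eigenvalues_distinct:
  assumes k: "k \<in> {1..6}" "l \<in> {1..6}" "k \<noteq> l" and i: "0 < i" "i \<le> D"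
  shows "ev k i \<noteq> ev l i"
proof -
  define r where "r = Re q"
  have q: "q = of_real r" and r: "r \<ge> 3" using q_real by (simp_all add: r_def)
  obtain j where j: "i = Suc j" using i by (cases i) auto
  define y where "y = r ^ j"
  define t where "t = r * y"
  have y1: "y \<ge> 1" using r by (simp add: y_def)
  have t: "t \<ge> 3 * y" using r y1 by (simp add: t_def)
  \<comment> \<open>On the top level the deviations of families 3 and 4 are
    \<open>r ^ (N - D) - 1\<close> and \<open>r ^ (N - D) - y\<close>, so \<open>y \<ge> 3\<close>
    is what keeps them apart.\<close>
  have top: "(r ^ D = t \<and> y \<ge> 3) \<or> r ^ D \<ge> 3 * t"
  proof (cases "i = D")
    case True
    then obtain m where "j = Suc m" using D3 j by (cases j) auto
    moreover have "1 \<le> r ^ m" using r by simp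
    ultimately have "y \<ge> 3" using mult_mono[of 3 r 1 "r ^ m"] r by (simp add: y_def)
    moreover have "r ^ D = r ^ Suc j" using True j by simp
    ultimately show ?thesis by (simp add: t_def y_def)
  next
    case False
    then have "r ^ Suc i \<le> r ^ D" using i r by (intro power_increasing) auto
    moreover have "3 * t \<le> r * t" using r t y1 by (intro mult_right_mono) auto
    ultimately show ?thesis by (simp add: j t_def y_def)
  qed
  have "r ^ Suc D \<le> r ^ (N - D)" using r N by (intro power_increasing) auto
  moreover have "3 * r ^ D \<le> r * r ^ D" using r by (intro mult_right_mono) auto
  ultimately have Q: "r ^ (N - D) \<ge> 3 * r ^ D" by simp
  have w: "0 < 1 / r" "1 / r \<le> 1 / 3" using r by (simp_all add: field_simps)
  define E where "E k = (if k = 1 then 0 else if k = 2 then r ^ D - 1 else if k = 3 then r ^ (N - D) - 1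
    else if k = 4 then r ^ (N - D) + r ^ D - t - y else if k = 5 then r ^ (N - D) + r ^ D - 2
    else r ^ (N - D) + r ^ D - t - y - 1 + 1 / r)" for k :: nat
  have y: "q ^ i / q = of_real y" "q ^ i = of_real t"
    using r by (simp_all add: j q y_def t_def)
  have "edev q P Q k (q ^ i) = of_real (E k)" for k
    unfolding edev_def y(1) unfolding y(2) E_def by (simp add: q)
  moreover have "E k \<noteq> E l"
  proof
    have E: "E 1 = 0" "E 2 = r ^ D - 1" "E 3 = r ^ (N - D) - 1" "E 4 = r ^ (N - D) + r ^ D - t - y"
      "E 5 = r ^ (N - D) + r ^ D - 2" "E 6 = r ^ (N - D) + r ^ D - t - y - 1 + 1 / r"
      by (simp_all add: E_def)
    assume eq: "E k = E l"
    from top ks[OF k(1)] ks[OF k(2)] show False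
      by (elim disjE conjE; insert k(3) eq Q w t y1; hypsubst; (simp only: E; fail)?; (simp only: E; linarith)?)
  qed
  ultimately show ?thesis using q_nz by (simp add: ev_def)
qed

text \<open>At level 1 the vectors are evaluated at the vertex \<open>y\<close>, that is at the
  matrix \<open>outer u v\<close>, where the form has the value 1. Family 4 takes the value
  \<open>(q - 2) / q\<close> there, so \<open>q \<noteq> 2\<close> is essential.\<close>

lemma w_base: "w 1 0 \<noteq> 0" "k \<in> {2..5} \<Longrightarrow> w k 1 \<noteq> 0"
proof -
  have "w 1 0 $ x = 1"
    unfolding w_def bv_apply wfun_simps comb_def by (simp add: rank_zero_iff)
  then show "w 1 0 \<noteq> 0" by auto
  assume k: "k \<in> {2..5}"
  define z where "z = outer u v"
  have z: "rank z = 1" using u v by (simp add: z_def rank_outer)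
  obtain j where "v $ j \<noteq> 0" using v by (auto simp: vec_eq_iff)
  then have p: "dotp v (axis j (inverse (v $ j))) = 1"
    by (simp add: dotp_def axis_def if_distrib cong: if_cong)
  have "z *v axis j (inverse (v $ j)) = u" by (simp add: z_def outer_mult p)
  moreover have "v \<in> row_sp z" using u by (auto simp: z_def transpose_outer col_outer intro: image_eqI[of _ _ 1])
  ultimately have 1: "incid u v 1 z" using p by (simp add: incid_iff)
  then have fg: "fF u z = 1" "gF v z = 1" "hF u v z = 1" "phiF u v 1 z = 1" "phiF u v 0 z = 0"
    using incidD[OF 1] rank_one_not_incid_0[OF u v z] by (simp_all add: fF_def gF_def hF_def phiF_incid)
  have "w k 1 $ (x + z) = wfun q P Q u v k q z" by (simp add: w_def bv_apply z)
  moreover have "wfun q P Q u v k q z \<noteq> 0"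
  proof -
    have "wfun q P Q u v 2 q z = (P - q ^ 1) / q" "wfun q P Q u v 3 q z = (Q - q ^ 1) / q"
      "wfun q P Q u v 4 q z = (q - 2) / q"
      unfolding wfun_simps comb_def fg using q_nz by (simp_all add: field_simps)
    moreover have "wfun q P Q u v 5 q z = (q - 1) * ((P - q ^ 1) * (Q - q ^ 1))"
      unfolding wfun_simps comb_def fg power2_eq_square power_one_right by algebra
    moreover have "D \<noteq> 1" "N - D \<noteq> 1" using D3 N by auto
    moreover have "k = 2 \<or> k = 3 \<or> k = 4 \<or> k = 5" using k by auto
    ultimately show ?thesis
      using q_nz q2 by (elim disjE) (simp_all only: divide_eq_0_iff mult_eq_0_iff right_minus_eq q_power_eq simp_thms)
  qed
  ultimately show "w k 1 \<noteq> 0" by auto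
qed

text \<open>Families 1 to 5 climb from their base vectors: \<open>Lop x\<close> maps each vector to
  a nonzero multiple of the one below, so it cannot be 0. Family 6 has no base vector and is
  detected through its cross term with family 5.\<close>

lemma w_nonzero:
  assumes k: "k \<in> {1..6}" and i: "i \<in> lv k"
  shows "w k i \<noteq> 0"
proof -
  have thin: "w k i \<noteq> 0" if k: "k \<in> {1..5}" and "i \<in> lv k" for k i
    using that(2)
  proof (induction i)
    case 0
    then show ?case using k w_base(1) by (auto simp: lv_def split: if_splits)
  next
    case (Suc i)
    show ?case
    proof (cases "i \<in> lv k")
      case True
      obtain c where c: "c \<noteq> 0" "Lop x *v w k (Suc i) = c *s w k i"
        using L_nonzero[OF k True Suc.prems] by (elim exE conjE) (rule that)
      show ?thesis
      proof
        assume "w k (Suc i) = 0"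
        then have "c *s w k i = 0" using c(2) by (simp only: matrix_vector_mult_0_right)
        then show False using Suc.IH[OF True] c(1) vec.scale_eq_0_iff[of c "w k i"] by blast
      qed
    next
      case False
      then have "i = 0" "k \<noteq> 1" using k Suc.prems by (auto simp: lv_def split: if_splits)
      then show ?thesis using k w_base(2)[of k] by auto
    qed
  qed
  show ?thesis
  proof (cases "k = 6")
    case True
    then have "2 \<le> i" "i \<le> D" using i by (simp_all add: lv_def)
    then obtain j where j: "i = Suc (Suc j)" "Suc j \<le> D - 1"
      using that[of "i - 2"] by simp
    let ?a = "(q ^ Suc (Suc j) - 1) * (P - q ^ Suc j) * (Q - q ^ Suc j) / ((q - 1) * (q ^ Suc j - 1))"
    let ?b = "q ^ j * (P - 1) * (Q - 1) / (q ^ Suc j - 1)"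
    have b: "?b \<noteq> 0"
      using q_nz D3 N by (simp only: divide_eq_0_iff mult_eq_0_iff power_eq_0_iff q_powers_distinct) simp
    \<comment> \<open>If this vector were 0, then \<open>L_w6\<close> would equate a multiple of
      \<open>w 6\<close> with a nonzero multiple of \<open>w 5\<close> one level below. Their
      \<open>Fop x\<close>-eigenvalues differ, which would force \<open>w 5\<close> to vanish
      there.\<close>
    have "w 6 (Suc (Suc j)) \<noteq> 0"
    proof
      assume "w 6 (Suc (Suc j)) = 0"
      then have eq: "?a *s w 6 (Suc j) = ?b *s w 5 (Suc j)"
        using L_w6[of j] by (simp only: matrix_vector_mult_0_right right_minus_eq eq_commute[of 0])
      have F: "Fop x *v (c *s w k (Suc j)) = ev k (Suc j) *s (c *s w k (Suc j))" if "k \<in> {1..6}" for c k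
        unfolding vector_scalar_commute using F_w[OF that, of "Suc j"]
        by (simp add: vector_smult_assoc mult.commute)
      have "Fop x *v (?a *s w 6 (Suc j)) = Fop x *v (?b *s w 5 (Suc j))"
        by (rule arg_cong[OF eq])
      also have "Fop x *v (?a *s w 6 (Suc j)) = ev 6 (Suc j) *s (?a *s w 6 (Suc j))" by (rule F) simp
      also have "Fop x *v (?b *s w 5 (Suc j)) = ev 5 (Suc j) *s (?b *s w 5 (Suc j))" by (rule F) simp
      finally have "(ev 6 (Suc j) - ev 5 (Suc j)) *s (?b *s w 5 (Suc j)) = 0"
        unfolding eq by (simp only: vec.scale_left_diff_distrib right_minus_eq)
      moreover have "ev 6 (Suc j) \<noteq> ev 5 (Suc j)" using j by (intro eigenvalues_distinct) auto
      moreover have "w 5 (Suc j) \<noteq> 0" using j by (intro thin) (auto simp: lv_def)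
      ultimately show False using b unfolding vec.scale_eq_0_iff right_minus_eq by blast
    qed
    then show ?thesis using True j by simp
  qed (use k i thin[of k i] in auto)
qed

definition "I = Sigma {1..6} lv"

lemma card_I: "card I = 6 * D - 2"
proof -
  have "{1..6 :: nat} = {1, 2, 3, 4, 5, 6}" by auto
  then have "card I = (\<Sum>k\<in>{1, 2, 3, 4, 5, 6}. card (lv k))"
    unfolding I_def by (subst card_SigmaI) (auto simp: lv_def)
  also have "\<dots> = 6 * D - 2" using D3 by (simp add: lv_def)
  finally show ?thesis .
qed

sublocale graded_family x I "\<lambda>(k, i). w k i" snd "\<lambda>(k, i). ev k i"
proof unfold_locales
  show "finite I" unfolding I_def by (auto simp: lv_def)
  fix a assume a: "a \<in> I"
  obtain k i where ki: "a = (k, i)" by (cases a)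
  then have k: "k \<in> {1..6}" and i: "i \<in> lv k" using a by (auto simp: I_def)
  show "(case a of (k, i) \<Rightarrow> w k i) \<noteq> 0" using w_nonzero[OF k i] by (simp add: ki)
  show "Es x j *v (case a of (k, i) \<Rightarrow> w k i) = (if j = snd a then case a of (k, i) \<Rightarrow> w k i else 0)" for j
    by (simp add: ki w_def bv_ops(5))
  have iD: "i \<le> D" using i by (auto simp: lv_def split: if_splits)
  then show "snd a \<le> CARD('m)" by (simp add: ki D)
  have i0: "i > 0 \<or> k = 1" using i by (auto simp: lv_def split: if_splits)
  show "Fop x *v (case a of (k, i) \<Rightarrow> w k i) = (case a of (k, i) \<Rightarrow> ev k i) *s (case a of (k, i) \<Rightarrow> w k i)"
    using F_w[OF k i0] by (simp add: ki)
  have "cnj q = q" by (simp add: q)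
  then show "cnj (case a of (k, i) \<Rightarrow> ev k i) = (case a of (k, i) \<Rightarrow> ev k i)"
    by (simp add: ki ev_def anum_def edev_def)
  fix b assume b: "b \<in> I" "a \<noteq> b" "snd a = snd b"
  then obtain l where l: "b = (l, i)" "l \<in> {1..6}" "i \<in> lv l" "k \<noteq> l"
    by (cases b) (auto simp: I_def ki)
  \<comment> \<open>Level 0 belongs to family 1 only, so two families can meet only on a positive
    level.\<close>
  then have "i > 0" using i0 by (auto simp: lv_def split: if_splits)
  then show "(case a of (k, i) \<Rightarrow> ev k i) \<noteq> (case b of (k, i) \<Rightarrow> ev k i)"
    using eigenvalues_distinct[OF k l(2,4) _ iD] by (simp add: ki l)
qed

end

section \<open>The direct sum and irreducibility\<close>

lemma interval_connected:
  fixes a b :: nat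
  assumes "\<And>i. a \<le> i \<Longrightarrow> i < b \<Longrightarrow> R i \<longleftrightarrow> R (Suc i)" "i \<in> {a..b}" "R i" "j \<in> {a..b}"
  shows "R j"
proof -
  have "R l \<longleftrightarrow> R a" if "a \<le> l" "l \<le> b" for l
    using that
  proof (induction l rule: dec_induct)
    case (step n)
    then have "R n \<longleftrightarrow> R a" "a \<le> n" "n < b" by simp_all
    then show ?case using assms(1)[of n] by blast
  qed (rule refl)
  from this[of i] this[of j] show ?thesis using assms(2-4) by simp
qed

lemma is_basis_family_reindex:
  assumes "is_basis_family f J W" "bij_betw g A J"
  shows "is_basis_family (\<lambda>a. f (g a)) A W"
proof -
  have "(\<lambda>a. f (g a)) ` A = f ` J" using assms(2) by (auto simp: bij_betw_def image_image)
  moreover have "inj_on (\<lambda>a. f (g a)) A"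
    using comp_inj_on[of g A f] assms by (auto simp: bij_betw_def is_basis_family_def comp_def)
  ultimately show ?thesis using assms(1) by (simp add: is_basis_family_def)
qed

context bf_modules
begin

abbreviation "ww \<equiv> \<lambda>(k, i). w k i"

text \<open>Family 6 has no module of its own, since L and R couple it with family 5.\<close>

definition "J k = (if k = 5 then {5} \<times> lv 5 \<union> {6} \<times> lv 6 else {k} \<times> lv k)"

abbreviation "M k \<equiv> vec.span (ww ` J k)"

lemma J_subset: "k \<in> {1..5} \<Longrightarrow> J k \<subseteq> I"
  by (auto simp: J_def I_def)

lemma span_ww: "vec.span (ww ` I) = U_space x y"
proof (rule span_eq_space)
  show "ww ` I \<subseteq> U_space x y" by (auto simp: w_def wfun_in_U)
  show "vec.subspace (U_space x y)" unfolding U_space_def by (rule vec.subspace_span)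
  show "vec.dim (U_space x y) \<le> card I" using dim_U_le by (simp add: card_I D)
qed

lemma M_direct_sum: "orthogonal_direct_sum (U_space x y) {1..5} M"
  unfolding span_ww[symmetric]
proof (rule direct_sum)
  have "{1..5 :: nat} = {1, 2, 3, 4, 5}" "{1..6 :: nat} = {1, 2, 3, 4, 5, 6}" by auto
  then show "I = (\<Union>k\<in>{1..5}. J k)" by (auto simp: I_def J_def)
  show "J k \<inter> J l = {}" if "k \<in> {1..5}" "l \<in> {1..5}" "k \<noteq> l" for k l
    using that by (auto simp: J_def)
qed simp

lemma w_out: "k \<in> {1..6} \<Longrightarrow> i \<notin> lv k \<Longrightarrow> w k i = 0"
proof -
  assume k: "k \<in> {1..6}" and i: "i \<notin> lv k"
  have "i = 0 \<and> k \<in> {2..6} \<or> i = 1 \<and> k = 6 \<or> i = D \<and> (k = 2 \<or> k = 5) \<or> D < i"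
    using ks[OF k] i D3 by (elim disjE; simp add: lv_def; arith)
  moreover have "w k i = 0" if "D < i"
  proof -
    have "rank z \<noteq> i" for z :: "'a^'n^'m"
      using bf_dist_le[of x "z + x"] that by (simp add: bf_dist_eq D)
    then show ?thesis unfolding w_def by (intro bv_eq_0) blast
  qed
  ultimately show ?thesis using w_0 w6_1 w_top by auto
qed

lemma w_in_span: "k \<in> {1..6} \<Longrightarrow> w k i \<in> vec.span (ww ` ({k} \<times> lv k))"
proof -
  assume k: "k \<in> {1..6}"
  show ?thesis
  proof (cases "i \<in> lv k")
    case True
    then have "(k, i) \<in> {k} \<times> lv k" by simp
    then show ?thesis by (intro vec.span_base image_eqI[of _ ww "(k, i)"]) simp_all
  qed (simp add: w_out[OF k] vec.span_zero)
qed

lemma w_in_M: "k \<in> {1..5} \<Longrightarrow> w k i \<in> M k" "w 6 i \<in> M 5"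
proof -
  show "w k i \<in> M k" if "k \<in> {1..5}"
  proof -
    have "{k} \<times> lv k \<subseteq> J k" by (auto simp: J_def)
    then have "vec.span (ww ` ({k} \<times> lv k)) \<subseteq> M k" by (intro vec.span_mono image_mono)
    then show ?thesis using w_in_span[of k i] that by auto
  qed
  have "{6} \<times> lv 6 \<subseteq> J 5" by (auto simp: J_def)
  then have "vec.span (ww ` ({6} \<times> lv 6)) \<subseteq> M 5" by (intro vec.span_mono image_mono)
  then show "w 6 i \<in> M 5" using w_in_span[of 6 i] by auto
qed

lemma L_bottom: "Lop x *v w 1 0 = 0" "k \<in> {2..5} \<Longrightarrow> Lop x *v w k 1 = 0"
proof -
  show "Lop x *v w 1 0 = 0" unfolding w_def by (rule bv_ops(2))
  assume k: "k \<in> {2..5}"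
  then have "k = 2 \<or> k = 3 \<or> k = 4 \<or> k = 5" by auto
  moreover have "w k 0 = 0" using k by (intro w_0) simp
  ultimately show "Lop x *v w k 1 = 0"
    unfolding One_nat_def by (elim disjE) (simp_all only: L_w vec.scale_zero_right)
qed

lemma M_T_module: "k \<in> {1..5} \<Longrightarrow> T_module x (M k)"
proof (rule T_module_span)
  assume k: "k \<in> {1..5}"
  show "J k \<subseteq> I" by (rule J_subset[OF k])
  have ks: "k = 1 \<or> k = 2 \<or> k = 3 \<or> k = 4 \<or> k = 5" using k by auto
  fix a assume "a \<in> J k"
  then obtain l i where a: "a = (l, i)" "i \<in> lv l" "l = k \<or> k = 5 \<and> l = 6"
    by (auto simp: J_def split: if_splits)
  have mem: "c *s w k j \<in> M k" for c j
    by (intro vec.span_scale w_in_M k)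
  have mem5: "c *s w 5 j \<in> M 5" "c *s w 6 j \<in> M 5" for c j
    by (intro vec.span_scale w_in_M; simp)+
  have "Lop x *v w l i \<in> M k \<and> Rop x *v w l i \<in> M k"
  proof (cases "l = 6")
    case True
    then have "2 \<le> i" "k = 5" using a k by (auto simp: lv_def)
    then obtain j where j: "i = Suc (Suc j)" using that[of "i - 2"] by simp
    show ?thesis unfolding True j \<open>k = 5\<close> L_w6 R_w6 by (intro conjI vec.span_diff mem5)
  next
    case False
    then have l: "l = k" using a by simp
    have "Lop x *v w k i \<in> M k"
    proof (cases i)
      case 0
      then have "k = 1" using a l ks by (auto simp: lv_def split: if_splits)
      then show ?thesis using L_bottom(1) 0 by (simp add: vec.span_zero)
    next
      case (Suc j)
      from ks show ?thesis unfolding Suc using mem[of _ j] by (elim disjE) (simp_all only: L_w)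
    qed
    moreover have "Rop x *v w k i \<in> M k"
    proof (cases "k = 5")
      case True
      then obtain j where "i = Suc j" using a l by (cases i) (auto simp: lv_def)
      then show ?thesis unfolding True by (simp only: R_w5) (intro vec.span_diff mem5)
    next
      case False
      with ks show ?thesis using mem[of _ "Suc i"] by (elim disjE) (simp_all only: R_w simp_thms)
    qed
    ultimately show ?thesis by (simp add: l)
  qed
  then show "Lop x *v (case a of (k, i) \<Rightarrow> w k i) \<in> M k" "Rop x *v (case a of (k, i) \<Rightarrow> w k i) \<in> M k"
    by (simp_all add: a)
qed

lemma scaled_in_module: "T_module x W \<Longrightarrow> c \<noteq> 0 \<Longrightarrow> c *s g \<in> W \<Longrightarrow> g \<in> W"
proof -
  assume W: "T_module x W" and c: "c \<noteq> 0" "c *s g \<in> W"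
  have "vec.subspace W" using W by (simp add: T_module_def)
  then have "inverse c *s (c *s g) \<in> W" using c(2) by (rule vec.subspace_scale)
  then show ?thesis using c(1) by (simp add: vector_smult_assoc)
qed

text \<open>Extracts the subtracted term from the two-term recurrences of families 5 and 6. At the
  ends of the range the other vector is 0 and not in the graded family, so that case is treated by
  scaling alone.\<close>

lemma separate_pair:
  assumes W: "T_module x W" and mem: "a *s w k i - b *s w l i \<in> W" and b: "b \<noteq> 0"
    and k: "k \<in> {1..6}" and l: "l \<in> {1..6}" "i \<in> lv l" and "k \<noteq> l"
  shows "w l i \<in> W"
proof (cases "i \<in> lv k")
  case True
  have "(\<Sum>c\<in>{(k, i), (l, i)}. (if c = (k, i) then a else - b) *s ww c) = a *s w k i - b *s w l i"
    using \<open>k \<noteq> l\<close> by simp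
  then have "ww (l, i) \<in> W"
    by (intro separate[OF W, of "{(k, i), (l, i)}" "\<lambda>c. if c = (k, i) then a else - b"])
      (use assms True in \<open>auto simp: I_def\<close>)
  then show ?thesis by simp
next
  case False
  then have "(- b) *s w l i \<in> W" using mem w_out[OF k False] by simp
  then show ?thesis by (rule scaled_in_module[OF W, rotated]) (use b in simp)
qed

text \<open>Families 1 to 4 are chains on which L and R act with nonzero coefficients. In the fifth
  module family 5 is the chain, and the cross terms tie \<open>w 6 (Suc i)\<close> to
  \<open>w 5 i\<close>: R leads from the latter to the former and L leads back.\<close>

lemma M_connected:
  assumes W: "T_module x W" and k: "k \<in> {1..5}" and a: "a \<in> J k" "ww a \<in> W" and b: "b \<in> J k"
  shows "ww b \<in> W"
proof -
  have L: "Lop x *v g \<in> W" and R: "Rop x *v g \<in> W" if "g \<in> W" for g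
    using W that ops_in_T_alg(2,4) unfolding T_module_def by blast+
  have down: "w k i \<in> W" if h: "i \<in> lv k" "Suc i \<in> lv k" "w k (Suc i) \<in> W" for i
  proof -
    obtain c where c: "c \<noteq> 0" "Lop x *v w k (Suc i) = c *s w k i"
      using L_nonzero[OF k h(1,2)] by (elim exE conjE) (rule that)
    from L[OF h(3)] show ?thesis unfolding c(2) by (rule scaled_in_module[OF W c(1)])
  qed
  obtain lo hi where lohi: "lv k = {lo..hi}" using lv_def[of k] by (rule that)
  show ?thesis
  proof (cases "k = 5")
    case False
    then have k4: "k \<in> {1..4}" using k by auto
    have up: "w k (Suc i) \<in> W" if h: "i \<in> lv k" "w k i \<in> W" for i
    proof -
      obtain c where c: "c \<noteq> 0" "Rop x *v w k i = c *s w k (Suc i)"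
        using R_nonzero[OF k4 h(1)] by (elim exE conjE) (rule that)
      from R[OF h(2)] show ?thesis unfolding c(2) by (rule scaled_in_module[OF W c(1)])
    qed
    obtain i j where ij: "a = (k, i)" "i \<in> lv k" "b = (k, j)" "j \<in> lv k"
      using a b False by (auto simp: J_def)
    have "w k j \<in> W"
    proof (rule interval_connected[of lo hi "\<lambda>i. w k i \<in> W" i])
      fix l assume "lo \<le> l" "l < hi"
      then have "l \<in> lv k" "Suc l \<in> lv k" by (simp_all add: lohi)
      then show "w k l \<in> W \<longleftrightarrow> w k (Suc l) \<in> W" using up down by blast
    qed (use ij a(2) lohi in auto)
    then show ?thesis by (simp add: ij)
  next
    case True
    have c5: "q ^ i * (q - 1) / (q ^ Suc (Suc i) - 1) \<noteq> 0" "q ^ i * (P - 1) * (Q - 1) / (q ^ Suc i - 1) \<noteq> 0"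
      "q ^ Suc i * (q ^ Suc i - 1)^2 / ((q - 1) * (q ^ Suc (Suc i) - 1)) \<noteq> 0" for i
      using q_nz D3 N by (simp_all only: divide_eq_0_iff mult_eq_0_iff power_eq_0_iff q_powers_distinct) simp_all
    \<comment> \<open>\<open>separate_pair\<close> yields the subtracted term, so the difference is
      turned around when the first term is wanted.\<close>
    have flip: "g - g' \<in> W \<Longrightarrow> g' - g \<in> W" for g g'
      using W vec.subspace_neg[of W "g - g'"] by (simp add: T_module_def)
    have up5: "w 5 (Suc (Suc i)) \<in> W" if "w 5 (Suc i) \<in> W" "Suc (Suc i) \<in> lv 5" for i
      using separate_pair[OF W flip[OF R[OF that(1), unfolded R_w5]] c5(3)] that(2) by simp
    have up6: "w 6 (Suc (Suc i)) \<in> W" if "w 5 (Suc i) \<in> W" "Suc i \<in> lv 5" for i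
      using separate_pair[OF W R[OF that(1), unfolded R_w5] c5(1)] that(2) D3 by (simp add: lv_def)
    have down6: "w 5 (Suc i) \<in> W" if "w 6 (Suc (Suc i)) \<in> W" "Suc i \<in> lv 5" for i
      using separate_pair[OF W L[OF that(1), unfolded L_w6] c5(2)] that(2) by simp
    have "\<exists>i\<in>lv 5. w 5 i \<in> W"
    proof -
      obtain l i where li: "a = (l, i)" "i \<in> lv l" "l = 5 \<or> l = 6" using a True by (auto simp: J_def)
      show ?thesis
      proof (cases "l = 5")
        case False
        then have l: "l = 6" "2 \<le> i" "i \<le> D" using li by (auto simp: lv_def)
        then obtain j where j: "i = Suc (Suc j)" using that[of "i - 2"] by simp
        then have "Suc j \<in> lv 5" using l by (simp add: lv_def)
        then show ?thesis using down6[of j] a li l j by auto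
      qed (use li a in auto)
    qed
    then obtain i where i: "i \<in> lv 5" "w 5 i \<in> W" by blast
    have all5: "w 5 j \<in> W" if "j \<in> lv 5" for j
    proof (rule interval_connected[of 1 "D - 1" "\<lambda>i. w 5 i \<in> W" i])
      show "w 5 l \<in> W \<longleftrightarrow> w 5 (Suc l) \<in> W" if "1 \<le> l" "l < D - 1" for l
      proof
        have l: "l \<in> lv 5" "Suc l \<in> lv 5" using that by (auto simp: lv_def)
        show "w 5 l \<in> W" if "w 5 (Suc l) \<in> W" using down[of l] l True that by simp
        obtain m where "l = Suc m" using l(1) by (cases l) (auto simp: lv_def)
        then show "w 5 (Suc l) \<in> W" if "w 5 l \<in> W" using up5[of m] l that by simp
      qed
    qed (use i that in \<open>auto simp: lv_def\<close>)
    obtain l j where lj: "b = (l, j)" "j \<in> lv l" "l = 5 \<or> l = 6" using b True by (auto simp: J_def)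
    show ?thesis
    proof (cases "l = 5")
      case False
      then have l: "l = 6" "2 \<le> j" "j \<le> D" using lj by (auto simp: lv_def)
      then obtain m where m: "j = Suc (Suc m)" using that[of "j - 2"] by simp
      then have "Suc m \<in> lv 5" using l by (simp add: lv_def)
      then show ?thesis using up6[of m] all5[of "Suc m"] lj l m by simp
    qed (use lj all5 in auto)
  qed
qed

lemma J_nonempty: "k \<in> {1..5} \<Longrightarrow> J k \<noteq> {}"
  using D3 by (auto simp: J_def lv_def)

lemma M_irreducible: "k \<in> {1..5} \<Longrightarrow> irreducible_T_module x (M k)"
  by (rule irreducible_span[OF J_subset J_nonempty M_T_module M_connected])

end

section \<open>Endpoints, diameters, local eigenvalues and the final formulas\<close>

context bf_modules
begin

lemma levels: "k \<in> {1..4} \<Longrightarrow> snd ` J k = lv k" "snd ` J 5 = {1..D}"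
proof -
  show "snd ` J k = lv k" if "k \<in> {1..4}"
  proof -
    have "J k = {k} \<times> lv k" using that by (auto simp: J_def)
    then show ?thesis by simp
  qed
  have "snd ` J 5 = {1..D - 1} \<union> {2..D}" by (simp add: J_def image_Un lv_simps)
  also have "\<dots> = {1..D}" using D3 by auto
  finally show "snd ` J 5 = {1..D}" .
qed

lemma M_thin: "k \<in> {1..4} \<Longrightarrow> thin x (M k)"
  unfolding thin_def
proof (intro allI impI)
  fix i assume k: "k \<in> {1..4}"
  then have "{a \<in> J k. snd a = i} \<subseteq> {(k, i)}" by (auto simp: J_def)
  then have "card {a \<in> J k. snd a = i} \<le> card {(k, i)}" by (intro card_mono) auto
  moreover have "J k \<subseteq> I" using k by (intro J_subset) auto
  ultimately show "vec.dim (Es_image x i (M k)) \<le> 1" by (simp add: dim_Es_image_span)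
qed

text \<open>Level 2 carries both \<open>w 5 2\<close> and \<open>w 6 2\<close>, the former because
  \<open>D \<ge> 3\<close>.\<close>

lemma M5_not_thin: "\<not> thin x (M 5)"
proof
  assume "thin x (M 5)"
  then have "vec.dim (Es_image x 2 (M 5)) \<le> 1" using D3 by (simp add: thin_def D)
  moreover have "{a \<in> J 5. snd a = 2} = {(5, 2), (6, 2)}" using D3 by (auto simp: J_def lv_simps)
  moreover have "J 5 \<subseteq> I" by (rule J_subset) simp
  ultimately show False by (simp add: dim_Es_image_span)
qed

lemma M_endpoint: "k \<in> {1..5} \<Longrightarrow> endpoint x (M k) = Min (snd ` J k)"
  unfolding endpoint_def by (simp only: module_support_span[OF J_subset])

lemma M_diameter: "k \<in> {1..5} \<Longrightarrow> module_diameter x (M k) = card (snd ` J k) - 1"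
  unfolding module_diameter_def by (simp only: module_support_span[OF J_subset])

lemma Min_interval: "a \<le> b \<Longrightarrow> Min {a..b} = a" for a b :: nat
  by (rule Min_eqI) auto

lemma endpoints: "endpoint x (M 1) = 0" "k \<in> {2..5} \<Longrightarrow> endpoint x (M k) = 1"
  "module_diameter x (M 1) = D" "module_diameter x (M 2) = D - 2" "module_diameter x (M 3) = D - 1"
  "module_diameter x (M 4) = D - 1" "module_diameter x (M 5) = D - 1"
proof -
  show "endpoint x (M 1) = 0" using levels(1)[of 1] M_endpoint[of 1] lv_simps(1) by (simp add: Min_interval)
  assume "k \<in> {2..5}"
  then have "k = 2 \<or> k = 3 \<or> k = 4 \<or> k = 5" by auto
  then show "endpoint x (M k) = 1"
    using D3 M_endpoint[of k] levels(1)[of k] levels(2)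
    by (elim disjE) (simp_all add: lv_simps Min_interval)
next
  show "module_diameter x (M 1) = D" "module_diameter x (M 2) = D - 2" "module_diameter x (M 3) = D - 1"
    "module_diameter x (M 4) = D - 1" "module_diameter x (M 5) = D - 1"
    using levels(1)[of 1] levels(1)[of 2] levels(1)[of 3] levels(1)[of 4] levels(2) M_diameter lv_simps(1)
    by (simp_all add: lv_simps(2-))
qed

lemma M_local_eigenvalue:
  assumes k: "k \<in> {2..5}" and ev: "ev k 1 = \<eta>"
  shows "has_local_eigenvalue x (M k) \<eta>"
proof -
  have JI: "J k \<subseteq> I" using k by (intro J_subset) auto
  have one: "{a \<in> J k. snd a = 1} = {(k, 1)}" using k D3 by (auto simp: J_def lv_def)
  have "(Fop x - mat \<eta>) *v g = 0" if "g \<in> Es_image x 1 (M k)" for g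
  proof -
    have "g \<in> vec.span {w k 1}" using that unfolding Es_image_span[OF JI] one by simp
    then obtain c where g: "g = c *s w k 1" by (auto simp: vec.span_singleton)
    have "k \<in> {1..6}" using k by auto
    then have "Fop x *v w k 1 = \<eta> *s w k 1" unfolding ev[symmetric] by (rule F_w) simp
    then have "Fop x *v g = \<eta> *s g"
      unfolding g vector_scalar_commute by (simp only: vector_smult_assoc mult.commute)
    then show ?thesis
      by (simp only: matrix_vector_mult_diff_rdistrib mat_mult_vector diff_self)
  qed
  moreover have "vec.dim (Es_image x 1 (M k)) = 1"
    unfolding dim_Es_image_span[OF JI] one by simp
  ultimately show ?thesis
    unfolding has_local_eigenvalue_def using endpoints(2)[OF k] by blast
qed

lemma local_eigenvalues: "ev 2 1 = Q - q - 1" "ev 3 1 = P - q - 1" "ev 4 1 = -1" "ev 5 1 = - q"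
  using q_nz by (simp_all add: ev_def anum_def edev_def)

text \<open>\<open>Es x 0\<close> projects onto the line of the basis vector at \<open>x\<close>,
  which is \<open>w 1 0\<close>. A module with endpoint 0 therefore contains \<open>w 1 0\<close>,
  hence all of \<open>M 1\<close> by connectedness, and irreducibility gives equality.\<close>

lemma M1_primary: "primary_T_module x (M 1)"
  unfolding primary_T_module_def
proof (intro conjI allI impI)
  show irr: "irreducible_T_module x (M 1)" by (rule M_irreducible) simp
  show "endpoint x (M 1) = 0" by (rule endpoints(1))
  fix W assume "irreducible_T_module x W \<and> endpoint x W = 0"
  then have W: "T_module x W" "W \<noteq> {0}" "endpoint x W = 0"
    and min: "\<And>W'. T_module x W' \<Longrightarrow> W' \<subseteq> W \<Longrightarrow> W' = {0} \<or> W' = W"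
    by (auto simp: irreducible_T_module_def)
  have sub: "vec.subspace W" using W by (simp add: T_module_def)
  have fin: "finite (module_support x W)" unfolding module_support_def by simp
  have image0: "Es_image x i W = {0}" if "\<forall>g\<in>W. Es x i *v g = 0" for i
    using that vec.subspace_0[OF sub] by (auto simp: Es_image_def image_iff)
  have ex: "\<exists>g\<in>W. Es x i *v g \<noteq> 0" if "i \<in> module_support x W" for i
    using that image0[of i] by (auto simp: module_support_def)
  \<comment> \<open>The endpoint is a \<open>Min\<close>, which is attained only on a nonempty
    support. A nonzero vector has a nonzero component on some level by
    \<open>Es_sum\<close>.\<close>
  have "module_support x W \<noteq> {}"
  proof
    assume "module_support x W = {}"
    then have 0: "Es_image x i W = {0}" if "i \<le> CARD('m)" for i
      using that by (auto simp: module_support_def)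
    have "g = 0" if g: "g \<in> W" for g
    proof -
      have "Es x i *v g = 0" if "i \<le> CARD('m)" for i
      proof -
        have "Es x i *v g \<in> Es_image x i W" unfolding Es_image_def using g by (rule imageI)
        then show ?thesis unfolding 0[OF that] by simp
      qed
      then have "(\<Sum>i = 0..CARD('m). Es x i *v g) = 0" by (intro sum.neutral) simp
      then show ?thesis unfolding Es_sum .
    qed
    then show False using W(2) vec.subspace_0[OF sub] by blast
  qed
  then have "0 \<in> module_support x W" using Min_in[OF fin] W(3) by (simp add: endpoint_def)
  from ex[OF this] obtain g where g: "g \<in> W" "Es x 0 *v g \<noteq> 0" by (elim bexE) (rule that)
  have e: "Es x 0 *v g = (g $ x) *s w 1 0"
    unfolding vec_eq_iff w_def wfun_simps vector_smult_component Es_apply bv_apply bf_dist_eq comb_def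
    by (auto simp: rank_zero_iff)
  have "Es x 0 *v g \<in> W" using W(1) ops_in_T_alg(1)[of 0 x] g unfolding T_module_def by blast
  moreover have "g $ x \<noteq> 0" using g(2) e by auto
  ultimately have "w 1 0 \<in> W" using scaled_in_module[OF W(1), of "g $ x" "w 1 0"] e by simp
  moreover have "(1, 0) \<in> J 1" using lv_simps(1) by (simp add: J_def)
  ultimately have "ww b \<in> W" if "b \<in> J 1" for b
    using M_connected[OF W(1), of 1 "(1, 0)" b] that by simp
  then have "ww ` J 1 \<subseteq> W" by blast
  then have "M 1 \<subseteq> W" using sub by (rule vec.span_minimal)
  then have "M 1 = {0} \<or> M 1 = W" using irr by (intro min) (simp add: irreducible_T_module_def)
  then show "W = M 1" using irr by (auto simp: irreducible_T_module_def)
qed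

lemma M_basis: "k \<in> {1..4} \<Longrightarrow> is_basis_family (w k) (lv k) (M k)"
proof -
  assume k: "k \<in> {1..4}"
  have "bij_betw (Pair k) (lv k) (J k)" using k by (auto simp: bij_betw_def inj_on_def J_def)
  from is_basis_family_reindex[OF basis_span[OF J_subset] this] show ?thesis using k by simp
qed

text \<open>The two families share levels, so they are indexed by a disjoint sum, matched with the
  pairs \<open>(5, i)\<close> and \<open>(6, i)\<close> of the graded family.\<close>

lemma M5_basis: "is_basis_family (case_sum (w 5) (w 6)) ({1..D - 1} <+> {2..D}) (M 5)"
proof -
  have "bij_betw (case_sum (Pair 5) (Pair 6)) ({1..D - 1} <+> {2..D}) (J 5)"
    unfolding bij_betw_def J_def lv_simps Plus_def image_Un image_image
    by (auto simp: inj_on_def split: sum.split_asm)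
  from is_basis_family_reindex[OF basis_span[OF J_subset] this]
  have "is_basis_family (\<lambda>a. ww (case_sum (Pair 5) (Pair 6) a)) ({1..D - 1} <+> {2..D}) (M 5)" by simp
  moreover have "(\<lambda>a. ww (case_sum (Pair 5) (Pair 6) a)) = case_sum (w 5) (w 6)"
    by (auto split: sum.split)
  ultimately show ?thesis by simp
qed

lemma w_in_image: "w k i \<in> Es_image x i (U_space x y)"
proof -
  have "Es x i *v w k i = w k i" by (simp add: w_def bv_ops(5))
  moreover have "w k i \<in> U_space x y" by (simp add: w_def wfun_in_U)
  ultimately show ?thesis unfolding Es_image_def by (metis imageI)
qed

lemma F_values:
  "Fop x *v w 1 i = anum q D N i *s w 1 i"
  "i \<ge> 1 \<Longrightarrow> Fop x *v w 2 i = (anum q D N i - q^(i-1) * (q^D - 1)) *s w 2 i"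
  "i \<ge> 1 \<Longrightarrow> Fop x *v w 3 i = (anum q D N i - q^(i-1) * (q^(N-D) - 1)) *s w 3 i"
  "i \<ge> 1 \<Longrightarrow> Fop x *v w 4 i = (anum q D N i - q^(i-1) * (q^(N-D) + q^D - q^i - q^(i-1))) *s w 4 i"
  "i \<ge> 1 \<Longrightarrow> Fop x *v w 5 i = (anum q D N i - q^(i-1) * (q^(N-D) + q^D - 2)) *s w 5 i"
  "i \<ge> 1 \<Longrightarrow> Fop x *v w 6 i = (anum q D N i - q^(i-1) * (q^(N-D) + q^D - q^i - q^(i-1) - 1 + inverse q)) *s w 6 i"
proof -
  have "ev 1 i = anum q D N i" by (simp add: ev_def edev_def)
  then show "Fop x *v w 1 i = anum q D N i *s w 1 i" using F_w[of 1 i] by simp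
  have d: "q ^ i / q = q ^ (i - 1)" if "i \<ge> 1" using q_power_div(1)[of "i - 1"] that by simp
  show "i \<ge> 1 \<Longrightarrow> Fop x *v w 2 i = (anum q D N i - q^(i-1) * (q^D - 1)) *s w 2 i"
    "i \<ge> 1 \<Longrightarrow> Fop x *v w 3 i = (anum q D N i - q^(i-1) * (q^(N-D) - 1)) *s w 3 i"
    "i \<ge> 1 \<Longrightarrow> Fop x *v w 4 i = (anum q D N i - q^(i-1) * (q^(N-D) + q^D - q^i - q^(i-1))) *s w 4 i"
    "i \<ge> 1 \<Longrightarrow> Fop x *v w 5 i = (anum q D N i - q^(i-1) * (q^(N-D) + q^D - 2)) *s w 5 i"
    "i \<ge> 1 \<Longrightarrow> Fop x *v w 6 i = (anum q D N i - q^(i-1) * (q^(N-D) + q^D - q^i - q^(i-1) - 1 + inverse q)) *s w 6 i"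
    using F_w[of _ i] by (simp_all add: ev_def edev_def d divide_inverse[of 1])
qed

lemma L_values:
  "i \<ge> 1 \<Longrightarrow> Lop x *v w 1 i = bnum q D N (i - 1) *s w 1 (i - 1)"
  "i \<ge> 1 \<Longrightarrow> Lop x *v w 2 i = ((q^D - q^i) * (q^(N-D) - q^(i-1)) / (q * (q - 1))) *s w 2 (i-1)"
  "i \<ge> 1 \<Longrightarrow> Lop x *v w 3 i = ((q^D - q^(i-1)) * (q^(N-D) - q^i) / (q * (q - 1))) *s w 3 (i-1)"
  "i \<ge> 1 \<Longrightarrow> Lop x *v w 4 i = ((q^D - q^(i-1)) * (q^(N-D) - q^(i-1)) / (q * (q - 1))) *s w 4 (i-1)"
  "i \<ge> 1 \<Longrightarrow> Lop x *v w 5 i = ((q^D - q^i) * (q^(N-D) - q^i) / (q - 1)) *s w 5 (i-1)"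
  "i \<ge> 2 \<Longrightarrow> Lop x *v w 6 i =
    ((q^i - 1) * (q^D - q^(i-1)) * (q^(N-D) - q^(i-1)) / ((q - 1) * (q^(i-1) - 1))) *s w 6 (i-1)
    - (q^(i-2) * (q^D - 1) * (q^(N-D) - 1) / (q^(i-1) - 1)) *s w 5 (i-1)"
  "Lop x *v w 6 2 = (- ((q^D - 1) * (q^(N-D) - 1) / (q - 1))) *s w 5 1"
proof -
  have b: "bnum q D N j = (P - q ^ j) * (Q - q ^ j) / (q - 1)" for j by (simp add: bnum_def mult.commute)
  assume "i \<ge> 1"
  then obtain j where j: "i = Suc j" by (cases i) auto
  show "Lop x *v w 1 i = bnum q D N (i - 1) *s w 1 (i - 1)"
    "Lop x *v w 2 i = ((q^D - q^i) * (q^(N-D) - q^(i-1)) / (q * (q - 1))) *s w 2 (i-1)"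
    "Lop x *v w 3 i = ((q^D - q^(i-1)) * (q^(N-D) - q^i) / (q * (q - 1))) *s w 3 (i-1)"
    "Lop x *v w 4 i = ((q^D - q^(i-1)) * (q^(N-D) - q^(i-1)) / (q * (q - 1))) *s w 4 (i-1)"
    "Lop x *v w 5 i = ((q^D - q^i) * (q^(N-D) - q^i) / (q - 1)) *s w 5 (i-1)"
    unfolding j b diff_Suc_1 by (rule L_w)+
next
  assume "i \<ge> 2"
  then obtain j where j: "i = Suc (Suc j)" using that[of "i - 2"] by simp
  then have "i - 1 = Suc j" "i - 2 = j" by simp_all
  then show "Lop x *v w 6 i =
    ((q^i - 1) * (q^D - q^(i-1)) * (q^(N-D) - q^(i-1)) / ((q - 1) * (q^(i-1) - 1))) *s w 6 (i-1)
    - (q^(i-2) * (q^D - 1) * (q^(N-D) - 1) / (q^(i-1) - 1)) *s w 5 (i-1)"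
    using L_w6[of j] unfolding j by (simp only:)
next
  \<comment> \<open>The general formula at level 2, where its first term contains
    \<open>w 6 1 = 0\<close>.\<close>
  show "Lop x *v w 6 2 = (- ((q^D - 1) * (q^(N-D) - 1) / (q - 1))) *s w 5 1"
    using L_w6[of 0] w6_1 by (simp add: numeral_2_eq_2 vec.scale_minus_left)
qed

lemma R_values:
  "Rop x *v w 1 i = cnum q (i+1) *s w 1 (i+1)"
  "Rop x *v w 2 i = (q^(i+1) * ((q^i - 1) / (q - 1))) *s w 2 (i+1)"
  "Rop x *v w 3 i = (q^(i+1) * ((q^i - 1) / (q - 1))) *s w 3 (i+1)"
  "Rop x *v w 4 i = (q^i * ((q^i - 1) / (q - 1))) *s w 4 (i+1)"
  "i \<ge> 1 \<Longrightarrow> Rop x *v w 5 i = (q^i * (q^i - 1)^2 / ((q - 1) * (q^(i+1) - 1))) *s w 5 (i+1)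
    - (q^(i-1) * (q - 1) / (q^(i+1) - 1)) *s w 6 (i+1)"
  "i \<ge> 1 \<Longrightarrow> Rop x *v w 6 i = (q^(i-1) * ((q^(i-1) - 1) / (q - 1))) *s w 6 (i+1)"
proof -
  assume "i \<ge> 1"
  then obtain j where j: "i = Suc j" by (cases i) auto
  show "Rop x *v w 5 i = (q^i * (q^i - 1)^2 / ((q - 1) * (q^(i+1) - 1))) *s w 5 (i+1)
    - (q^(i-1) * (q - 1) / (q^(i+1) - 1)) *s w 6 (i+1)"
    "Rop x *v w 6 i = (q^(i-1) * ((q^(i-1) - 1) / (q - 1))) *s w 6 (i+1)"
    unfolding j Suc_eq_plus1[symmetric] diff_Suc_1 by (rule R_w5, rule R_w6)
qed (simp_all only: R_w Suc_eq_plus1[symmetric])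

text \<open>The general recurrences with the vanishing vectors of \<open>w_top\<close>
  inserted.\<close>

lemma R_top: "k \<in> {1, 3, 4, 6} \<Longrightarrow> Rop x *v w k D = 0" "Rop x *v w 2 (D - 1) = 0"
  "Rop x *v w 5 (D - 1) = (- (q^(D-2) * ((q - 1) / (q^D - 1)))) *s w 6 D"
proof -
  have D: "D - 1 + 1 = D" "D - 1 - 1 = D - 2" "D - 1 \<ge> 1" "D \<ge> 1" using D3 by simp_all
  show "Rop x *v w 2 (D - 1) = 0" unfolding R_values(2)[of "D - 1"] D(1) w_top by simp
  show "Rop x *v w 5 (D - 1) = (- (q^(D-2) * ((q - 1) / (q^D - 1)))) *s w 6 D"
    unfolding R_values(5)[OF D(3)] D(1,2) w_top by (simp add: vec.scale_minus_left)
  assume "k \<in> {1, 3, 4, 6}"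
  then show "Rop x *v w k D = 0"
    using R_values(1,3,4)[of D] R_values(6)[OF D(4)] w_top(3) by auto
qed

end

theorem theorem8p15:
  fixes x y :: "'a::{finite,field}^'n^'m"
    and q :: complex
    and D N :: nat
  assumes q_def: "q = of_nat CARD('a)"
    and q_ne_2: "q \<noteq> 2"
    and rows: "CARD('m) = D"
    and cols: "CARD('n) = N - D"
    and N_gt: "N > 2 * D"
    and D_ge: "2 * D \<ge> 6"
    and adj: "bf_adj x y"
  shows "\<exists>W :: nat \<Rightarrow> (complex^('a^'n^'m)) set.
    orthogonal_direct_sum (U_space x y) {1..5} W \<and>
    (\<forall>k\<in>{1..5}. irreducible_T_module x (W k)) \<and>

    (primary_T_module x (W 1) \<and>
     thin x (W 1) \<and> endpoint x (W 1) = 0 \<and> module_diameter x (W 1) = D \<and>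
     (\<exists>w. is_basis_family w {0..D} (W 1) \<and>
       (\<forall>i\<in>{0..D}. w i \<in> Es_image x i (U_space x y)) \<and>
       (\<forall>i\<in>{0..D-1}. Rop x *v w i = cnum q (i+1) *s w (i+1)) \<and>
       Rop x *v w D = 0 \<and>
       (\<forall>i\<in>{1..D}. Lop x *v w i = bnum q D N (i-1) *s w (i-1)) \<and>
       Lop x *v w 0 = 0 \<and>
       (\<forall>i\<in>{0..D}. Fop x *v w i = anum q D N i *s w i))) \<and>

    (thin x (W 2) \<and> endpoint x (W 2) = 1 \<and> module_diameter x (W 2) = D - 2 \<and>
     has_local_eigenvalue x (W 2) (q^(N-D) - q - 1) \<and>
     (\<exists>w. is_basis_family w {1..D-1} (W 2) \<and>
       (\<forall>i\<in>{1..D-1}. w i \<in> Es_image x i (U_space x y)) \<and>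
       (\<forall>i\<in>{1..D-2}. Rop x *v w i = (q^(i+1) * ((q^i - 1) / (q - 1))) *s w (i+1)) \<and>
       Rop x *v w (D-1) = 0 \<and>
       (\<forall>i\<in>{2..D-1}. Lop x *v w i =
          ((q^D - q^i) * (q^(N-D) - q^(i-1)) / (q * (q - 1))) *s w (i-1)) \<and>
       Lop x *v w 1 = 0 \<and>
       (\<forall>i\<in>{1..D-1}. Fop x *v w i = (anum q D N i - q^(i-1) * (q^D - 1)) *s w i))) \<and>

    (thin x (W 3) \<and> endpoint x (W 3) = 1 \<and> module_diameter x (W 3) = D - 1 \<and>
     has_local_eigenvalue x (W 3) (q^D - q - 1) \<and>
     (\<exists>w. is_basis_family w {1..D} (W 3) \<and>
       (\<forall>i\<in>{1..D}. w i \<in> Es_image x i (U_space x y)) \<and>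
       (\<forall>i\<in>{1..D-1}. Rop x *v w i = (q^(i+1) * ((q^i - 1) / (q - 1))) *s w (i+1)) \<and>
       Rop x *v w D = 0 \<and>
       (\<forall>i\<in>{2..D}. Lop x *v w i =
          ((q^D - q^(i-1)) * (q^(N-D) - q^i) / (q * (q - 1))) *s w (i-1)) \<and>
       Lop x *v w 1 = 0 \<and>
       (\<forall>i\<in>{1..D}. Fop x *v w i = (anum q D N i - q^(i-1) * (q^(N-D) - 1)) *s w i))) \<and>

    (thin x (W 4) \<and> endpoint x (W 4) = 1 \<and> module_diameter x (W 4) = D - 1 \<and>
     has_local_eigenvalue x (W 4) (-1) \<and>
     (\<exists>w. is_basis_family w {1..D} (W 4) \<and>
       (\<forall>i\<in>{1..D}. w i \<in> Es_image x i (U_space x y)) \<and>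
       (\<forall>i\<in>{1..D-1}. Rop x *v w i = (q^i * ((q^i - 1) / (q - 1))) *s w (i+1)) \<and>
       Rop x *v w D = 0 \<and>
       (\<forall>i\<in>{2..D}. Lop x *v w i =
          ((q^D - q^(i-1)) * (q^(N-D) - q^(i-1)) / (q * (q - 1))) *s w (i-1)) \<and>
       Lop x *v w 1 = 0 \<and>
       (\<forall>i\<in>{1..D}. Fop x *v w i =
          (anum q D N i - q^(i-1) * (q^(N-D) + q^D - q^i - q^(i-1))) *s w i))) \<and>

    (\<not> thin x (W 5) \<and> endpoint x (W 5) = 1 \<and> module_diameter x (W 5) = D - 1 \<and>
     has_local_eigenvalue x (W 5) (- q) \<and>
     (\<exists>wm wp. is_basis_family (case_sum wm wp) ({1..D-1} <+> {2..D}) (W 5) \<and>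
       (\<forall>i\<in>{1..D-1}. wm i \<in> Es_image x i (U_space x y)) \<and>
       (\<forall>i\<in>{2..D}. wp i \<in> Es_image x i (U_space x y)) \<and>
       (\<forall>i\<in>{1..D-2}. Rop x *v wm i =
          (q^i * (q^i - 1)^2 / ((q - 1) * (q^(i+1) - 1))) *s wm (i+1)
          - (q^(i-1) * (q - 1) / (q^(i+1) - 1)) *s wp (i+1)) \<and>
       Rop x *v wm (D-1) = (- (q^(D-2) * ((q - 1) / (q^D - 1)))) *s wp D \<and>
       (\<forall>i\<in>{2..D-1}. Rop x *v wp i = (q^(i-1) * ((q^(i-1) - 1) / (q - 1))) *s wp (i+1)) \<and>
       Rop x *v wp D = 0 \<and>
       (\<forall>i\<in>{2..D-1}. Lop x *v wm i =
          ((q^D - q^i) * (q^(N-D) - q^i) / (q - 1)) *s wm (i-1)) \<and>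
       Lop x *v wm 1 = 0 \<and>
       (\<forall>i\<in>{3..D}. Lop x *v wp i =
          ((q^i - 1) * (q^D - q^(i-1)) * (q^(N-D) - q^(i-1)) / ((q - 1) * (q^(i-1) - 1))) *s wp (i-1)
          - (q^(i-2) * (q^D - 1) * (q^(N-D) - 1) / (q^(i-1) - 1)) *s wm (i-1)) \<and>
       Lop x *v wp 2 = (- ((q^D - 1) * (q^(N-D) - 1) / (q - 1))) *s wm 1 \<and>
       (\<forall>i\<in>{1..D-1}. Fop x *v wm i =
          (anum q D N i - q^(i-1) * (q^(N-D) + q^D - 2)) *s wm i) \<and>
       (\<forall>i\<in>{2..D}. Fop x *v wp i =
          (anum q D N i
           - q^(i-1) * (q^(N-D) + q^D - q^i - q^(i-1) - 1 + inverse q)) *s wp i)))"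
proof -
  \<comment> \<open>The edge itself supplies the two vectors: \<open>y - x\<close> has rank one and
    factors as \<open>outer u v\<close>, uniquely up to a scalar moved between the factors.\<close>
  have "rank (y - x) = 1" using adj by (simp add: bf_adj_def rank_diff_commute)
  then obtain u v where uv: "u \<noteq> 0" "v \<noteq> 0" "y - x = outer u v" by (rule rank_one_decomp)
  interpret bf_modules x y u v q D N
  proof unfold_locales
    show "y = x + outer u v" using uv(3) by (simp add: algebra_simps)
  qed (use assms uv in auto)
  note val = w_in_image F_values L_values R_values R_top L_bottom
  have part1: "\<exists>f. is_basis_family f {0..D} (M 1) \<and>
       (\<forall>i\<in>{0..D}. f i \<in> Es_image x i (U_space x y)) \<and>
       (\<forall>i\<in>{0..D-1}. Rop x *v f i = cnum q (i+1) *s f (i+1)) \<and>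
       Rop x *v f D = 0 \<and>
       (\<forall>i\<in>{1..D}. Lop x *v f i = bnum q D N (i-1) *s f (i-1)) \<and>
       Lop x *v f 0 = 0 \<and>
       (\<forall>i\<in>{0..D}. Fop x *v f i = anum q D N i *s f i)"
    by (rule exI[of _ "w 1"], intro conjI ballI) (rule M_basis[of 1, unfolded lv_simps] val; simp)+
  have part2: "\<exists>f. is_basis_family f {1..D-1} (M 2) \<and>
       (\<forall>i\<in>{1..D-1}. f i \<in> Es_image x i (U_space x y)) \<and>
       (\<forall>i\<in>{1..D-2}. Rop x *v f i = (q^(i+1) * ((q^i - 1) / (q - 1))) *s f (i+1)) \<and>
       Rop x *v f (D-1) = 0 \<and>
       (\<forall>i\<in>{2..D-1}. Lop x *v f i =
          ((q^D - q^i) * (q^(N-D) - q^(i-1)) / (q * (q - 1))) *s f (i-1)) \<and>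
       Lop x *v f 1 = 0 \<and>
       (\<forall>i\<in>{1..D-1}. Fop x *v f i = (anum q D N i - q^(i-1) * (q^D - 1)) *s f i)"
    by (rule exI[of _ "w 2"], intro conjI ballI) (rule M_basis[of 2, unfolded lv_simps] val; simp)+
  have part3: "\<exists>f. is_basis_family f {1..D} (M 3) \<and>
       (\<forall>i\<in>{1..D}. f i \<in> Es_image x i (U_space x y)) \<and>
       (\<forall>i\<in>{1..D-1}. Rop x *v f i = (q^(i+1) * ((q^i - 1) / (q - 1))) *s f (i+1)) \<and>
       Rop x *v f D = 0 \<and>
       (\<forall>i\<in>{2..D}. Lop x *v f i =
          ((q^D - q^(i-1)) * (q^(N-D) - q^i) / (q * (q - 1))) *s f (i-1)) \<and>
       Lop x *v f 1 = 0 \<and>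
       (\<forall>i\<in>{1..D}. Fop x *v f i = (anum q D N i - q^(i-1) * (q^(N-D) - 1)) *s f i)"
    by (rule exI[of _ "w 3"], intro conjI ballI) (rule M_basis[of 3, unfolded lv_simps] val; simp)+
  have part4: "\<exists>f. is_basis_family f {1..D} (M 4) \<and>
       (\<forall>i\<in>{1..D}. f i \<in> Es_image x i (U_space x y)) \<and>
       (\<forall>i\<in>{1..D-1}. Rop x *v f i = (q^i * ((q^i - 1) / (q - 1))) *s f (i+1)) \<and>
       Rop x *v f D = 0 \<and>
       (\<forall>i\<in>{2..D}. Lop x *v f i =
          ((q^D - q^(i-1)) * (q^(N-D) - q^(i-1)) / (q * (q - 1))) *s f (i-1)) \<and>
       Lop x *v f 1 = 0 \<and>
       (\<forall>i\<in>{1..D}. Fop x *v f i =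
          (anum q D N i - q^(i-1) * (q^(N-D) + q^D - q^i - q^(i-1))) *s f i)"
    by (rule exI[of _ "w 4"], intro conjI ballI) (rule M_basis[of 4, unfolded lv_simps] val; simp)+
  have part5: "\<exists>wm wp. is_basis_family (case_sum wm wp) ({1..D-1} <+> {2..D}) (M 5) \<and>
       (\<forall>i\<in>{1..D-1}. wm i \<in> Es_image x i (U_space x y)) \<and>
       (\<forall>i\<in>{2..D}. wp i \<in> Es_image x i (U_space x y)) \<and>
       (\<forall>i\<in>{1..D-2}. Rop x *v wm i =
          (q^i * (q^i - 1)^2 / ((q - 1) * (q^(i+1) - 1))) *s wm (i+1)
          - (q^(i-1) * (q - 1) / (q^(i+1) - 1)) *s wp (i+1)) \<and>
       Rop x *v wm (D-1) = (- (q^(D-2) * ((q - 1) / (q^D - 1)))) *s wp D \<and>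
       (\<forall>i\<in>{2..D-1}. Rop x *v wp i = (q^(i-1) * ((q^(i-1) - 1) / (q - 1))) *s wp (i+1)) \<and>
       Rop x *v wp D = 0 \<and>
       (\<forall>i\<in>{2..D-1}. Lop x *v wm i =
          ((q^D - q^i) * (q^(N-D) - q^i) / (q - 1)) *s wm (i-1)) \<and>
       Lop x *v wm 1 = 0 \<and>
       (\<forall>i\<in>{3..D}. Lop x *v wp i =
          ((q^i - 1) * (q^D - q^(i-1)) * (q^(N-D) - q^(i-1)) / ((q - 1) * (q^(i-1) - 1))) *s wp (i-1)
          - (q^(i-2) * (q^D - 1) * (q^(N-D) - 1) / (q^(i-1) - 1)) *s wm (i-1)) \<and>
       Lop x *v wp 2 = (- ((q^D - 1) * (q^(N-D) - 1) / (q - 1))) *s wm 1 \<and>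
       (\<forall>i\<in>{1..D-1}. Fop x *v wm i =
          (anum q D N i - q^(i-1) * (q^(N-D) + q^D - 2)) *s wm i) \<and>
       (\<forall>i\<in>{2..D}. Fop x *v wp i =
          (anum q D N i
           - q^(i-1) * (q^(N-D) + q^D - q^i - q^(i-1) - 1 + inverse q)) *s wp i)"
    by (rule exI[of _ "w 5"], rule exI[of _ "w 6"], intro conjI ballI) (rule M5_basis val; simp)+
  show ?thesis
    by (rule exI[of _ M], intro conjI ballI part1 part2 part3 part4 part5 M_direct_sum M1_primary M5_not_thin
        endpoints M_thin M_irreducible M_local_eigenvalue[OF _ local_eigenvalues(1)]
        M_local_eigenvalue[OF _ local_eigenvalues(2)] M_local_eigenvalue[OF _ local_eigenvalues(3)]
        M_local_eigenvalue[OF _ local_eigenvalues(4)]) simp_all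
qed

end
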